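(* Let $X_1,X_2,\dots$ be i.i.d. random variables whose distribution function is Pareto, $F(x)=1-x^{-\lambda}$ for $x\ge 1$, for some $\lambda>0$ (the null hypothesis $H_0$). Then for $a>0$ $$\lim_{n\to\infty} n^{-1}\ln P\bigl(I_n^{(4)}>a\bigr)=-f_I^{(4)}(a),$$ where the function $f_I^{(4)}$ is continuous for sufficiently small $a>0$, and $$f_I^{(4)}(a)\sim\frac{a^2}{50\,\Delta_4^2}\approx 3.875\,a^2\qquad\text{as } a\to 0,$$ where $\Delta_4^2=\frac{271}{52500}$.
   Context: For $n\ge 4$ and $t\ge 1$, let $$H_n(t)=\binom{n}{4}^{-1}\sum_{1\le i_1<i_2<i_3<i_4\le n}\mathbf 1\{X_{(4,\{i_1,\dots,i_4\})}/X_{(3,\{i_1,\dots,i_4\})}<t\},$$ where $X_{(s,\{i_1,\dots,i_4\})}$ is the $s$-th order statistic (in increasing order) of the subsample $X_{i_1},\dots,X_{i_4}$. Let $F_n(t)=n^{-1}\sum_{i=1}^n\mathbf 1(X_i<t)$ be the empirical distribution function. The statistic is $$I_n^{(4)}=\int_1^\infty (H_n(t)-F_n(t))\,dF_n(t)=\frac1n\sum_{i=1}^n\bigl(H_n(X_i)-F_n(X_i)\bigr).$$ The number $\Delta_4^2$ is $\int_1^\infty\psi_4^2(s)s^{-2}\,ds=\frac{271}{52500}$, where $\psi_4(s)=\frac{12\ln s}{5s}-\frac{4}{5s^3}+\frac{18}{5s^2}-\frac{13}{5s}-\frac{3}{10}$. The notation $f(a)\sim g(a)$ means $f(a)/g(a)\to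 1$; the decimal $3.875$ is a rounded value of $1/(50\Delta_4^2)$. *)

theory Defs
  imports "HOL-Probability.Probability"
begin

text \<open>A sample of size \<open>n\<close> is given by the values \<open>x 1, \<dots>, x n\<close> of a function
  \<open>x :: nat \<Rightarrow> real\<close>.\<close>

definition pareto_cdf :: "real \<Rightarrow> real \<Rightarrow> real" where
  "pareto_cdf lam x = (if x \<ge> 1 then 1 - x powr (- lam) else 0)"

text \<open>The order statistics of the subsample indexed by the finite set \<open>A\<close> are numbered from 1,
  whereas list positions are numbered from 0.\<close>

definition order_stat :: "nat \<Rightarrow> (nat \<Rightarrow> real) \<Rightarrow> nat set \<Rightarrow> real" where
  "order_stat s x A = sort (map x (sorted_list_of_set A)) ! (s - 1)"

definition H_emp :: "(nat \<Rightarrow> real) \<Rightarrow> nat \<Rightarrow> real \<Rightarrow> real" where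
  "H_emp x n t =
     (\<Sum>A | A \<subseteq> {1..n} \<and> card A = 4. of_bool (order_stat 4 x A / order_stat 3 x A < t))
       / real (n choose 4)"

definition F_emp :: "(nat \<Rightarrow> real) \<Rightarrow> nat \<Rightarrow> real \<Rightarrow> real" where
  "F_emp x n t = (\<Sum>i = 1..n. of_bool (x i < t)) / real n"

definition I_stat :: "(nat \<Rightarrow> real) \<Rightarrow> nat \<Rightarrow> real" where
  "I_stat x n = (\<Sum>i = 1..n. H_emp x n (x i) - F_emp x n (x i)) / real n"

definition psi4 :: "real \<Rightarrow> real" where
  "psi4 s = 12 * ln s / (5 * s) - 4 / (5 * s ^ 3) + 18 / (5 * s ^ 2) - 13 / (5 * s) - 3 / 10"

definition Delta4_sq :: real where
  "Delta4_sq = (LBINT s:{1..}. (psi4 s)\<^sup>2 / s\<^sup>2)"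

text \<open>The logarithm of a probability, with the convention \<open>ln 0 = -\<infinity>\<close>. The library's real
  logarithm has \<open>ln 0 = 0\<close>, which would be wrong here: \<open>I_stat\<close> is bounded, so the probability
  that it exceeds a large level is 0.\<close>

definition eln :: "real \<Rightarrow> ereal" where
  "eln p = (if p > 0 then ereal (ln p) else - \<infinity>)"

end

theory Submission
  imports Defs "HOL-Library.Multiset" "HOL-Real_Asymp.Real_Asymp"
begin

text \<open>
  Put \<open>Y\<^sub>i = lam * ln X\<^sub>i\<close>. Under the null hypothesis the \<open>Y\<^sub>i\<close> are independent standard exponentials, and a
  quadruple contributes to \<open>H\<^sub>n (X\<^sub>l)\<close> exactly when the gap between its two largest \<open>Y\<close> is below \<open>Y\<^sub>l\<close>.
  It fails to contribute when one of its members \<open>i\<close> satisfies \<open>Y\<^sub>j + Y\<^sub>l \<le> Y\<^sub>i\<close> for the three others, so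
  almost surely \<open>I\<^sub>n = 1/2 + 1/(2n) - Q\<^sub>n\<close>, where \<open>Q\<^sub>n\<close> is the fraction of failing pairs (quadruple, \<open>l\<close>).
  Up to \<open>O(1/n)\<close>, \<open>Q\<^sub>n\<close> is a polynomial \<open>\<Phi>\<close> of degree five in the empirical law:
  \<open>\<Phi> q = 4 \<Sum>\<^sub>x \<Sum>\<^sub>y q\<^sub>x q\<^sub>y (\<Sum>\<^bsub>u + y \<le> x\<^esub> q\<^sub>u)\<^sup>3\<close> (\<open>fail_prob\<close>). The event \<open>I\<^sub>n > a\<close> thus asks that the
  empirical law has \<open>\<Phi> < 1/2 - a\<close>, while the true law has \<open>\<Phi> = 1/2\<close>.

  \<^bold>\<open>Reduction to finite alphabets.\<close> Cut the half line into cells of width \<open>d\<close>. By lack of memory, moving every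
  \<open>Y\<^sub>i\<close> up by two cells costs only a factor \<open>e\<^bsup>-2dn\<^esup>\<close>, and this shift absorbs every rounding error in the
  comparison \<open>Y\<^sub>j + Y\<^sub>l \<le> Y\<^sub>i\<close>. Hence the tail probability lies between two probabilities of events about words
  over a finite alphabet, whose weights differ by \<open>e\<^bsup>-2dn\<^esup>\<close> and a factor per letter in the last, unbounded cell
  (\<open>sandwiched\<close>). The latter is harmless because that cell is rarely used.

  \<^bold>\<open>Existence and continuity of the rate.\<close> There are only polynomially many types (multisets of letters) of
  length \<open>n\<close>, so an event of probability \<open>e\<^bsup>-Rn\<^esup>\<close> contains a type of about that probability. Types of
  fixed composition can be concatenated, which makes their probabilities supermultiplicative: one good type at one
  length yields good types at all large lengths. The limit could still fail to exist if \<open>\<Phi>\<close> had a local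
  minimum with value \<open>1/2 - a\<close>; \<open>fail_prob_improve\<close> excludes this. If adding a little mass at a letter and
  normalising never decreases \<open>\<Phi> q > 0\<close> to first order, then by Euler's identity all partial derivatives on
  the support equal \<open>5 \<Phi> q\<close>, in particular the one at the largest letter \<open>M\<close> of the support; but \<open>\<Phi>\<close> is
  linear in the mass of \<open>M\<close>, so adding mass \<open>t\<close> there turns
  \<open>\<Phi>\<close> into \<open>\<Phi> (1 + 5 t)/(1 + t)\<^sup>5 < \<Phi>\<close>. Together this gives \<open>tail_transfer\<close>: a frequent
  exponential lower bound at levels below \<open>a\<close> implies almost the same bound for all large \<open>n\<close> at a level
  above \<open>a\<close>. Existence of the limit, its independence of the model and its continuity for \<open>a < 1/2\<close> follow. For
  \<open>a > 1/2\<close> the tail vanishes eventually, and at \<open>a = 1/2\<close> almost all of the sample has to lie in an octave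
  \<open>[m, 2 m)\<close>, whose probability is at most \<open>1/4\<close>, so the limit is \<open>- ln 4\<close>.

  \<^bold>\<open>Small levels.\<close> Near the true law \<open>\<Phi>\<close> is linear up to a quadratic error in the \<open>\<ell>\<^sub>1\<close> distance
  (\<open>fail_prob_expansion\<close>), and the distance exceeds \<open>8 a\<close> with negligible probability. The rate is therefore that of
  a mean of independent bounded variables: a Chernoff bound and a tilted law give
  the exponent \<open>a\<^sup>2/(2 V)\<close>, with \<open>V\<close> the variance of the derivative of \<open>\<Phi>\<close> (\<open>rate_quadratic\<close>). As the cells shrink, the
  derivative tends to \<open>5/2 - 5 psi4\<close> (\<open>fail_deriv_tendsto\<close>), so \<open>V\<close> tends to \<open>25 Delta4_sq\<close>.
\<close>

section \<open>The failure polynomial\<close>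

definition low :: "nat set \<Rightarrow> (nat \<Rightarrow> real) \<Rightarrow> nat \<Rightarrow> nat \<Rightarrow> real" where
  "low S q x y = (\<Sum>u | u \<in> S \<and> u + y \<le> x. q u)"

text \<open>The probability, under the law \<open>q\<close>, that the gap between the two largest of four letters is at least a fifth
  one: \<open>x\<close> is the largest of the four (hence the factor 4), \<open>y\<close> the fifth, and the three others are at most \<open>x - y\<close>.
  For positive letters at most one of the four can play the role of \<open>x\<close>. It is used for unnormalised \<open>q\<close> as well.\<close>

definition fail_prob :: "nat set \<Rightarrow> (nat \<Rightarrow> real) \<Rightarrow> real" where
  "fail_prob S q = 4 * (\<Sum>x\<in>S. \<Sum>y\<in>S. q x * q y * low S q x y ^ 3)"

text \<open>The partial derivative of \<open>fail_prob\<close> with respect to the mass of \<open>k\<close>: the letter \<open>k\<close> may take the role of the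
  largest letter, of the threshold, or of one of the three smaller letters.\<close>

definition fail_deriv :: "nat set \<Rightarrow> (nat \<Rightarrow> real) \<Rightarrow> nat \<Rightarrow> real" where
  "fail_deriv S q k = 4 * ((\<Sum>y\<in>S. q y * low S q k y ^ 3) + (\<Sum>x\<in>S. q x * low S q x k ^ 3)
     + 3 * (\<Sum>x\<in>S. \<Sum>y\<in>S. q x * q y * low S q x y ^ 2 * of_bool (k + y \<le> x)))"

lemma low_alt: "finite S \<Longrightarrow> low S q x y = (\<Sum>u\<in>S. of_bool (u + y \<le> x) * q u)"
  unfolding low_def by (intro sum.mono_neutral_cong_left) auto

lemma abs_low_le:
  assumes "finite S" shows "\<bar>low S q x y\<bar> \<le> (\<Sum>v\<in>S. \<bar>q v\<bar>)"
proof -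
  have "\<bar>low S q x y\<bar> \<le> (\<Sum>u | u \<in> S \<and> u + y \<le> x. \<bar>q u\<bar>)" unfolding low_def by (rule sum_abs)
  also have "\<dots> \<le> (\<Sum>v\<in>S. \<bar>q v\<bar>)" by (rule sum_mono2) (use assms in auto)
  finally show ?thesis .
qed

lemma low_nonneg: "(\<And>v. v \<in> S \<Longrightarrow> q v \<ge> 0) \<Longrightarrow> low S q x y \<ge> 0"
  unfolding low_def by (rule sum_nonneg) auto

lemma low_le_1:
  assumes "finite S" "\<And>v. v \<in> S \<Longrightarrow> q v \<ge> 0" "sum q S = 1"
  shows "low S q x y \<le> 1"
proof -
  have "low S q x y \<le> sum q S" unfolding low_def by (rule sum_mono2) (use assms in auto)
  then show ?thesis using assms by simp
qed

lemma low_add: "finite S \<Longrightarrow> low S (\<lambda>v. q v + \<sigma> v) x y = low S q x y + low S \<sigma> x y"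
  unfolding low_def by (simp add: sum.distrib)

lemma low_scale: "low S (\<lambda>v. c * q v) x y = c * low S q x y"
  unfolding low_def by (simp add: sum_distrib_left)

lemma fail_prob_scale: "fail_prob S (\<lambda>v. c * q v) = c ^ 5 * fail_prob S q"
  unfolding fail_prob_def low_scale
  by (simp add: sum_distrib_left power_mult_distrib algebra_simps eval_nat_numeral)

lemma fail_prob_nonneg: "(\<And>v. v \<in> S \<Longrightarrow> q v \<ge> 0) \<Longrightarrow> fail_prob S q \<ge> 0"
  unfolding fail_prob_def by (intro mult_nonneg_nonneg sum_nonneg) (auto intro!: low_nonneg)

lemma tendsto_fail_prob:
  assumes "\<And>v. v \<in> S \<Longrightarrow> ((\<lambda>n. q n v) \<longlongrightarrow> r v) F"
  shows "((\<lambda>n. fail_prob S (q n)) \<longlongrightarrow> fail_prob S r) F"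
  unfolding fail_prob_def low_def by (intro tendsto_intros) (auto intro!: assms)

lemma fail_deriv_linear:
  assumes S: "finite S"
  shows "(\<Sum>k\<in>S. fail_deriv S q k * \<sigma> k) =
    4 * (\<Sum>x\<in>S. \<Sum>y\<in>S. \<sigma> x * q y * low S q x y ^ 3 + q x * \<sigma> y * low S q x y ^ 3
       + 3 * q x * q y * low S q x y ^ 2 * low S \<sigma> x y)"
proof -
  let ?c = "\<lambda>k x y. q x * q y * low S q x y ^ 2 * of_bool (k + y \<le> x) :: real"
  have 1: "(\<Sum>k\<in>S. (\<Sum>x\<in>S. q x * low S q x k ^ 3) * \<sigma> k) = (\<Sum>x\<in>S. \<Sum>y\<in>S. q x * \<sigma> y * low S q x y ^ 3)"
    by (simp add: sum_distrib_right sum_distrib_left) (subst sum.swap, simp add: mult_ac)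
  have "(\<Sum>k\<in>S. (\<Sum>x\<in>S. \<Sum>y\<in>S. ?c k x y) * \<sigma> k) = (\<Sum>k\<in>S. \<Sum>x\<in>S. \<Sum>y\<in>S. ?c k x y * \<sigma> k)"
    by (simp add: sum_distrib_right)
  also have "\<dots> = (\<Sum>x\<in>S. \<Sum>k\<in>S. \<Sum>y\<in>S. ?c k x y * \<sigma> k)" by (rule sum.swap)
  also have "\<dots> = (\<Sum>x\<in>S. \<Sum>y\<in>S. \<Sum>k\<in>S. ?c k x y * \<sigma> k)" by (intro sum.cong refl sum.swap)
  also have "\<dots> = (\<Sum>x\<in>S. \<Sum>y\<in>S. q x * q y * low S q x y ^ 2 * low S \<sigma> x y)"
    by (intro sum.cong refl) (simp add: low_alt[OF S, of \<sigma>] sum_distrib_left mult_ac)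
  finally have 2: "(\<Sum>k\<in>S. (\<Sum>x\<in>S. \<Sum>y\<in>S. ?c k x y) * \<sigma> k)
      = (\<Sum>x\<in>S. \<Sum>y\<in>S. q x * q y * low S q x y ^ 2 * low S \<sigma> x y)" .
  have 3: "(\<Sum>k\<in>S. (\<Sum>y\<in>S. q y * low S q k y ^ 3) * \<sigma> k) = (\<Sum>x\<in>S. \<Sum>y\<in>S. \<sigma> x * q y * low S q x y ^ 3)"
    by (simp add: sum_distrib_right sum_distrib_left mult_ac)
  have "fail_deriv S q k * \<sigma> k = 4 * ((\<Sum>y\<in>S. q y * low S q k y ^ 3) * \<sigma> k
      + (\<Sum>x\<in>S. q x * low S q x k ^ 3) * \<sigma> k
      + 3 * ((\<Sum>x\<in>S. \<Sum>y\<in>S. ?c k x y) * \<sigma> k))" for k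
    unfolding fail_deriv_def by (simp only: ring_distribs mult.assoc)
  then have "(\<Sum>k\<in>S. fail_deriv S q k * \<sigma> k) = 4 * ((\<Sum>k\<in>S. (\<Sum>y\<in>S. q y * low S q k y ^ 3) * \<sigma> k)
      + (\<Sum>k\<in>S. (\<Sum>x\<in>S. q x * low S q x k ^ 3) * \<sigma> k)
      + 3 * (\<Sum>k\<in>S. (\<Sum>x\<in>S. \<Sum>y\<in>S. ?c k x y) * \<sigma> k))"
    by (simp only: sum_distrib_left[symmetric] sum.distrib)
  then show ?thesis unfolding 1 2 3 by (simp add: sum.distrib sum_distrib_left ring_distribs mult_ac)
qed

lemma fail_deriv_euler:
  assumes "finite S" shows "(\<Sum>k\<in>S. fail_deriv S q k * q k) = 5 * fail_prob S q"
proof -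
  have *: "q x * q y * low S q x y ^ 3 + q x * q y * low S q x y ^ 3
       + 3 * q x * q y * low S q x y ^ 2 * low S q x y = 5 * (q x * q y * low S q x y ^ 3)" for x y
    by (simp add: eval_nat_numeral)
  show ?thesis unfolding fail_deriv_linear[OF assms] fail_prob_def * by (simp add: sum_distrib_left)
qed

text \<open>The factor \<open>(L + \<Lambda>)\<^sup>3\<close> equals \<open>L\<^sup>3 + 3 L\<^sup>2 \<Lambda>\<close> up to \<open>4 s\<^sup>2\<close>; each remaining product
  contains at least two small factors.\<close>

lemma fail_prob_expansion_term:
  fixes L \<Lambda> s :: real
  assumes L: "0 \<le> L" "L \<le> 1" and \<Lambda>: "\<bar>\<Lambda>\<bar> \<le> s" and s: "s \<le> 1" and q: "0 \<le> a" "0 \<le> b"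
  shows "\<bar>(a + \<sigma>) * (b + \<tau>) * (L + \<Lambda>) ^ 3 - a * b * L ^ 3
      - (\<sigma> * b * L ^ 3 + a * \<tau> * L ^ 3 + 3 * a * b * L ^ 2 * \<Lambda>)\<bar>
    \<le> 8 * (\<bar>\<sigma>\<bar> * \<bar>\<tau>\<bar>) + 7 * s * (\<bar>\<sigma>\<bar> * b) + 7 * s * (a * \<bar>\<tau>\<bar>) + 4 * s\<^sup>2 * (a * b)"
proof -
  define \<rho> where "\<rho> = 3 * L * \<Lambda>\<^sup>2 + \<Lambda> ^ 3"
  have s0: "0 \<le> s" using \<Lambda> by linarith
  have \<Lambda>2: "\<Lambda>\<^sup>2 \<le> s\<^sup>2" using \<Lambda> s0 by (metis abs_le_square_iff abs_of_nonneg)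
  have "\<bar>\<rho>\<bar> \<le> 3 * L * \<Lambda>\<^sup>2 + \<bar>\<Lambda>\<bar> * \<Lambda>\<^sup>2"
    unfolding \<rho>_def using L by (intro order_trans[OF abs_triangle_ineq]) (simp add: abs_mult power_abs eval_nat_numeral)
  also have "\<dots> \<le> 3 * 1 * s\<^sup>2 + 1 * s\<^sup>2"
    using L \<Lambda> s \<Lambda>2 by (intro add_mono mult_mono) auto
  finally have \<rho>: "\<bar>\<rho>\<bar> \<le> 4 * s\<^sup>2" by simp
  have "s\<^sup>2 \<le> s" using s s0 by (simp add: power2_eq_square mult_left_le)
  have "\<bar>3 * L\<^sup>2 * \<Lambda>\<bar> \<le> 3 * 1 * s"
    using L \<Lambda> mult_mono[of "L\<^sup>2" 1 "\<bar>\<Lambda>\<bar>" s] power_le_one[of L 2] s0 by (simp add: abs_mult)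
  then have \<kappa>: "\<bar>3 * L\<^sup>2 * \<Lambda> + \<rho>\<bar> \<le> 7 * s" using \<rho> \<open>s\<^sup>2 \<le> s\<close> by linarith
  have "\<bar>L + \<Lambda>\<bar> \<le> 2" using L \<Lambda> s by linarith
  then have c: "\<bar>(L + \<Lambda>) ^ 3\<bar> \<le> 8" using power_mono[of "\<bar>L+\<Lambda>\<bar>" 2 3] by (simp add: power_abs)
  have eq: "(a + \<sigma>) * (b + \<tau>) * (L + \<Lambda>) ^ 3 - a * b * L ^ 3
      - (\<sigma> * b * L ^ 3 + a * \<tau> * L ^ 3 + 3 * a * b * L ^ 2 * \<Lambda>)
     = \<sigma> * \<tau> * (L + \<Lambda>) ^ 3 + (\<sigma> * b) * (3 * L\<^sup>2 * \<Lambda> + \<rho>) + (a * \<tau>) * (3 * L\<^sup>2 * \<Lambda> + \<rho>) + (a * b) * \<rho>"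
    unfolding \<rho>_def by (simp add: eval_nat_numeral algebra_simps)
  have "\<bar>\<sigma> * \<tau> * (L + \<Lambda>) ^ 3\<bar> \<le> (\<bar>\<sigma>\<bar> * \<bar>\<tau>\<bar>) * 8" using c by (simp add: abs_mult mult_left_mono)
  moreover have "\<bar>(\<sigma> * b) * (3 * L\<^sup>2 * \<Lambda> + \<rho>)\<bar> \<le> (\<bar>\<sigma>\<bar> * b) * (7 * s)"
    using \<kappa> q by (simp add: abs_mult mult_left_mono del: mult.assoc)
  moreover have "\<bar>(a * \<tau>) * (3 * L\<^sup>2 * \<Lambda> + \<rho>)\<bar> \<le> (a * \<bar>\<tau>\<bar>) * (7 * s)"
    using \<kappa> q by (simp add: abs_mult mult_left_mono)
  moreover have "\<bar>(a * b) * \<rho>\<bar> \<le> (a * b) * (4 * s\<^sup>2)"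
    using \<rho> q by (simp add: abs_mult mult_left_mono)
  moreover have "\<bar>A + B + C + D\<bar> \<le> \<bar>A\<bar> + \<bar>B\<bar> + \<bar>C\<bar> + \<bar>D\<bar>" for A B C D :: real by linarith
  ultimately show ?thesis unfolding eq by (smt (verit) mult.commute)
qed

text \<open>Summing the termwise bound gives \<open>8 + 7 + 7 + 4 = 26\<close> times \<open>s\<^sup>2\<close>, and the factor 4 in \<open>fail_prob\<close> makes it 104.\<close>

lemma fail_prob_expansion:
  assumes S: "finite S" and q: "\<And>v. v \<in> S \<Longrightarrow> q v \<ge> 0" "sum q S = 1"
    and s: "(\<Sum>v\<in>S. \<bar>\<sigma> v\<bar>) \<le> s" "s \<le> 1"
  shows "\<bar>fail_prob S (\<lambda>v. q v + \<sigma> v) - fail_prob S q - (\<Sum>k\<in>S. fail_deriv S q k * \<sigma> k)\<bar> \<le> 104 * s\<^sup>2"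
proof -
  have s0: "0 \<le> s" using s by (meson order_trans sum_nonneg abs_ge_zero)
  define T where "T x y = (q x + \<sigma> x) * (q y + \<sigma> y) * low S (\<lambda>v. q v + \<sigma> v) x y ^ 3 - q x * q y * low S q x y ^ 3
      - (\<sigma> x * q y * low S q x y ^ 3 + q x * \<sigma> y * low S q x y ^ 3 + 3 * q x * q y * low S q x y ^ 2 * low S \<sigma> x y)" for x y
  let ?B = "\<lambda>x y. 8 * (\<bar>\<sigma> x\<bar> * \<bar>\<sigma> y\<bar>) + 7 * s * (\<bar>\<sigma> x\<bar> * q y) + 7 * s * (q x * \<bar>\<sigma> y\<bar>) + 4 * s\<^sup>2 * (q x * q y)"
  have T: "\<bar>T x y\<bar> \<le> ?B x y" if "x \<in> S" "y \<in> S" for x y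
    unfolding T_def low_add[OF S]
    by (rule fail_prob_expansion_term)
       (use that q s low_nonneg[of S q] low_le_1[OF S q] abs_low_le[OF S, of \<sigma> x y] in auto)
  define s' where "s' = (\<Sum>v\<in>S. \<bar>\<sigma> v\<bar>)"
  have s': "0 \<le> s'" "s' \<le> s" using s by (auto simp: s'_def intro: sum_nonneg)
  have prod: "(\<Sum>x\<in>S. \<Sum>y\<in>S. c * (f x * g y)) = c * (sum f S * sum g S)" for c and f g :: "nat \<Rightarrow> real"
    by (simp add: sum_product) (simp add: sum_distrib_left)
  have "\<bar>\<Sum>x\<in>S. \<Sum>y\<in>S. T x y\<bar> \<le> (\<Sum>x\<in>S. \<Sum>y\<in>S. ?B x y)"
    by (rule order_trans[OF sum_abs], rule sum_mono, rule order_trans[OF sum_abs], rule sum_mono, rule T)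
  also have "\<dots> = 8 * (s' * s') + 7 * s * (s' * 1) + 7 * s * (1 * s') + 4 * s\<^sup>2 * (1 * 1)"
    unfolding sum.distrib prod q(2) s'_def ..
  also have "\<dots> \<le> 8 * (s * s) + 7 * s * (s * 1) + 7 * s * (1 * s) + 4 * s\<^sup>2 * (1 * 1)"
    using s' s0 by (intro add_mono mult_mono) auto
  also have "\<dots> = 26 * s\<^sup>2" by (simp add: power2_eq_square)
  finally have "\<bar>\<Sum>x\<in>S. \<Sum>y\<in>S. T x y\<bar> \<le> 26 * s\<^sup>2" .
  moreover have "fail_prob S (\<lambda>v. q v + \<sigma> v) - fail_prob S q - (\<Sum>k\<in>S. fail_deriv S q k * \<sigma> k)
      = 4 * (\<Sum>x\<in>S. \<Sum>y\<in>S. T x y)"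
    unfolding fail_deriv_linear[OF S] fail_prob_def T_def sum_subtractf by (simp add: algebra_simps)
  ultimately show ?thesis by (simp add: abs_mult)
qed

text \<open>As all letters are positive, the largest letter \<open>M\<close> that occurs can neither be a threshold nor a smaller letter
  in a failing configuration; it enters only as the maximum, hence linearly.\<close>

lemma fail_prob_top_linear:
  assumes S: "finite S" "\<And>v. v \<in> S \<Longrightarrow> v \<ge> 1" and M: "M \<in> S" and top: "\<And>v. v \<in> S \<Longrightarrow> v > M \<Longrightarrow> q v = 0"
  shows "fail_prob S (\<lambda>v. q v + t * of_bool (v = M)) = fail_prob S q + t * fail_deriv S q M"
proof -
  let ?q = "\<lambda>v. q v + t * of_bool (v = M)"
  have l: "low S ?q x y = low S q x y" if "x \<le> M" "y \<in> S" for x y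
    unfolding low_def using that S(2)[of y] by (intro sum.cong) auto
  have lowM: "low S q x M = 0" if "x \<le> M" for x
  proof -
    have "{u \<in> S. u + M \<le> x} = {}" using S(2) that by force
    then show ?thesis unfolding low_def by (metis sum.empty)
  qed
  have z1: "q x * low S q x M ^ 3 = 0" if "x \<in> S" for x
    using top[OF that] lowM[of x] by (cases "x > M") auto
  have z2: "?q x * ?q y * low S ?q x y ^ 3
      = (q x + t * of_bool (x = M)) * q y * low S q x y ^ 3" if "x \<in> S" "y \<in> S" for x y
  proof (cases "x > M")
    case True then show ?thesis using top that by auto
  next
    case False
    moreover have "low S q x M = 0" using False lowM by simp
    ultimately show ?thesis using l[of x y] that by auto
  qed
  have z3: "q x * q y * (low S q x y)\<^sup>2 * of_bool (M + y \<le> x) = 0" if "x \<in> S" "y \<in> S" for x y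
    using that top[of x] S(2)[of y] by (cases "x > M") auto
  have "(\<Sum>x\<in>S. \<Sum>y\<in>S. ?q x * ?q y * low S ?q x y ^ 3)
     = (\<Sum>x\<in>S. \<Sum>y\<in>S. q x * q y * low S q x y ^ 3 + of_bool (x = M) * (t * q y * low S q x y ^ 3))"
    by (intro sum.cong refl) (simp only: z2, simp add: algebra_simps)
  also have "\<dots> = (\<Sum>x\<in>S. \<Sum>y\<in>S. q x * q y * low S q x y ^ 3) + (\<Sum>x\<in>S. of_bool (x = M) * (\<Sum>y\<in>S. t * q y * low S q x y ^ 3))"
    by (simp add: sum.distrib sum_distrib_left)
  also have "(\<Sum>x\<in>S. of_bool (x = M) * (\<Sum>y\<in>S. t * q y * low S q x y ^ 3)) = (\<Sum>y\<in>S. t * q y * low S q M y ^ 3)"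
    using S M by (simp add: of_bool_def if_distrib if_distribR sum.delta cong: if_cong)
  finally have "(\<Sum>x\<in>S. \<Sum>y\<in>S. ?q x * ?q y * low S ?q x y ^ 3)
     = (\<Sum>x\<in>S. \<Sum>y\<in>S. q x * q y * low S q x y ^ 3) + t * (\<Sum>y\<in>S. q y * low S q M y ^ 3)"
    by (simp only: sum_distrib_left mult.assoc)
  moreover have "(\<Sum>x\<in>S. q x * low S q x M ^ 3) = 0"
    by (rule sum.neutral) (use z1 in blast)
  moreover have "(\<Sum>x\<in>S. \<Sum>y\<in>S. q x * q y * (low S q x y)\<^sup>2 * of_bool (M + y \<le> x)) = 0"
    by (intro sum.neutral ballI) (use z3 in blast)
  ultimately show ?thesis
    unfolding fail_prob_def fail_deriv_def by (simp add: ring_distribs)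
qed

text \<open>There are no local minima of the normalised failure probability with a positive value: adding a little mass at
  a single letter always decreases it strictly. Either some derivative is below \<open>5 * fail_prob S q\<close>, the value that
  homogeneity prescribes on average, or all derivatives on the support equal this value, and then exact linearity in the
  mass of the largest letter beats the normalisation \<open>(1 + t)\<^sup>5\<close>.\<close>

lemma fail_prob_improve:
  assumes S: "finite S" "\<And>v. v \<in> S \<Longrightarrow> v \<ge> 1" and q: "\<And>v. v \<in> S \<Longrightarrow> q v \<ge> 0" "sum q S = 1"
    and b: "fail_prob S q \<le> b" "b > 0" and t0: "t0 > 0"
  shows "\<exists>k\<in>S. \<exists>t. 0 < t \<and> t < t0 \<and> fail_prob S (\<lambda>v. q v + t * of_bool (v = k)) < b * (1 + t) ^ 5"
proof (cases "\<exists>k\<in>S. fail_deriv S q k < 5 * fail_prob S q \<or> fail_prob S q < b")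
  case True
  then obtain k where k: "k \<in> S" "fail_deriv S q k < 5 * fail_prob S q \<or> fail_prob S q < b" by auto
  let ?\<Phi> = "fail_prob S q" and ?D = "fail_deriv S q k"
  have ex: "\<bar>fail_prob S (\<lambda>v. q v + t * of_bool (v = k)) - ?\<Phi> - ?D * t\<bar> \<le> 104 * t\<^sup>2" if "0 < t" "t \<le> 1" for t
  proof -
    have "(\<Sum>v\<in>S. \<bar>t * of_bool (v = k)\<bar>) = t" "(\<Sum>v\<in>S. fail_deriv S q v * (t * of_bool (v = k))) = ?D * t"
      using k(1) S(1) that by (simp_all add: of_bool_def if_distrib cong: if_cong)
    then show ?thesis using fail_prob_expansion[OF S(1) q, of "\<lambda>v. t * of_bool (v = k)" t] that by simp
  qed
  have "\<forall>\<^sub>F t in at_right 0. ?\<Phi> + ?D * t + 104 * t\<^sup>2 < b * (1 + 5 * t)"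
  proof (cases "?\<Phi> < b")
    case True
    have "((\<lambda>t. b * (1 + 5 * t) - (?\<Phi> + ?D * t + 104 * t\<^sup>2)) \<longlongrightarrow> b * (1 + 5 * 0) - (?\<Phi> + ?D * 0 + 104 * 0\<^sup>2)) (at_right 0)"
      by (intro tendsto_intros)
    then show ?thesis using True by (auto dest!: order_tendstoD(1)[where a=0] elim: eventually_mono)
  next
    case False
    then have bb: "b = ?\<Phi>" "?D < 5 * b" using b k by auto
    have "((\<lambda>t. 5 * b - (?D + 104 * t)) \<longlongrightarrow> 5 * b - (?D + 104 * 0)) (at_right 0)"
      by (intro tendsto_intros)
    then have "\<forall>\<^sub>F t in at_right 0. 0 < 5 * b - (?D + 104 * t)"
      using bb by (auto dest!: order_tendstoD(1)[where a=0])
    moreover have "\<forall>\<^sub>F t::real in at_right 0. 0 < t" by (rule eventually_at_right_less)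
    ultimately show ?thesis
    proof eventually_elim
      case (elim t)
      then have "0 < t * (5 * b - (?D + 104 * t))" by simp
      then show ?case using bb by (simp add: algebra_simps power2_eq_square)
    qed
  qed
  moreover have "\<forall>\<^sub>F t in at_right 0. t < min t0 1" using t0 by (intro eventually_at_rightI[of 0 "min t0 1"]) auto
  moreover have "\<forall>\<^sub>F t::real in at_right 0. 0 < t" by (rule eventually_at_right_less)
  ultimately have "\<forall>\<^sub>F t in at_right 0. 0 < t \<and> t < min t0 1 \<and> ?\<Phi> + ?D * t + 104 * t\<^sup>2 < b * (1 + 5 * t)"
    by eventually_elim auto
  then obtain t where t: "0 < t" "t < min t0 1" "?\<Phi> + ?D * t + 104 * t\<^sup>2 < b * (1 + 5 * t)"
    using eventually_happens'[OF trivial_limit_at_right_real] by blast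
  have "b * (1 + 5 * t) \<le> b * (1 + t) ^ 5" using Bernoulli_inequality[of t 5] b t by (intro mult_left_mono) auto
  then have "fail_prob S (\<lambda>v. q v + t * of_bool (v = k)) < b * (1 + t) ^ 5" using ex[of t] t by simp
  then show ?thesis using k(1) t by auto
next
  case False
  let ?\<Phi> = "fail_prob S q"
  have "S \<noteq> {}" using q(2) by auto
  then have bb: "?\<Phi> = b" using False b by auto
  have ge: "fail_deriv S q k \<ge> 5 * b" if "k \<in> S" for k using False that bb by auto
  have "(\<Sum>k\<in>S. (fail_deriv S q k - 5 * b) * q k) = (\<Sum>k\<in>S. fail_deriv S q k * q k) - 5 * b * sum q S"
    by (simp only: left_diff_distrib sum_subtractf sum_distrib_left)
  then have "(\<Sum>k\<in>S. (fail_deriv S q k - 5 * b) * q k) = 0"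
    using q(2) bb fail_deriv_euler[OF S(1), of q] by simp
  then have zero: "(fail_deriv S q k - 5 * b) * q k = 0" if "k \<in> S" for k
    using that ge q(1) S(1) by (subst (asm) sum_nonneg_eq_0_iff) auto
  define M where "M = Max {v\<in>S. q v \<noteq> 0}"
  have ne: "{v\<in>S. q v \<noteq> 0} \<noteq> {}" using q(2) by (auto intro: ccontr simp: sum.neutral)
  have M: "M \<in> S" "q M \<noteq> 0" using Max_in[OF _ ne] S(1) by (auto simp: M_def)
  have top: "q v = 0" if "v \<in> S" "v > M" for v
  proof (rule ccontr)
    assume "q v \<noteq> 0"
    then have "v \<le> M" unfolding M_def using that S(1) by (intro Max_ge) auto
    then show False using that by simp
  qed
  have DM: "fail_deriv S q M = 5 * b" using zero[OF M(1)] M(2) by simp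
  define t where "t = t0 / 2"
  have t: "0 < t" "t < t0" using t0 by (auto simp: t_def)
  have "1 + 5 * t < (1 + t) ^ 5" using t(1) by (simp add: eval_nat_numeral algebra_simps add_pos_pos)
  then have "b * (1 + 5 * t) < b * (1 + t) ^ 5" using b by simp
  then have "fail_prob S (\<lambda>v. q v + t * of_bool (v = M)) < b * (1 + t) ^ 5"
    using fail_prob_top_linear[OF S M(1) top, where t = t] bb DM by (simp add: algebra_simps)
  then show ?thesis using M(1) t by auto
qed

section \<open>Words and Chernoff bounds\<close>

definition words :: "nat set \<Rightarrow> nat \<Rightarrow> nat list set" where
  "words S n = {w. set w \<subseteq> S \<and> length w = n}"

definition weight :: "(nat \<Rightarrow> real) \<Rightarrow> nat list \<Rightarrow> real" where
  "weight p w = prod_list (map p w)"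

text \<open>The measure of a set of words under the product of the letter weights. The weights need not sum to 1, since
  lower bounds use sub-probability weights.\<close>

definition mass :: "(nat \<Rightarrow> real) \<Rightarrow> nat list set \<Rightarrow> real" where
  "mass p A = (\<Sum>w\<in>A. weight p w)"

definition freq :: "nat multiset \<Rightarrow> nat \<Rightarrow> real" where
  "freq c v = real (count c v) / real (size c)"

lemma finite_words: "finite S \<Longrightarrow> finite (words S n)"
  unfolding words_def by (rule finite_lists_length_eq)

lemma weight_simps [simp]: "weight p [] = 1" "weight p (v # w) = p v * weight p w"
    "weight p (w @ w') = weight p w * weight p w'"
  by (simp_all add: weight_def)

lemma weight_nonneg: "(\<And>v. v \<in> set w \<Longrightarrow> p v \<ge> 0) \<Longrightarrow> weight p w \<ge> 0"
  by (induction w) auto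

lemma weight_mult: "weight (\<lambda>v. p v * r v) w = weight p w * weight r w"
  by (induction w) auto

lemma weight_nonneg_words: "w \<in> words S n \<Longrightarrow> (\<And>v. v \<in> S \<Longrightarrow> p v \<ge> 0) \<Longrightarrow> weight p w \<ge> 0"
  by (rule weight_nonneg) (auto simp: words_def)

lemma mass_nonneg: "A \<subseteq> words S n \<Longrightarrow> (\<And>v. v \<in> S \<Longrightarrow> p v \<ge> 0) \<Longrightarrow> mass p A \<ge> 0"
  unfolding mass_def by (intro sum_nonneg weight_nonneg_words[of _ S n]) auto

lemma mass_mono:
  assumes "finite S" "B \<subseteq> words S n" "A \<subseteq> B" "\<And>v. v \<in> S \<Longrightarrow> p v \<ge> 0"
  shows "mass p A \<le> mass p B"
  unfolding mass_def using assms
  by (intro sum_mono2 weight_nonneg_words[of _ S n] finite_subset[OF _ finite_words[of S n]]) auto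

lemma mass_UN_le:
  assumes S: "finite S" and I: "finite I" "\<And>i. i \<in> I \<Longrightarrow> E i \<subseteq> words S n" and p: "\<And>v. v \<in> S \<Longrightarrow> p v \<ge> 0"
  shows "mass p (\<Union>i\<in>I. E i) \<le> (\<Sum>i\<in>I. mass p (E i))"
  using I
proof (induction I rule: finite_induct)
  case (insert i I)
  have fin: "finite (E i)" "finite (\<Union>i\<in>I. E i)"
    using insert finite_words[OF S, of n] by (auto intro: finite_subset)
  have "mass p (E i \<union> (\<Union>i\<in>I. E i)) + mass p (E i \<inter> (\<Union>i\<in>I. E i)) = mass p (E i) + mass p (\<Union>i\<in>I. E i)"
    unfolding mass_def by (rule sum.union_inter[OF fin])
  moreover have "mass p (E i \<inter> (\<Union>i\<in>I. E i)) \<ge> 0"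
    by (rule mass_nonneg[of _ S n]) (use insert p in auto)
  ultimately show ?case using insert by simp
qed (simp add: mass_def)

lemma mass_words:
  assumes "finite S" shows "mass p (words S n) = sum p S ^ n"
proof (induction n)
  case 0
  have "words S 0 = {[]}" by (auto simp: words_def)
  then show ?case by (simp add: mass_def)
next
  case (Suc n)
  have eq: "words S (Suc n) = (\<lambda>(v, w). v # w) ` (S \<times> words S n)"
    by (auto simp: words_def length_Suc_conv image_iff)
  have "mass p (words S (Suc n)) = (\<Sum>(v, w)\<in>S \<times> words S n. p v * weight p w)"
    unfolding mass_def eq by (subst sum.reindex) (auto simp: inj_on_def case_prod_beta)
  also have "\<dots> = sum p S * mass p (words S n)"
    by (simp add: sum.cartesian_product[symmetric] sum_product mass_def)
  finally show ?case using Suc by simp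
qed

lemma sum_list_eq_freq:
  assumes "finite S" "w \<in> words S n"
  shows "sum_list (map g w) = real n * (\<Sum>v\<in>S. freq (mset w) v * g v)"
proof -
  have w: "set w \<subseteq> S" "length w = n" using assms by (auto simp: words_def)
  have "sum_list (map g w) = (\<Sum>v\<in>S. real (count_list w v) * g v)"
    using w(1)
  proof (induction w)
    case (Cons a w)
    have "(\<Sum>v\<in>S. real (count_list (a # w) v) * g v) = (\<Sum>v\<in>S. real (count_list w v) * g v + (if v = a then g v else 0))"
      by (intro sum.cong refl) (auto simp: algebra_simps)
    then show ?case using Cons assms(1) by (simp add: sum.distrib)
  qed simp
  also have "\<dots> = real n * (\<Sum>v\<in>S. freq (mset w) v * g v)"
    using w(2) by (cases "n = 0") (auto simp: freq_def sum_distrib_left count_mset)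
  finally show ?thesis .
qed

lemma freq_nonneg: "freq c v \<ge> 0"
  by (simp add: freq_def)

lemma sum_freq:
  assumes "finite S" "set_mset c \<subseteq> (S :: nat set)" "c \<noteq> {#}"
  shows "sum (freq c) S = 1"
proof -
  have "(\<Sum>v\<in>S. count c v) = size c"
    using assms by (subst size_multiset_overloaded_eq) (auto intro!: sum.mono_neutral_right simp: not_in_iff)
  then have "(\<Sum>v\<in>S. real (count c v)) = real (size c)" by (metis of_nat_sum)
  then show ?thesis using assms(3) by (simp add: freq_def sum_divide_distrib[symmetric])
qed

text \<open>Exponential Markov inequality for a sum over the letters of a word; the tilting parameter is part of \<open>g\<close>.\<close>

lemma chernoff:
  assumes S: "finite S" and p: "\<And>v. v \<in> S \<Longrightarrow> p v \<ge> 0"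
    and A: "A \<subseteq> words S n" "\<And>w. w \<in> A \<Longrightarrow> sum_list (map g w) \<ge> c"
  shows "mass p A \<le> exp (- c) * (\<Sum>v\<in>S. p v * exp (g v)) ^ n"
proof -
  have e: "weight (\<lambda>v. exp (g v)) w = exp (sum_list (map g w))" for w
    by (induction w) (auto simp: exp_add)
  have "weight p w \<le> exp (- c) * weight (\<lambda>v. p v * exp (g v)) w" if "w \<in> A" for w
  proof -
    have "weight p w * 1 \<le> weight p w * exp (sum_list (map g w) - c)"
      using A that p by (intro mult_left_mono weight_nonneg_words[of _ S n]) auto
    then show ?thesis by (simp add: weight_mult e exp_diff exp_minus field_simps)
  qed
  then have "mass p A \<le> (\<Sum>w\<in>A. exp (- c) * weight (\<lambda>v. p v * exp (g v)) w)"
    unfolding mass_def by (rule sum_mono)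
  also have "\<dots> = exp (- c) * mass (\<lambda>v. p v * exp (g v)) A" by (simp add: mass_def sum_distrib_left)
  also have "\<dots> \<le> exp (- c) * mass (\<lambda>v. p v * exp (g v)) (words S n)"
    using S p A by (intro mult_left_mono mass_mono[of S _ n]) auto
  finally show ?thesis by (simp add: mass_words[OF S])
qed

lemma exp_le_quadratic: "exp (x::real) \<le> 1 + x + x\<^sup>2 / 2 * exp \<bar>x\<bar>"
proof -
  obtain t where t: "\<bar>t\<bar> \<le> \<bar>x\<bar>" "exp x = (\<Sum>m<2. x ^ m / fact m) + exp t / fact 2 * x ^ 2"
    using Maclaurin_exp_le[of x 2] by blast
  have "exp x = 1 + x + x\<^sup>2 / 2 * exp t" using t(2) by (simp add: eval_nat_numeral)
  moreover have "x\<^sup>2 / 2 * exp t \<le> x\<^sup>2 / 2 * exp \<bar>x\<bar>" using t(1) by (intro mult_left_mono) auto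
  ultimately show ?thesis by simp
qed

text \<open>For a centred bounded \<open>g\<close> the moment generating function at \<open>\<theta>\<close> is at most
  \<open>exp (\<theta>\<^sup>2 V / 2 * e\<^bsup>\<theta> B\<^esup>)\<close>, so that for small \<open>\<theta>\<close> the variance governs the exponent sharply.\<close>

lemma chernoff_variance:
  assumes S: "finite S" and p: "\<And>v. v \<in> S \<Longrightarrow> p v \<ge> 0" "sum p S = 1"
    and g: "(\<Sum>v\<in>S. p v * g v) = 0" "\<And>v. v \<in> S \<Longrightarrow> \<bar>g v\<bar> \<le> B" "(\<Sum>v\<in>S. p v * (g v)\<^sup>2) \<le> V"
    and \<theta>: "\<theta> \<ge> 0"
    and A: "A \<subseteq> words S n" "\<And>w. w \<in> A \<Longrightarrow> (\<Sum>v\<in>S. freq (mset w) v * g v) \<ge> b"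
  shows "mass p A \<le> exp (- real n * (\<theta> * b - \<theta>\<^sup>2 * V / 2 * exp (\<theta> * B)))"
proof -
  have "mass p A \<le> exp (- (real n * (\<theta> * b))) * (\<Sum>v\<in>S. p v * exp (\<theta> * g v)) ^ n"
  proof (rule chernoff[OF S p(1) A(1)])
    fix w assume w: "w \<in> A"
    have "sum_list (map (\<lambda>v. \<theta> * g v) w) = real n * (\<theta> * (\<Sum>v\<in>S. freq (mset w) v * g v))"
      using A(1) w by (subst sum_list_eq_freq[OF S]) (auto simp: sum_distrib_left mult_ac)
    also have "\<dots> \<ge> real n * (\<theta> * b)" using A(2)[OF w] \<theta> by (intro mult_left_mono) auto
    finally show "real n * (\<theta> * b) \<le> sum_list (map (\<lambda>v. \<theta> * g v) w)" .
  qed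
  also have "(\<Sum>v\<in>S. p v * exp (\<theta> * g v)) \<le> exp (\<theta>\<^sup>2 * V / 2 * exp (\<theta> * B))"
  proof -
    have "(\<Sum>v\<in>S. p v * exp (\<theta> * g v)) \<le> (\<Sum>v\<in>S. p v * (1 + \<theta> * g v + \<theta>\<^sup>2 * (g v)\<^sup>2 / 2 * exp (\<theta> * B)))"
    proof (intro sum_mono mult_left_mono p(1))
      fix v assume v: "v \<in> S"
      have "exp (\<theta> * g v) \<le> 1 + \<theta> * g v + (\<theta> * g v)\<^sup>2 / 2 * exp \<bar>\<theta> * g v\<bar>" by (rule exp_le_quadratic)
      also have "(\<theta> * g v)\<^sup>2 / 2 * exp \<bar>\<theta> * g v\<bar> \<le> (\<theta> * g v)\<^sup>2 / 2 * exp (\<theta> * B)"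
        using g(2)[OF v] \<theta> by (intro mult_left_mono) (auto simp: abs_mult mult_left_mono)
      finally show "exp (\<theta> * g v) \<le> 1 + \<theta> * g v + \<theta>\<^sup>2 * (g v)\<^sup>2 / 2 * exp (\<theta> * B)"
        by (simp add: power_mult_distrib)
    qed
    also have "\<dots> = (\<Sum>v\<in>S. p v + \<theta> * (p v * g v) + \<theta>\<^sup>2 / 2 * exp (\<theta> * B) * (p v * (g v)\<^sup>2))"
      by (intro sum.cong refl) (simp add: algebra_simps)
    also have "\<dots> = 1 + \<theta>\<^sup>2 / 2 * exp (\<theta> * B) * (\<Sum>v\<in>S. p v * (g v)\<^sup>2)"
      by (simp only: sum.distrib sum_distrib_left[symmetric] p(2) g(1) mult_zero_right add_0_right)
    also have "\<dots> \<le> 1 + \<theta>\<^sup>2 / 2 * exp (\<theta> * B) * V"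
      using g(3) by (intro add_left_mono mult_left_mono) auto
    also have "\<dots> \<le> exp (\<theta>\<^sup>2 * V / 2 * exp (\<theta> * B))"
      using exp_ge_add_one_self[of "\<theta>\<^sup>2 * V / 2 * exp (\<theta> * B)"] by (simp add: mult_ac)
    finally show ?thesis .
  qed
  then have "(\<Sum>v\<in>S. p v * exp (\<theta> * g v)) ^ n \<le> exp (\<theta>\<^sup>2 * V / 2 * exp (\<theta> * B)) ^ n"
    using p by (intro power_mono sum_nonneg) auto
  also have "\<dots> = exp (real n * (\<theta>\<^sup>2 * V / 2 * exp (\<theta> * B)))" by (simp only: exp_of_nat_mult)
  finally have "mass p A \<le> exp (- (real n * (\<theta> * b))) * exp (real n * (\<theta>\<^sup>2 * V / 2 * exp (\<theta> * B)))"
    by simp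
  then show ?thesis by (simp add: exp_add[symmetric] algebra_simps)
qed

text \<open>The distance is twice the excess of the empirical law over \<open>p\<close> on the set of letters where it exceeds \<open>p\<close>, so
  a union bound over all \<open>2\<^bsup>card S\<^esup>\<close> sets of letters suffices. The same bound serves as law of large numbers.\<close>

lemma l1_deviation:
  assumes S: "finite S" and p: "\<And>v. v \<in> S \<Longrightarrow> p v \<ge> 0" "sum p S = 1" and s: "0 < s" "s \<le> 2" and n: "n > 0"
  shows "mass p {w \<in> words S n. s \<le> (\<Sum>v\<in>S. \<bar>freq (mset w) v - p v\<bar>)} \<le> 2 ^ card S * exp (- real n * (s\<^sup>2 / 16))"
proof -
  let ?T = "{w \<in> words S n. s \<le> (\<Sum>v\<in>S. \<bar>freq (mset w) v - p v\<bar>)}"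
  define E where "E A = {w \<in> words S n. s / 2 \<le> (\<Sum>v\<in>S. freq (mset w) v * (of_bool (v \<in> A) - sum p A))}" for A
  have one: "sum (freq (mset w)) S = 1" if "w \<in> words S n" for w
    using that n by (intro sum_freq S) (auto simp: words_def)
  have ind: "(\<Sum>v\<in>S. of_bool (v \<in> A) * h v) = sum h A" if "A \<subseteq> S" for A and h :: "nat \<Rightarrow> real"
    using that S by (intro sum.mono_neutral_cong_right) auto
  have "w \<in> (\<Union>A\<in>Pow S. E A)" if w: "w \<in> ?T" for w
  proof -
    let ?f = "freq (mset w)"
    define A where "A = {v \<in> S. p v < ?f v}"
    have A: "A \<subseteq> S" by (auto simp: A_def)
    have f1: "sum ?f S = 1" using one w by auto
    have "(\<Sum>v\<in>S. \<bar>?f v - p v\<bar>) = (\<Sum>v\<in>S. 2 * (of_bool (v \<in> A) * (?f v - p v)) - (?f v - p v))"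
      by (intro sum.cong refl) (auto simp: A_def)
    also have "\<dots> = 2 * (\<Sum>v\<in>S. of_bool (v \<in> A) * (?f v - p v))"
      using f1 p(2) by (simp add: sum_subtractf sum_distrib_left)
    also have "(\<Sum>v\<in>S. of_bool (v \<in> A) * (?f v - p v)) = (\<Sum>v\<in>A. ?f v - p v)"
      by (rule ind[OF A])
    finally have 1: "s / 2 \<le> sum ?f A - sum p A" using w by (simp add: sum_subtractf)
    have "(\<Sum>v\<in>S. ?f v * (of_bool (v \<in> A) - sum p A)) = (\<Sum>v\<in>S. of_bool (v \<in> A) * ?f v) - sum ?f S * sum p A"
      by (simp only: right_diff_distrib sum_subtractf sum_distrib_right mult.commute[of "of_bool _"])
    also have "(\<Sum>v\<in>S. of_bool (v \<in> A) * ?f v) = sum ?f A"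
      by (rule ind[OF A])
    finally have "w \<in> E A" using 1 w f1 by (auto simp: E_def)
    then show ?thesis using A by auto
  qed
  then have sub: "?T \<subseteq> (\<Union>A\<in>Pow S. E A)" by auto
  have E: "mass p (E A) \<le> exp (- real n * (s\<^sup>2 / 16))" if A: "A \<in> Pow S" for A
  proof -
    have pA: "0 \<le> sum p A" "sum p A \<le> 1"
      using A S p sum_mono2[of S A p] by (auto intro!: sum_nonneg)
    have b1: "(\<Sum>v\<in>S. p v * of_bool (v \<in> A)) = sum p A"
      using ind[of A p] A by (simp add: mult.commute)
    have g0: "(\<Sum>v\<in>S. p v * (of_bool (v \<in> A) - sum p A)) = 0"
      using b1 p(2) by (simp add: right_diff_distrib sum_subtractf sum_distrib_right[symmetric])
    have g1: "\<bar>of_bool (v \<in> A) - sum p A\<bar> \<le> 1" for v using pA by (cases "v \<in> A") auto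
    have g2: "(\<Sum>v\<in>S. p v * (of_bool (v \<in> A) - sum p A)\<^sup>2) \<le> 1"
    proof -
      have "(\<Sum>v\<in>S. p v * (of_bool (v \<in> A) - sum p A)\<^sup>2) \<le> (\<Sum>v\<in>S. p v * 1)"
        using g1 p(1) by (intro sum_mono mult_left_mono) (auto simp: abs_square_le_1)
      then show ?thesis using p(2) by simp
    qed
    \<comment> \<open>The parameter \<open>s / 4\<close> is half of the optimal one for variance bound 1; it keeps the factor \<open>exp (s / 4)\<close> below 2.\<close>
    have "mass p (E A) \<le> exp (- real n * (s / 4 * (s / 2) - (s / 4)\<^sup>2 * 1 / 2 * exp (s / 4 * 1)))"
      by (rule chernoff_variance[OF S p g0 g1 g2]) (use s in \<open>auto simp: E_def\<close>)
    also have "\<dots> \<le> exp (- real n * (s\<^sup>2 / 16))"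
    proof -
      have "exp (s / 4) \<le> exp (1/2)" using s by simp
      also have "exp (1/2::real) \<le> 2" using exp_le_quadratic[of "1/2"] by (simp add: power2_eq_square)
      finally have "(s / 4)\<^sup>2 * 1 / 2 * exp (s / 4 * 1) \<le> (s / 4)\<^sup>2 * 1 / 2 * 2" by (intro mult_left_mono) auto
      then have "s\<^sup>2 / 16 \<le> s / 4 * (s / 2) - (s / 4)\<^sup>2 * 1 / 2 * exp (s / 4 * 1)"
        by (simp add: power2_eq_square field_simps)
      then show ?thesis unfolding exp_le_cancel_iff by (rule mult_left_mono_neg) auto
    qed
    finally show ?thesis .
  qed
  have "mass p ?T \<le> mass p (\<Union>A\<in>Pow S. E A)"
    by (rule mass_mono[OF S _ sub p(1)]) (auto simp: E_def)
  also have "\<dots> \<le> (\<Sum>A\<in>Pow S. mass p (E A))"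
    by (rule mass_UN_le[OF S _ _ p(1)]) (use S in \<open>auto simp: E_def\<close>)
  also have "\<dots> \<le> (\<Sum>A\<in>Pow S. exp (- real n * (s\<^sup>2 / 16)))" by (intro sum_mono E)
  finally show ?thesis using S by (simp add: card_Pow)
qed

section \<open>Types\<close>

definition type_mass :: "(nat \<Rightarrow> real) \<Rightarrow> nat multiset \<Rightarrow> real" where
  "type_mass p c = mass p {w. mset w = c}"

lemma finite_type: "finite {w :: nat list. mset w = c}"
  by (rule finite_subset[OF _ finite_words[of "set_mset c" "size c"]]) (auto simp: words_def)

lemma type_mass_nonneg: "(\<And>v. v \<in># c \<Longrightarrow> p v \<ge> 0) \<Longrightarrow> type_mass p c \<ge> 0"
  unfolding type_mass_def mass_def by (intro sum_nonneg weight_nonneg) auto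

text \<open>Concatenating a word of type \<open>c\<close> with a word of type \<open>d\<close> is injective, because the lengths are fixed. This
  supermultiplicativity takes the place of an asymptotic analysis of multinomial coefficients.\<close>

lemma type_mass_add:
  assumes "\<And>v. v \<in># c + d \<Longrightarrow> p v \<ge> 0"
  shows "type_mass p c * type_mass p d \<le> type_mass p (c + d)"
proof -
  let ?C = "{w. mset w = c}" and ?D = "{w. mset w = d}"
  have "type_mass p c * type_mass p d = (\<Sum>(w, w')\<in>?C \<times> ?D. weight p (w @ w'))"
    unfolding type_mass_def mass_def by (simp add: sum_product sum.cartesian_product)
  also have "\<dots> = (\<Sum>w\<in>(\<lambda>(w, w'). w @ w') ` (?C \<times> ?D). weight p w)"
  proof (subst sum.reindex)
    show "inj_on (\<lambda>(w, w'). w @ w') (?C \<times> ?D)"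
      by (auto simp: inj_on_def dest!: mset_eq_length)
  qed (simp add: case_prod_beta)
  also have "\<dots> \<le> type_mass p (c + d)"
    unfolding type_mass_def mass_def using assms
    by (intro sum_mono2 finite_type weight_nonneg) (auto simp flip: set_mset_mset)
  finally show ?thesis .
qed

lemma type_mass_single: "type_mass p {#k#} = p k"
  by (simp add: type_mass_def mass_def)

lemma type_mass_empty: "type_mass p {#} = 1"
  by (simp add: type_mass_def mass_def)

lemma type_mass_replicate:
  assumes "p k \<ge> 0" shows "p k ^ m \<le> type_mass p (replicate_mset m k)"
proof (induction m)
  case (Suc m)
  have "p k * p k ^ m \<le> type_mass p {#k#} * type_mass p (replicate_mset m k)"
    using Suc assms by (simp add: type_mass_single mult_left_mono)
  also have "\<dots> \<le> type_mass p ({#k#} + replicate_mset m k)"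
    by (rule type_mass_add) (use assms in \<open>auto split: if_splits\<close>)
  finally show ?case by simp
qed (simp add: type_mass_empty)

lemma type_mass_repeat:
  assumes "\<And>v. v \<in># c \<Longrightarrow> p v \<ge> 0"
  shows "type_mass p c ^ m \<le> type_mass p (repeat_mset m c)"
proof (induction m)
  case (Suc m)
  have "type_mass p c * type_mass p c ^ m \<le> type_mass p c * type_mass p (repeat_mset m c)"
    using Suc assms by (intro mult_left_mono type_mass_nonneg) auto
  also have "\<dots> \<le> type_mass p (c + repeat_mset m c)"
  proof (rule type_mass_add)
    fix v assume "v \<in># c + repeat_mset m c"
    then have "v \<in># c" by (metis count_eq_zero_iff count_repeat_mset mult_0_right union_iff)
    then show "0 \<le> p v" by (rule assms)
  qed
  finally show ?case by simp
qed (simp add: type_mass_empty)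

text \<open>Pigeonhole: the types of length \<open>n\<close> over \<open>S\<close> number at most \<open>(n + 1)\<^bsup>card S\<^esup>\<close>.\<close>

lemma exists_heavy_type:
  assumes S: "finite S" and p: "\<And>v. v \<in> S \<Longrightarrow> p v \<ge> 0"
    and A: "A \<subseteq> words S n" and x: "x > 0" "x \<le> mass p A"
  shows "\<exists>w\<in>A. x / real (Suc n) ^ card S \<le> type_mass p (mset w)"
proof (rule ccontr)
  assume "\<not> ?thesis"
  then have less: "type_mass p (mset w) < x / real (Suc n) ^ card S" if "w \<in> A" for w using that by force
  have fA: "finite A" using A finite_words[OF S] finite_subset by blast
  have ne: "A \<noteq> {}" using x by (auto simp: mass_def)
  have "card (mset ` A) \<le> card (PiE S (\<lambda>_. {0..n}))"
  proof (rule card_inj_on_le)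
    show "inj_on (\<lambda>c. restrict (count c) S) (mset ` A)"
    proof (rule inj_onI)
      fix c d assume cd: "c \<in> mset ` A" "d \<in> mset ` A" "restrict (count c) S = restrict (count d) S"
      have "count c v = count d v" for v
      proof (cases "v \<in> S")
        case True then show ?thesis using cd(3) by (metis restrict_apply')
      next
        case False
        then have "v \<notin># c" "v \<notin># d" using cd(1,2) A by (fastforce simp: words_def)+
        then show ?thesis by (simp add: not_in_iff)
      qed
      then show "c = d" by (rule multiset_eqI)
    qed
    show "(\<lambda>c. restrict (count c) S) ` mset ` A \<subseteq> PiE S (\<lambda>_. {0..n})"
      using A by (auto simp: words_def count_mset count_le_length)
  qed (use S in \<open>auto intro: finite_PiE\<close>)
  also have "\<dots> = Suc n ^ card S" using S by (simp add: card_PiE)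
  finally have card: "real (card (mset ` A)) \<le> real (Suc n) ^ card S" by (metis of_nat_le_iff of_nat_power)
  have "mass p A = (\<Sum>c\<in>mset ` A. sum (weight p) {w \<in> A. mset w = c})"
    unfolding mass_def by (rule sum.image_gen[OF fA])
  also have "\<dots> \<le> (\<Sum>c\<in>mset ` A. type_mass p c)"
    unfolding type_mass_def mass_def
  proof (intro sum_mono sum_mono2 finite_type weight_nonneg)
    fix c w v assume "c \<in> mset ` A" "w \<in> {w. mset w = c} - {w \<in> A. mset w = c}" "v \<in> set w"
    then obtain w' where "w' \<in> A" "mset w' = mset w" by auto
    then have "v \<in> S" using A \<open>v \<in> set w\<close> mset_eq_setD[of w' w] by (auto simp: words_def)
    then show "0 \<le> p v" by (rule p)
  qed auto
  also have "\<dots> < (\<Sum>c\<in>mset ` A. x / real (Suc n) ^ card S)"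
    using fA ne less by (intro sum_strict_mono) auto
  also have "\<dots> = real (card (mset ` A)) * (x / real (Suc n) ^ card S)" by simp
  also have "\<dots> \<le> real (Suc n) ^ card S * (x / real (Suc n) ^ card S)"
    using card x by (intro mult_right_mono) auto
  also have "\<dots> = x" by simp
  finally show False using x by simp
qed

section \<open>Tail probabilities sandwiched between events on words\<close>

text \<open>Letters for the upper bound: the cells \<open>0, \<dots>, K\<close>, where \<open>K\<close> is the unbounded last cell, moved up by two.\<close>

definition alphabet :: "nat \<Rightarrow> nat set" where "alphabet K = {2..K + 2}"

text \<open>The probability that a standard exponential variable lies in \<open>(d v, d (v + 1)]\<close>.\<close>

definition lower_weight :: "real \<Rightarrow> nat \<Rightarrow> real" where
  "lower_weight d v = exp (- d * real v) * (1 - exp (- d))"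

text \<open>The law of the cell index moved up by two; the letter \<open>K + 2\<close> collects the half line beyond \<open>d K\<close>.\<close>

definition upper_weight :: "real \<Rightarrow> nat \<Rightarrow> nat \<Rightarrow> real" where
  "upper_weight d K v = (if v = K + 2 then exp (- d * real K) else exp (- d * (real v - 2)) * (1 - exp (- d)))"

text \<open>Everything that the large deviation analysis needs to know about the tail probabilities
  \<open>P n a\<close> of \<open>I\<^sub>n > a\<close>. The term \<open>300 / n\<close> covers the differences between sampling with and without replacement and the
  summand \<open>1/(2 n)\<close>. It makes the lower bound by words empty at \<open>a = 1/2\<close>, where the explicit bound \<open>(1/4)\<^sup>n\<close> is
  needed instead.\<close>

definition sandwiched :: "(nat \<Rightarrow> real \<Rightarrow> real) \<Rightarrow> bool" where
  "sandwiched P \<longleftrightarrow>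
     (\<forall>n a. 0 \<le> P n a \<and> P n a \<le> 1) \<and> (\<forall>n. antimono (P n)) \<and> (\<forall>n\<ge>6. (1/4) ^ n \<le> P n (1/2)) \<and>
     (\<forall>d>0. \<forall>K. \<forall>n\<ge>6. \<forall>a. P n a \<le> mass (upper_weight d K)
        {w \<in> words (alphabet K) n. fail_prob (alphabet K) (freq (mset w)) \<le> 1/2 - a + 300 / real n}) \<and>
     (\<forall>d>0. \<forall>S. finite S \<longrightarrow> S \<subseteq> {1..} \<longrightarrow> (\<forall>n\<ge>6. \<forall>a. mass (lower_weight d)
        {w \<in> words S n. fail_prob S (freq (mset w)) < 1/2 - a - 300 / real n} \<le> P n a))"

lemma sandwichedD:
  assumes "sandwiched P"
  shows "0 \<le> P n a" "P n a \<le> 1" "a \<le> b \<Longrightarrow> P n b \<le> P n a" "n \<ge> 6 \<Longrightarrow> (1/4) ^ n \<le> P n (1/2)"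
    "d > 0 \<Longrightarrow> n \<ge> 6 \<Longrightarrow> P n a \<le> mass (upper_weight d K)
        {w \<in> words (alphabet K) n. fail_prob (alphabet K) (freq (mset w)) \<le> 1/2 - a + 300 / real n}"
    "d > 0 \<Longrightarrow> n \<ge> 6 \<Longrightarrow> finite S \<Longrightarrow> S \<subseteq> {1..} \<Longrightarrow> mass (lower_weight d)
        {w \<in> words S n. fail_prob S (freq (mset w)) < 1/2 - a - 300 / real n} \<le> P n a"
  using assms unfolding sandwiched_def by (auto dest: antimonoD)

lemma alphabet: "finite (alphabet K)" "alphabet K \<subseteq> {1..}" "v \<in> alphabet K \<Longrightarrow> v \<ge> 1" "K + 2 \<in> alphabet K"
  by (auto simp: alphabet_def)

lemma lower_weight_pos: "d > 0 \<Longrightarrow> lower_weight d v > 0"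
  by (simp add: lower_weight_def)

lemma lower_weight_le_1: "d > 0 \<Longrightarrow> lower_weight d v \<le> 1"
  unfolding lower_weight_def by (intro mult_le_one) auto

lemma upper_weight_pos: "d > 0 \<Longrightarrow> upper_weight d K v > 0"
  by (simp add: upper_weight_def)

lemma upper_weight_sum: "sum (upper_weight d K) (alphabet K) = 1"
proof -
  have *: "(\<Sum>j<K. exp (- d * real j) * (1 - exp (- d))) + exp (- d * real K) = 1"
    by (induction K) (auto simp: algebra_simps exp_add[symmetric])
  have "alphabet K = insert (K + 2) ((\<lambda>j. j + 2) ` {..<K})"
    by (auto simp: alphabet_def image_iff Bex_def) presburger
  then have "sum (upper_weight d K) (alphabet K) = exp (- d * real K) + (\<Sum>j<K. upper_weight d K (j + 2))"
    by (simp add: sum.reindex inj_on_def upper_weight_def image_iff)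
  also have "(\<Sum>j<K. upper_weight d K (j + 2)) = (\<Sum>j<K. exp (- d * real j) * (1 - exp (- d)))"
    by (intro sum.cong) (auto simp: upper_weight_def)
  finally show ?thesis using * by simp
qed

lemma lower_weight_eq:
  "lower_weight d v = upper_weight d K v * (exp (- 2 * d) * (if v = K + 2 then 1 - exp (- d) else 1))"
  by (auto simp: lower_weight_def upper_weight_def exp_add[symmetric] algebra_simps)

lemma weight_lower_upper:
  "weight (lower_weight d) w = weight (upper_weight d K) w
     * (exp (- 2 * d * real (length w)) * (1 - exp (- d)) ^ count_list w (K + 2))"
proof (induction w)
  case (Cons v w)
  have "exp (- 2 * d * real (length (v # w))) = exp (- 2 * d) * exp (- 2 * d * real (length w))"
    by (simp add: exp_add[symmetric] algebra_simps)
  then show ?case using Cons by (simp add: lower_weight_eq[of d v K] mult_ac)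
qed simp

text \<open>A single type with \<open>fail_prob < 1/2 - a\<close> gives a lower bound at all large lengths: repeat it, and fill up the
  remainder with fewer than \<open>size c\<close> copies of one letter, which neither affects the exponent nor the limiting frequencies.\<close>

lemma tail_ge_repeated_type:
  assumes P: "sandwiched P" and d: "d > 0" and S: "finite S" "S \<subseteq> {1..}" and c: "set_mset c \<subseteq> S" "c \<noteq> {#}"
    and \<Phi>: "fail_prob S (freq c) < 1/2 - a"
    and R: "R \<ge> 0" "exp (- real (size c) * R) \<le> type_mass (lower_weight d) c" and \<epsilon>: "\<epsilon> > 0"
  shows "\<exists>\<eta>>0. \<forall>\<^sub>F n in sequentially. exp (- real n * (R + \<epsilon>)) \<le> P n (a + \<eta>)"
proof -
  define s where "s = size c"
  have s: "s > 0" using c by (simp add: s_def nonempty_has_size)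
  obtain k where k: "k \<in># c" using c by blast
  let ?p = "lower_weight d"
  have p: "?p v > 0" "?p v \<le> 1" for v using lower_weight_pos lower_weight_le_1 d by auto
  define C where "C n = repeat_mset (n div s) c + replicate_mset (n mod s) k" for n
  have Csize: "size (C n) = n" for n by (simp add: C_def s_def[symmetric])
  have Cset: "set_mset (C n) \<subseteq> S" for n
  proof
    fix v assume "v \<in># C n"
    then have "v \<in># c" using k unfolding C_def
      by (metis count_eq_zero_iff count_repeat_mset mult_0_right union_iff in_replicate_mset)
    then show "v \<in> S" using c by auto
  qed
  have mass: "exp (- real n * R) * ?p k ^ s \<le> type_mass ?p (C n)" for n
  proof -
    have "exp (- real n * R) \<le> exp (- real s * R) ^ (n div s)"
    proof -
      have "s * (n div s) \<le> n" by simp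
      then have "real s * real (n div s) * R \<le> real n * R"
        using R(1) by (intro mult_right_mono) (metis of_nat_le_iff of_nat_mult, simp)
      then show ?thesis by (simp add: exp_of_nat_mult[symmetric] mult_ac)
    qed
    also have "\<dots> \<le> type_mass ?p c ^ (n div s)" using R(2) by (intro power_mono) (auto simp: s_def)
    also have "\<dots> \<le> type_mass ?p (repeat_mset (n div s) c)" by (rule type_mass_repeat) (use p in \<open>auto intro: less_imp_le\<close>)
    finally have 1: "exp (- real n * R) \<le> type_mass ?p (repeat_mset (n div s) c)" .
    have "?p k ^ s \<le> ?p k ^ (n mod s)" using p[of k] s by (intro power_decreasing) auto
    also have "\<dots> \<le> type_mass ?p (replicate_mset (n mod s) k)" by (rule type_mass_replicate) (use p[of k] in auto)
    finally have 2: "?p k ^ s \<le> type_mass ?p (replicate_mset (n mod s) k)" .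
    have "exp (- real n * R) * ?p k ^ s \<le> type_mass ?p (repeat_mset (n div s) c) * type_mass ?p (replicate_mset (n mod s) k)"
      using 1 2 p[of k] by (intro mult_mono type_mass_nonneg) (auto intro: less_imp_le p)
    also have "\<dots> \<le> type_mass ?p (C n)" unfolding C_def by (rule type_mass_add) (use p in \<open>auto intro: less_imp_le\<close>)
    finally show ?thesis .
  qed
  have lim: "(\<lambda>n. freq (C n) v) \<longlonglongrightarrow> freq c v" for v
  proof -
    have bd: "norm (freq (C n) v - freq c v) \<le> 2 * real s / real n" if n: "n > 0" for n
    proof -
      have "real n = real s * real (n div s) + real (n mod s)" by (metis mult_div_mod_eq of_nat_add of_nat_mult)
      then have div: "real (n div s) = (real n - real (n mod s)) / real s" using s by (simp add: field_simps)
      have "freq (C n) v - freq c v = real (n mod s) / real n * (of_bool (v = k) - freq c v)"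
        unfolding freq_def Csize s_def[symmetric] using s n
        by (simp add: C_def div field_simps)
      moreover have "\<bar>of_bool (v = k) - freq c v\<bar> \<le> 2"
        using count_le_size[of c v] s by (auto simp: freq_def s_def field_simps split: if_splits)
      moreover have "real (n mod s) / real n \<le> real s / real n"
        using s by (intro divide_right_mono) (auto intro: less_imp_le)
      ultimately have "norm (freq (C n) v - freq c v) \<le> real s / real n * 2"
        by (simp only: real_norm_def abs_mult, intro mult_mono) auto
      then show ?thesis by (simp add: mult.commute)
    qed
    have "(\<lambda>n. 2 * real s / real n) \<longlonglongrightarrow> 0" by real_asymp
    then have "(\<lambda>n. freq (C n) v - freq c v) \<longlonglongrightarrow> 0"
      by (rule Lim_null_comparison[rotated]) (rule eventually_mono[OF eventually_gt_at_top[of 0] bd])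
    then show ?thesis by (simp add: LIM_zero_iff)
  qed
  have "(\<lambda>n. fail_prob S (freq (C n)) + 300 / real n) \<longlonglongrightarrow> fail_prob S (freq c) + 0"
    by (intro tendsto_add tendsto_fail_prob lim) real_asymp
  moreover define \<eta> where "\<eta> = (1/2 - a - fail_prob S (freq c)) / 2"
  ultimately have "\<forall>\<^sub>F n in sequentially. fail_prob S (freq (C n)) + 300 / real n < 1/2 - a - \<eta>"
    using \<Phi> by (intro order_tendstoD(2)) (auto simp: \<eta>_def field_simps)
  moreover have "\<forall>\<^sub>F n in sequentially. exp (- real n * \<epsilon>) \<le> ?p k ^ s"
  proof -
    have "(\<lambda>n. exp (- real n * \<epsilon>)) \<longlonglongrightarrow> 0" using \<epsilon> by real_asymp
    then have "\<forall>\<^sub>F n in sequentially. exp (- real n * \<epsilon>) < ?p k ^ s"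
      by (rule order_tendstoD) (use p in auto)
    then show ?thesis by (rule eventually_mono) auto
  qed
  ultimately have "\<forall>\<^sub>F n in sequentially. exp (- real n * (R + \<epsilon>)) \<le> P n (a + \<eta>)"
    using eventually_ge_at_top[of 6]
  proof eventually_elim
    case (elim n)
    have "exp (- real n * (R + \<epsilon>)) = exp (- real n * R) * exp (- real n * \<epsilon>)"
      by (simp add: exp_add[symmetric] algebra_simps)
    also have "\<dots> \<le> exp (- real n * R) * ?p k ^ s" using elim by (intro mult_left_mono) auto
    also have "\<dots> \<le> type_mass ?p (C n)" by (rule mass)
    also have "\<dots> \<le> mass ?p {w \<in> words S n. fail_prob S (freq (mset w)) < 1/2 - (a + \<eta>) - 300 / real n}"
      unfolding type_mass_def
    proof (rule mass_mono[OF S(1)])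
      show "{w. mset w = C n} \<subseteq> {w \<in> words S n. fail_prob S (freq (mset w)) < 1/2 - (a + \<eta>) - 300 / real n}"
      proof safe
        fix w assume w: "mset w = C n"
        have "set w \<subseteq> S" using Cset[of n] w by (metis set_mset_mset)
        moreover have "length w = n" using Csize[of n] w by (metis size_mset)
        ultimately show "w \<in> words S n" by (simp add: words_def)
        show "fail_prob S (freq (mset w)) < 1/2 - (a + \<eta>) - 300 / real n" using elim w by simp
      qed
    qed (use p in \<open>auto intro: less_imp_le\<close>)
    also have "\<dots> \<le> P n (a + \<eta>)" using sandwichedD(6)[OF P d _ S] elim by simp
    finally show ?case .
  qed
  moreover have "\<eta> > 0" using \<Phi> by (simp add: \<eta>_def)
  ultimately show ?thesis by blast
qed

lemma finite_convergent_subseq: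
  fixes f :: "nat \<Rightarrow> nat \<Rightarrow> real"
  assumes "finite S" "\<And>m v. 0 \<le> f m v \<and> f m v \<le> 1"
  shows "\<exists>r q. strict_mono r \<and> (\<forall>v\<in>S. (\<lambda>m. f (r m) v) \<longlonglongrightarrow> q v)"
  using assms(1)
proof (induction S rule: finite_induct)
  case empty
  show ?case by (rule exI[of _ id]) (simp add: strict_mono_id)
next
  case (insert x S)
  then obtain r q where r: "strict_mono r" "\<forall>v\<in>S. (\<lambda>m. f (r m) v) \<longlonglongrightarrow> q v" by blast
  have "seq_compact {0..1::real}" by (simp add: compact_imp_seq_compact)
  then obtain l r' where r': "strict_mono r'" "((\<lambda>m. f (r m) x) \<circ> r') \<longlonglongrightarrow> l"
    unfolding seq_compact_def using assms(2) by (metis atLeastAtMost_iff)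
  have "(\<lambda>m. f ((r \<circ> r') m) v) \<longlonglongrightarrow> (q(x := l)) v" if "v \<in> insert x S" for v
    using that r' insert.hyps r(2) LIMSEQ_subseq_LIMSEQ[OF _ r'(1), of "\<lambda>m. f (r m) v"] by (auto simp: o_def)
  then show ?case using strict_mono_o[OF r(1) r'(1)] by blast
qed

text \<open>The last cell has weight \<open>e\<^bsup>-dK\<^esup>\<close>, so for large \<open>K\<close> a positive fraction of letters there has
  an arbitrarily large exponent.\<close>

lemma cap_mass_le:
  assumes d: "d > 0" and K: "exp (- d * real K) * exp s \<le> 1" and s: "s \<ge> 0"
  shows "mass (upper_weight d K) {w \<in> words (alphabet K) n. \<eta> \<le> freq (mset w) (K + 2)} \<le> (2 * exp (- s * \<eta>)) ^ n"
proof -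
  let ?p = "upper_weight d K" and ?g = "\<lambda>v. if v = K + 2 then s else 0"
  have "mass ?p {w \<in> words (alphabet K) n. \<eta> \<le> freq (mset w) (K + 2)}
      \<le> exp (- (real n * (s * \<eta>))) * (\<Sum>v\<in>alphabet K. ?p v * exp (?g v)) ^ n"
  proof (rule chernoff[OF alphabet(1)])
    fix w assume w: "w \<in> {w \<in> words (alphabet K) n. \<eta> \<le> freq (mset w) (K + 2)}"
    then have "sum_list (map ?g w) = real n * (\<Sum>v\<in>alphabet K. freq (mset w) v * ?g v)"
      by (intro sum_list_eq_freq alphabet) auto
    also have "(\<Sum>v\<in>alphabet K. freq (mset w) v * ?g v) = freq (mset w) (K + 2) * s"
      using alphabet(1,4)[of K] by (simp add: if_distrib cong: if_cong)
    finally have eq: "sum_list (map ?g w) = real n * (freq (mset w) (K + 2) * s)" .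
    show "real n * (s * \<eta>) \<le> sum_list (map ?g w)"
      unfolding eq using w s by (subst mult.commute[of s]) (intro mult_left_mono mult_right_mono, auto)
  qed (use upper_weight_pos[OF d] in \<open>auto intro: less_imp_le\<close>)
  also have "(\<Sum>v\<in>alphabet K. ?p v * exp (?g v)) \<le> 2"
  proof -
    have "(\<Sum>v\<in>alphabet K. ?p v * exp (?g v)) \<le> (\<Sum>v\<in>alphabet K. ?p v + (if v = K + 2 then ?p v * exp s else 0))"
      using upper_weight_pos[OF d, of K] by (intro sum_mono) (auto intro: less_imp_le)
    also have "\<dots> = 1 + ?p (K + 2) * exp s" using alphabet(1,4)[of K] by (simp add: sum.distrib upper_weight_sum)
    also have "\<dots> \<le> 2" using K by (simp add: upper_weight_def)
    finally show ?thesis .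
  qed
  then have "(\<Sum>v\<in>alphabet K. ?p v * exp (?g v)) ^ n \<le> 2 ^ n"
    using upper_weight_pos[OF d, of K] by (intro power_mono sum_nonneg) (auto intro: less_imp_le mult_nonneg_nonneg)
  finally show ?thesis by (simp add: power_mult_distrib exp_of_nat_mult[symmetric] mult_ac)
qed

text \<open>Types extracted from the upper bound, measured by the weights of the lower bound. The two weights differ by
  \<open>e\<^bsup>-2d\<^esup>\<close> per letter and by \<open>1 - e\<^bsup>-d\<^esup>\<close> per letter in the last cell; first \<open>d\<close>, then \<open>K\<close> is chosen
  such that both losses are at most \<open>\<epsilon>\<close> per letter.\<close>

lemma tail_bound_gives_types:
  assumes P: "sandwiched P" and R: "R \<ge> 0" and \<epsilon>: "\<epsilon> > 0"
    and freq: "\<And>\<eta>. \<eta> > 0 \<Longrightarrow> \<exists>\<^sub>F n in sequentially. exp (- real n * R) \<le> P n (a - \<eta>)"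
  shows "\<exists>d>0. \<exists>K. \<forall>m. \<exists>c. set_mset c \<subseteq> alphabet K \<and> size c > m
     \<and> fail_prob (alphabet K) (freq c) \<le> 1/2 - a + 1 / real (Suc m) + 300 / real (size c)
     \<and> exp (- real (size c) * (R + \<epsilon>)) \<le> type_mass (lower_weight d) c"
proof -
  define d where "d = \<epsilon> / 6"
  have d: "d > 0" using \<epsilon> by (simp add: d_def)
  define l where "l = - ln (1 - exp (- d))"
  have e1: "0 < 1 - exp (- d)" "1 - exp (- d) < 1" using d by auto
  have l: "l > 0" "1 - exp (- d) = exp (- l)" using e1 by (auto simp: l_def)
  \<comment> \<open>The budget is \<open>\<epsilon> / 3\<close> each for the shift, for the last cell and for the number of types.\<close>
  define \<eta> where "\<eta> = \<epsilon> / (3 * l)"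
  have \<eta>: "\<eta> > 0" using \<epsilon> l by (simp add: \<eta>_def)
  \<comment> \<open>With this tilt a fraction \<open>\<eta>\<close> of letters in the last cell has exponent \<open>R + 2\<close>, one unit of which pays for the factor 2 in \<open>cap_mass_le\<close>.\<close>
  define s where "s = (R + 2) / \<eta>"
  have s: "s \<ge> 0" using R \<eta> by (simp add: s_def)
  define K where "K = nat \<lceil>s / d\<rceil>"
  have "s \<le> d * real K" using s d by (simp add: K_def field_simps) (metis le_of_int_ceiling mult.commute pos_divide_le_eq)
  then have K: "exp (- d * real K) * exp s \<le> 1" by (simp add: exp_add[symmetric])
  let ?p = "upper_weight d K" and ?S = "alphabet K"
  have p: "?p v \<ge> 0" for v using upper_weight_pos[OF d] by (simp add: less_imp_le)
  have cap: "mass ?p {w \<in> words ?S n. \<eta> \<le> freq (mset w) (K + 2)} \<le> exp (- real n * R) / 2" if n: "n > 0" for n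
  proof -
    have "2 * exp (- s * \<eta>) \<le> exp 1 * exp (- (R + 2))" using \<eta> exp_ge_add_one_self[of 1] by (simp add: s_def)
    also have "\<dots> = exp (- (R + 1))" by (simp add: exp_add[symmetric])
    finally have "(2 * exp (- s * \<eta>)) ^ n \<le> exp (- (R + 1)) ^ n" by (intro power_mono) auto
    also have "\<dots> = exp (- real n * R) * exp (- real n)" by (simp add: exp_of_nat_mult[symmetric] exp_add[symmetric] algebra_simps)
    also have "\<dots> \<le> exp (- real n * R) * (1 / 2)"
    proof -
      have "exp (- real n) \<le> exp (-1)" using n by simp
      also have "exp (- 1::real) \<le> 1 / 2" using exp_ge_add_one_self[of 1] by (simp add: exp_minus field_simps)
      finally show ?thesis by (intro mult_left_mono) auto
    qed
    finally show ?thesis using cap_mass_le[OF d K s, of n \<eta>] by simp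
  qed
  have "(\<lambda>n. 2 * real (Suc n) ^ card ?S * exp (- real n * (\<epsilon> / 3))) \<longlonglongrightarrow> 0" using \<epsilon> by real_asymp
  then have "\<forall>\<^sub>F n in sequentially. 2 * real (Suc n) ^ card ?S * exp (- real n * (\<epsilon> / 3)) < 1"
    by (rule order_tendstoD) simp
  then obtain N where N: "2 * real (Suc n) ^ card ?S * exp (- real n * (\<epsilon> / 3)) < 1" if "n \<ge> N" for n
    by (auto simp: eventually_sequentially)
  have "\<exists>c. set_mset c \<subseteq> ?S \<and> size c > m
     \<and> fail_prob ?S (freq c) \<le> 1/2 - a + 1 / real (Suc m) + 300 / real (size c)
     \<and> exp (- real (size c) * (R + \<epsilon>)) \<le> type_mass (lower_weight d) c" for m
  proof -
    have "\<exists>n \<ge> N + m + 6. exp (- real n * R) \<le> P n (a - 1 / real (Suc m))"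
      using freq[of "1 / real (Suc m)"] by (auto simp: frequently_sequentially)
    then obtain n where n: "n \<ge> N + m + 6" "exp (- real n * R) \<le> P n (a - 1 / real (Suc m))" by blast
    define A where "A = {w \<in> words ?S n. fail_prob ?S (freq (mset w)) \<le> 1/2 - (a - 1 / real (Suc m)) + 300 / real n}"
    define B where "B = {w \<in> words ?S n. \<eta> \<le> freq (mset w) (K + 2)}"
    have fin: "finite (words ?S n)" by (rule finite_words) (rule alphabet)
    have "mass ?p A \<le> mass ?p ((A - B) \<union> B)"
      by (rule mass_mono[OF alphabet(1)]) (use p in \<open>auto simp: A_def B_def\<close>)
    also have "\<dots> = mass ?p (A - B) + mass ?p B" unfolding mass_def
      by (rule sum.union_disjoint) (use fin in \<open>auto simp: A_def B_def\<close>)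
    finally have "mass ?p (A - B) \<ge> exp (- real n * R) / 2"
      using sandwichedD(5)[OF P d, of n "a - 1 / real (Suc m)" K] cap[of n] n unfolding A_def B_def by simp
    then obtain w where w: "w \<in> A - B" "exp (- real n * R) / 2 / real (Suc n) ^ card ?S \<le> type_mass ?p (mset w)"
      using exists_heavy_type[where S = ?S and p = ?p and A = "A - B" and n = n and x = "exp (- real n * R) / 2"]
        p alphabet(1) by (auto simp: A_def)
    have len: "length w = n" using w by (auto simp: A_def words_def)
    have sz: "size (mset w) = n" using len by simp
    define \<kappa> where "\<kappa> = exp (- real n * (2 * \<epsilon> / 3))"
    have "\<kappa> * type_mass ?p (mset w) \<le> type_mass (lower_weight d) (mset w)"
      unfolding type_mass_def mass_def sum_distrib_left
    proof (rule sum_mono)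
      fix w' assume "w' \<in> {w'. mset w' = mset w}"
      then have w': "mset w' = mset w" by simp
      then have len': "length w' = n" using len by (metis size_mset)
      have cl: "real (count_list w' (K + 2)) \<le> \<eta> * real n"
        using w(1) w' len n(1) by (auto simp: B_def A_def freq_def count_mset[symmetric] field_simps)
      have "(1 - exp (- d)) ^ count_list w' (K + 2) = exp (- (real (count_list w' (K + 2)) * l))"
        by (simp add: l(2) exp_of_nat_mult[symmetric])
      also have "\<dots> \<ge> exp (- (\<eta> * real n * l))" using cl l by simp
      finally have "exp (- (real n * (\<epsilon> / 3))) \<le> (1 - exp (- d)) ^ count_list w' (K + 2)"
        using l by (simp add: \<eta>_def mult_ac)
      then have "exp (- 2 * d * real n) * exp (- (real n * (\<epsilon> / 3))) \<le> exp (- 2 * d * real n) * (1 - exp (- d)) ^ count_list w' (K + 2)"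
        by (rule mult_left_mono) auto
      moreover have "\<kappa> = exp (- 2 * d * real n) * exp (- (real n * (\<epsilon> / 3)))"
        by (simp add: \<kappa>_def d_def exp_add[symmetric])
      ultimately have "\<kappa> \<le> exp (- 2 * d * real n) * (1 - exp (- d)) ^ count_list w' (K + 2)" by simp
      then show "\<kappa> * weight ?p w' \<le> weight (lower_weight d) w'"
        unfolding weight_lower_upper[of d w' K] len' mult.commute[of "weight ?p w'"] 
        by (intro mult_right_mono weight_nonneg p)
    qed
    moreover have "exp (- real n * (R + \<epsilon>)) \<le> \<kappa> * type_mass ?p (mset w)"
    proof -
      have "exp (- real n * (\<epsilon> / 3)) \<le> 1 / (2 * real (Suc n) ^ card ?S)" using N[of n] n(1) by (simp add: field_simps)
      then have "\<kappa> * exp (- real n * R) * exp (- real n * (\<epsilon> / 3)) \<le> \<kappa> * exp (- real n * R) * (1 / (2 * real (Suc n) ^ card ?S))"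
        by (intro mult_left_mono) (auto simp: \<kappa>_def)
      also have "\<dots> = \<kappa> * (exp (- real n * R) / 2 / real (Suc n) ^ card ?S)" by simp
      also have "\<dots> \<le> \<kappa> * type_mass ?p (mset w)" using w(2) by (intro mult_left_mono) (auto simp: \<kappa>_def)
      finally show ?thesis by (simp add: \<kappa>_def exp_add[symmetric] algebra_simps)
    qed
    ultimately have "exp (- real n * (R + \<epsilon>)) \<le> type_mass (lower_weight d) (mset w)" by simp
    moreover have "set_mset (mset w) \<subseteq> ?S" using w(1) by (auto simp: A_def words_def)
    moreover have "fail_prob ?S (freq (mset w)) \<le> 1/2 - a + 1 / real (Suc m) + 300 / real n" using w(1) by (simp add: A_def)
    ultimately show ?thesis using sz n(1) by (intro exI[of _ "mset w"]) auto
  qed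
  then show ?thesis using d by blast
qed

text \<open>The heart of the existence proof. The types from the hypothesis have a limit point \<open>q\<close> with
  \<open>\<Phi> q \<le> 1/2 - a\<close>. Adding a small fraction of one letter makes the inequality strict at a small cost per
  letter, and repeating the improved type gives the conclusion. Using two families \<open>P\<close> and \<open>P'\<close> shows that the rate
  does not depend on the model; varying the level gives continuity.\<close>

lemma tail_transfer:
  assumes P: "sandwiched P" "sandwiched P'" and a: "a < 1/2" and R: "R \<ge> 0" and \<epsilon>: "\<epsilon> > 0"
    and freq: "\<And>\<eta>. \<eta> > 0 \<Longrightarrow> \<exists>\<^sub>F n in sequentially. exp (- real n * R) \<le> P n (a - \<eta>)"
  shows "\<exists>\<eta>>0. \<forall>\<^sub>F n in sequentially. exp (- real n * (R + \<epsilon>)) \<le> P' n (a + \<eta>)"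
proof -
  have e4: "\<epsilon> / 4 > 0" using \<epsilon> by simp
  obtain d K where d: "d > 0" and "\<forall>m. \<exists>c. set_mset c \<subseteq> alphabet K \<and> size c > m
     \<and> fail_prob (alphabet K) (freq c) \<le> 1/2 - a + 1 / real (Suc m) + 300 / real (size c)
     \<and> exp (- real (size c) * (R + \<epsilon> / 4)) \<le> type_mass (lower_weight d) c"
    using tail_bound_gives_types[OF P(1) R e4 freq] by blast
  then obtain c where c: "\<And>m. set_mset (c m) \<subseteq> alphabet K" "\<And>m. size (c m) > m"
     "\<And>m. fail_prob (alphabet K) (freq (c m)) \<le> 1/2 - a + 1 / real (Suc m) + 300 / real (size (c m))"
     "\<And>m. exp (- real (size (c m)) * (R + \<epsilon> / 4)) \<le> type_mass (lower_weight d) (c m)"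
    by metis
  let ?S = "alphabet K" and ?p = "lower_weight d" and ?b = "1/2 - a"
  have p: "?p v > 0" "?p v \<le> 1" for v using lower_weight_pos lower_weight_le_1 d by auto
  have "0 \<le> freq (c m) v \<and> freq (c m) v \<le> 1" for m v
    using count_le_size[of "c m" v] by (cases "c m = {#}") (auto simp: freq_def divide_le_eq_1 nonempty_has_size)
  then obtain r q where r: "strict_mono r" and q: "\<forall>v\<in>?S. (\<lambda>m. freq (c (r m)) v) \<longlonglongrightarrow> q v"
    using finite_convergent_subseq[OF alphabet(1), where f = "\<lambda>m. freq (c m)"] by blast
  have rm: "r m \<ge> m" for m using r by (rule seq_suble)
  have sz: "size (c (r m)) > m" for m using c(2)[of "r m"] rm[of m] by linarith
  \<comment> \<open>The rounding of \<open>t\<close> times the size disappears because the sizes tend to infinity.\<close>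
  have szlim: "filterlim (\<lambda>m. size (c (r m))) at_top sequentially"
    by (rule filterlim_at_top_mono[OF filterlim_ident]) (use sz in \<open>auto intro!: always_eventually less_imp_le\<close>)
  have q0: "q v \<ge> 0" if "v \<in> ?S" for v
    by (rule LIMSEQ_le_const[OF q[rule_format, OF that]]) (auto simp: freq_nonneg)
  have q1: "sum q ?S = 1"
  proof -
    have "(\<lambda>m. sum (freq (c (r m))) ?S) \<longlonglongrightarrow> sum q ?S" by (intro tendsto_sum) (use q in auto)
    moreover have "sum (freq (c (r m))) ?S = 1" for m
      using c(1)[of "r m"] sz[of m] by (intro sum_freq alphabet) auto
    ultimately show ?thesis by (simp add: LIMSEQ_const_iff)
  qed
  have \<Phi>: "fail_prob ?S q \<le> ?b"
  proof (rule LIMSEQ_le)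
    show "(\<lambda>m. fail_prob ?S (freq (c (r m)))) \<longlonglongrightarrow> fail_prob ?S q" by (intro tendsto_fail_prob) (use q in auto)
    have "(\<lambda>m. ?b + 1 / real (Suc m) + 300 / real (Suc m)) \<longlonglongrightarrow> ?b + 0 + 0"
      by (intro tendsto_add tendsto_const) real_asymp+
    then show "(\<lambda>m. ?b + 1 / real (Suc m) + 300 / real (Suc m)) \<longlonglongrightarrow> ?b" by simp
    have "fail_prob ?S (freq (c (r m))) \<le> ?b + 1 / real (Suc m) + 300 / real (Suc m)" for m
    proof -
      have "1 / real (Suc (r m)) \<le> 1 / real (Suc m)" using rm[of m] by (intro divide_left_mono) auto
      moreover have "300 / real (size (c (r m))) \<le> 300 / real (Suc m)" using sz[of m] by (intro divide_left_mono) auto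
      ultimately show ?thesis using c(3)[of "r m"] by linarith
    qed
    then show "\<exists>N. \<forall>n\<ge>N. fail_prob ?S (freq (c (r n))) \<le> ?b + 1 / real (Suc n) + 300 / real (Suc n)" by blast
  qed
  define L where "L = (\<Sum>v\<in>?S. - ln (?p v))"
  have Lk: "- ln (?p k) \<le> L" if "k \<in> ?S" for k
    unfolding L_def by (rule member_le_sum) (use that p alphabet in auto)
  have L0: "L \<ge> 0" unfolding L_def by (rule sum_nonneg) (use p in auto)
  \<comment> \<open>Adding a fraction of at most \<open>2 * t0\<close> of any letter costs at most \<open>\<epsilon> / 4\<close> in the exponent.\<close>
  define t0 where "t0 = \<epsilon> / (8 * (1 + L))"
  have t0: "t0 > 0" using \<epsilon> L0 by (simp add: t0_def)
  obtain k t where k: "k \<in> ?S" and t: "0 < t" "t < t0" "fail_prob ?S (\<lambda>v. q v + t * of_bool (v = k)) < ?b * (1 + t) ^ 5"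
    using fail_prob_improve[OF alphabet(1) alphabet(3)[of _ K] q0 q1 \<Phi> _ t0] a by auto
  define M where "M m = nat \<lceil>t * real (size (c (r m)))\<rceil>" for m
  define \<tau> where "\<tau> m = real (M m) / real (size (c (r m)))" for m
  have \<tau>: "\<tau> \<longlonglongrightarrow> t"
  proof -
    have "((\<lambda>n. real (nat \<lceil>t * real n\<rceil>) / real n) \<longlongrightarrow> t) sequentially" using t(1) by real_asymp
    from filterlim_compose[OF this szlim] show ?thesis unfolding \<tau>_def[abs_def] M_def .
  qed
  have \<tau>0: "\<tau> m \<ge> 0" for m by (simp add: \<tau>_def)
  \<comment> \<open>Realise the improvement of the limit law by integer counts.\<close>
  define c' where "c' m = c (r m) + replicate_mset (M m) k" for m
  have fc': "freq (c' m) v = 1 / (1 + \<tau> m) * (freq (c (r m)) v + \<tau> m * of_bool (v = k))" for m v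
  proof -
    have eq: "(x + y * z) / (n + y) = 1 / (1 + y / n) * (x / n + y / n * z)"
      if "n > 0" "y \<ge> 0" for x y z n :: real
    proof -
      have "1 + y / n = (n + y) / n" using that by (simp add: add_divide_distrib)
      moreover have "x / n + y / n * z = (x + y * z) / n" by (simp add: add_divide_distrib)
      ultimately show ?thesis using that by simp
    qed
    have "freq (c' m) v = (real (count (c (r m)) v) + real (M m) * of_bool (v = k)) / (real (size (c (r m))) + real (M m))"
      by (simp add: freq_def c'_def)
    also have "\<dots> = 1 / (1 + \<tau> m) * (freq (c (r m)) v + \<tau> m * of_bool (v = k))"
      unfolding \<tau>_def freq_def by (rule eq) (use sz[of m] in auto)
    finally show ?thesis .
  qed
  have "(\<lambda>m. fail_prob ?S (freq (c' m))) \<longlonglongrightarrow> fail_prob ?S (\<lambda>v. 1 / (1 + t) * (q v + t * of_bool (v = k)))"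
    unfolding fc' by (intro tendsto_fail_prob tendsto_intros \<tau>) (use q t in auto)
  moreover have "fail_prob ?S (\<lambda>v. 1 / (1 + t) * (q v + t * of_bool (v = k))) < ?b"
    unfolding fail_prob_scale using t by (simp add: power_divide field_simps)
  ultimately have ev1: "\<forall>\<^sub>F m in sequentially. fail_prob ?S (freq (c' m)) < ?b" by (rule order_tendstoD)
  have "\<forall>\<^sub>F m in sequentially. \<tau> m < 2 * t" by (rule order_tendstoD(2)[OF \<tau>]) (use t in auto)
  with ev1 have "\<forall>\<^sub>F m in sequentially. fail_prob ?S (freq (c' m)) < ?b \<and> \<tau> m < 2 * t" by eventually_elim auto
  then obtain m where m: "fail_prob ?S (freq (c' m)) < ?b" "\<tau> m < 2 * t"
    using eventually_happens'[OF sequentially_bot] by blast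
  let ?n = "size (c (r m))"
  have n0: "real ?n > 0" using sz[of m] by simp
  have "exp (- real ?n * (\<epsilon> / 4)) \<le> ?p k ^ M m"
  proof -
    have "real (M m) * - ln (?p k) \<le> (2 * t * real ?n) * L"
      using m(2) n0 Lk[OF k] p[of k] L0 t by (intro mult_mono) (auto simp: \<tau>_def field_simps)
    also have "\<dots> \<le> (2 * t0 * real ?n) * L" using t L0 n0 by (intro mult_right_mono) auto
    also have "\<dots> = real ?n * (\<epsilon> / 4) * (L / (1 + L))" using L0 by (simp add: t0_def field_simps)
    also have "\<dots> \<le> real ?n * (\<epsilon> / 4) * 1" using L0 \<epsilon> by (intro mult_left_mono) (auto simp: divide_le_eq_1)
    finally have "- (real ?n * (\<epsilon> / 4)) \<le> real (M m) * ln (?p k)" by simp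
    then have "exp (- (real ?n * (\<epsilon> / 4))) \<le> exp (real (M m) * ln (?p k))" by simp
    also have "\<dots> = ?p k ^ M m" using p[of k] by (simp add: exp_of_nat_mult)
    finally show ?thesis by simp
  qed
  then have "exp (- real ?n * (R + \<epsilon> / 4)) * exp (- real ?n * (\<epsilon> / 4)) \<le> type_mass ?p (c (r m)) * ?p k ^ M m"
    by (intro mult_mono c(4) type_mass_nonneg) (auto intro: less_imp_le p)
  also have "\<dots> \<le> type_mass ?p (c (r m)) * type_mass ?p (replicate_mset (M m) k)"
    by (intro mult_left_mono type_mass_replicate type_mass_nonneg) (auto intro: less_imp_le p)
  also have "\<dots> \<le> type_mass ?p (c' m)" unfolding c'_def by (rule type_mass_add) (auto intro: less_imp_le p)
  finally have "exp (- real ?n * (R + \<epsilon> / 2)) \<le> type_mass ?p (c' m)" by (simp add: exp_add[symmetric] algebra_simps)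
  moreover have "exp (- real (size (c' m)) * (R + \<epsilon> / 2)) \<le> exp (- real ?n * (R + \<epsilon> / 2))"
    unfolding exp_le_cancel_iff using R \<epsilon> by (intro mult_right_mono) (auto simp: c'_def)
  ultimately have tm: "exp (- real (size (c' m)) * (R + \<epsilon> / 2)) \<le> type_mass ?p (c' m)" by linarith
  have "c' m \<noteq> {#}" "set_mset (c' m) \<subseteq> ?S" using c(1)[of "r m"] sz[of m] k by (auto simp: c'_def split: if_splits)
  from tail_ge_repeated_type[OF P(2) d alphabet(1,2) this(2,1) m(1) _ tm, of "\<epsilon> / 2"] R \<epsilon> show ?thesis by (simp add: add.commute)
qed

section \<open>Existence and continuity of the rate\<close>

definition log_rate :: "(nat \<Rightarrow> real \<Rightarrow> real) \<Rightarrow> real \<Rightarrow> nat \<Rightarrow> real" where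
  "log_rate P a n = - ln (P n a) / real n"

definition rate :: "(nat \<Rightarrow> real \<Rightarrow> real) \<Rightarrow> real \<Rightarrow> real" where
  "rate P a = lim (log_rate P a)"

lemma sandwiched_pos:
  assumes "sandwiched P" "a \<le> 1/2" "n \<ge> 6" shows "(1/4) ^ n \<le> P n a" "0 < P n a"
proof -
  show "(1/4) ^ n \<le> P n a" using sandwichedD(3)[OF assms(1,2), of n] sandwichedD(4)[OF assms(1,3)] by linarith
  then show "0 < P n a" by (rule less_le_trans[rotated]) simp
qed

lemma log_rate_bounds:
  assumes "sandwiched P" "a \<le> 1/2" "n \<ge> 6" shows "0 \<le> log_rate P a n" "log_rate P a n \<le> ln 4"
proof -
  have pos: "0 < P n a" using sandwiched_pos[OF assms] by simp
  show "0 \<le> log_rate P a n" unfolding log_rate_def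
    using pos sandwichedD(2)[OF assms(1), of n a] by (intro divide_nonneg_nonneg) auto
  have "ln ((1/4) ^ n) \<le> ln (P n a)" using sandwiched_pos[OF assms] by (subst ln_le_cancel_iff) auto
  then have "- real n * ln 4 \<le> ln (P n a)" by (simp add: ln_realpow ln_div)
  then show "log_rate P a n \<le> ln 4" using assms(3) by (simp add: log_rate_def field_simps)
qed

lemma log_rate_le_iff:
  assumes "sandwiched P" "a \<le> 1/2" "n \<ge> 6" shows "log_rate P a n \<le> R \<longleftrightarrow> exp (- real n * R) \<le> P n a"
proof -
  have pos: "0 < P n a" using sandwiched_pos[OF assms] by simp
  have "log_rate P a n \<le> R \<longleftrightarrow> - ln (P n a) \<le> R * real n"
    unfolding log_rate_def using assms(3) by (intro pos_divide_le_eq) simp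
  also have "\<dots> \<longleftrightarrow> - (real n * R) \<le> ln (P n a)" by (subst minus_le_iff) (simp add: mult.commute)
  also have "\<dots> \<longleftrightarrow> exp (- (real n * R)) \<le> P n a" by (rule ln_ge_iff[OF pos])
  finally show ?thesis by simp
qed

text \<open>A subsequential limit \<open>l\<close> of the rates of \<open>P\<close> is the limit for every family: rates of \<open>P\<close> near \<open>l\<close> force the
  rates of \<open>P'\<close> below \<open>l + \<epsilon>\<close>, and rates of \<open>P'\<close> infinitely often below \<open>l - \<epsilon>\<close> would
  eventually force the rates of \<open>P\<close> below \<open>l - \<epsilon> / 2\<close>.\<close>

lemma log_rate_converges:
  assumes P: "sandwiched P" and a: "a < 1/2"
  shows "\<exists>l\<ge>0. \<forall>P'. sandwiched P' \<longrightarrow> log_rate P' a \<longlonglongrightarrow> l"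
proof -
  have "seq_compact {0..ln (4::real)}" by (simp add: compact_imp_seq_compact)
  moreover have "\<forall>n. log_rate P a (n + 6) \<in> {0..ln 4}" using log_rate_bounds[OF P] a by simp
  ultimately obtain l r where l: "l \<in> {0..ln 4}" "strict_mono r" "((\<lambda>n. log_rate P a (n + 6)) \<circ> r) \<longlonglongrightarrow> l"
    unfolding seq_compact_def by meson
  have r: "r m \<ge> m" for m using l(2) by (rule seq_suble)
  have up: "\<exists>\<^sub>F n in sequentially. exp (- real n * (l + \<epsilon>)) \<le> P n a" if "\<epsilon> > 0" for \<epsilon>
  proof -
    have "\<forall>\<^sub>F m in sequentially. ((\<lambda>n. log_rate P a (n + 6)) \<circ> r) m < l + \<epsilon>"
      by (rule order_tendstoD(2)[OF l(3)]) (use that in simp)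
    then obtain M where M: "log_rate P a (r m + 6) < l + \<epsilon>" if "m \<ge> M" for m by (auto simp: eventually_sequentially)
    show ?thesis unfolding frequently_sequentially
    proof
      fix N
      have "exp (- real (r (max M N) + 6) * (l + \<epsilon>)) \<le> P (r (max M N) + 6) a"
        using M[of "max M N"] log_rate_le_iff[OF P, of a "r (max M N) + 6" "l + \<epsilon>"] a by simp
      moreover have "r (max M N) + 6 \<ge> N" using r[of "max M N"] by linarith
      ultimately show "\<exists>n\<ge>N. exp (- real n * (l + \<epsilon>)) \<le> P n a" by blast
    qed
  qed
  have "log_rate P' a \<longlonglongrightarrow> l" if P': "sandwiched P'" for P'
  proof (rule order_tendstoI)
    fix x assume x: "l < x"
    define \<epsilon> where "\<epsilon> = (x - l) / 4"
    have \<epsilon>: "\<epsilon> > 0" using x by (simp add: \<epsilon>_def)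
    have "\<exists>\<eta>>0. \<forall>\<^sub>F n in sequentially. exp (- real n * (l + \<epsilon> + \<epsilon>)) \<le> P' n (a + \<eta>)"
    proof (rule tail_transfer[OF P P' a])
      fix \<eta> :: real assume "\<eta> > 0"
      show "\<exists>\<^sub>F n in sequentially. exp (- real n * (l + \<epsilon>)) \<le> P n (a - \<eta>)"
        by (rule frequently_mono[OF _ up[OF \<epsilon>]])
           (use \<open>\<eta> > 0\<close> sandwichedD(3)[OF P, of "a - \<eta>" a] in \<open>auto intro: order_trans\<close>)
    qed (use l \<epsilon> in auto)
    then obtain \<eta> where \<eta>: "\<eta> > 0" "\<forall>\<^sub>F n in sequentially. exp (- real n * (l + \<epsilon> + \<epsilon>)) \<le> P' n (a + \<eta>)" by blast
    from \<eta>(2) show "\<forall>\<^sub>F n in sequentially. log_rate P' a n < x"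
      using eventually_ge_at_top[of 6]
    proof eventually_elim
      case (elim n)
      have "exp (- real n * (l + \<epsilon> + \<epsilon>)) \<le> P' n a"
        using elim \<eta>(1) sandwichedD(3)[OF P', of a "a + \<eta>" n] by linarith
      then have "log_rate P' a n \<le> l + \<epsilon> + \<epsilon>" using log_rate_le_iff[OF P', of a n] elim a by simp
      then show ?case using x by (simp add: \<epsilon>_def field_simps)
    qed
  next
    fix x assume x: "x < l"
    define \<epsilon> where "\<epsilon> = (l - x) / 2"
    have \<epsilon>: "\<epsilon> > 0" using x by (simp add: \<epsilon>_def)
    show "\<forall>\<^sub>F n in sequentially. x < log_rate P' a n"
    proof (rule ccontr)
      assume "\<not> ?thesis"
      then have F: "\<exists>\<^sub>F n in sequentially. log_rate P' a n \<le> x" by (simp add: not_eventually not_less)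
      then have F': "\<exists>\<^sub>F n in sequentially. exp (- real n * x) \<le> P' n a \<and> 0 \<le> x"
      proof (rule frequently_rev_mp)
        show "\<forall>\<^sub>F n in sequentially. log_rate P' a n \<le> x \<longrightarrow> exp (- real n * x) \<le> P' n a \<and> 0 \<le> x"
          using eventually_ge_at_top[of 6]
        proof eventually_elim
          case (elim n)
          then show ?case using log_rate_le_iff[OF P', of a n x] log_rate_bounds(1)[OF P', of a n] a by linarith
        qed
      qed
      then have x0: "x \<ge> 0" by (auto dest: frequently_ex)
      have "\<exists>\<eta>>0. \<forall>\<^sub>F n in sequentially. exp (- real n * (x + \<epsilon>)) \<le> P n (a + \<eta>)"
      proof (rule tail_transfer[OF P' P a x0 \<epsilon>])
        fix \<eta> :: real assume "\<eta> > 0"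
        show "\<exists>\<^sub>F n in sequentially. exp (- real n * x) \<le> P' n (a - \<eta>)"
          by (rule frequently_mono[OF _ F'])
             (use \<open>\<eta> > 0\<close> sandwichedD(3)[OF P', of "a - \<eta>" a] in \<open>auto intro: order_trans\<close>)
      qed
      then obtain \<eta> where \<eta>: "\<eta> > 0" "\<forall>\<^sub>F n in sequentially. exp (- real n * (x + \<epsilon>)) \<le> P n (a + \<eta>)" by blast
      then obtain N where N: "exp (- real n * (x + \<epsilon>)) \<le> P n (a + \<eta>)" if "n \<ge> N" for n
        by (auto simp: eventually_sequentially)
      have "((\<lambda>n. log_rate P a (n + 6)) \<circ> r) m \<le> x + \<epsilon>" if "m \<ge> N" for m
      proof -
        have "exp (- real (r m + 6) * (x + \<epsilon>)) \<le> P (r m + 6) a"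
          using N[of "r m + 6"] r[of m] that \<eta>(1) sandwichedD(3)[OF P, of a "a + \<eta>" "r m + 6"] by linarith
        then show ?thesis using log_rate_le_iff[OF P, of a "r m + 6"] a by simp
      qed
      then have "l \<le> x + \<epsilon>" by (intro LIMSEQ_le_const2[OF l(3)]) blast
      then show False using x by (simp add: \<epsilon>_def field_simps)
    qed
  qed
  then show ?thesis using l(1) by auto
qed

lemma log_rate_tendsto:
  assumes "sandwiched P" "sandwiched P'" "a < 1/2"
  shows "log_rate P' a \<longlonglongrightarrow> rate P a"
proof -
  obtain l where l: "\<And>P'. sandwiched P' \<Longrightarrow> log_rate P' a \<longlonglongrightarrow> l"
    using log_rate_converges[OF assms(1,3)] by blast
  then have "rate P a = l" unfolding rate_def using assms(1) by (intro limI) blast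
  then show ?thesis using l[OF assms(2)] by simp
qed

lemma rate_nonneg:
  assumes "sandwiched P" "a < 1/2" shows "rate P a \<ge> 0"
proof -
  obtain l where "l \<ge> 0" "log_rate P a \<longlonglongrightarrow> l"
    using log_rate_converges[OF assms] assms(1) by blast
  then show ?thesis unfolding rate_def by (simp add: limI)
qed

lemma rate_mono:
  assumes P: "sandwiched P" and "a \<le> b" "b < 1/2" shows "rate P a \<le> rate P b"
proof (rule LIMSEQ_le[OF log_rate_tendsto log_rate_tendsto])
  show "\<exists>N. \<forall>n\<ge>N. log_rate P a n \<le> log_rate P b n"
  proof (intro exI[of _ 6] allI impI)
    fix n :: nat assume n: "n \<ge> 6"
    have "ln (P n b) \<le> ln (P n a)"
      using sandwiched_pos[OF P _ n] sandwichedD(3)[OF P] assms by (subst ln_le_cancel_iff) auto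
    then show "log_rate P a n \<le> log_rate P b n" by (simp add: log_rate_def divide_right_mono)
  qed
qed (use assms in auto)

lemma rate_le_of_tail:
  assumes P: "sandwiched P" and a: "a < 1/2" and ev: "\<forall>\<^sub>F n in sequentially. exp (- real n * R) \<le> P n a"
  shows "rate P a \<le> R"
proof (rule tendsto_upperbound[OF log_rate_tendsto[OF P P a]])
  show "\<forall>\<^sub>F n in sequentially. log_rate P a n \<le> R"
    using ev eventually_ge_at_top[of 6] by eventually_elim (use log_rate_le_iff[OF P, of a] a in auto)
qed simp

lemma rate_ge_of_tail:
  assumes P: "sandwiched P" and a: "a < 1/2" and ev: "\<forall>\<^sub>F n in sequentially. P n a \<le> exp (- real n * R)"
  shows "R \<le> rate P a"
proof (rule tendsto_lowerbound[OF log_rate_tendsto[OF P P a]])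
  show "\<forall>\<^sub>F n in sequentially. R \<le> log_rate P a n"
    using ev eventually_ge_at_top[of 6]
  proof eventually_elim
    case (elim n)
    have "ln (P n a) \<le> ln (exp (- real n * R))"
      using elim sandwiched_pos[OF P _ elim(2), of a] a by (subst ln_le_cancel_iff) auto
    then show ?case using elim(2) by (simp add: log_rate_def field_simps)
  qed
qed simp

lemma tail_ge_of_rate:
  assumes P: "sandwiched P" and a: "a < 1/2" and R: "rate P a < R"
  shows "\<forall>\<^sub>F n in sequentially. exp (- real n * R) \<le> P n a"
  using order_tendstoD(2)[OF log_rate_tendsto[OF P P a] R] eventually_ge_at_top[of 6]
proof eventually_elim
  case (elim n)
  then show ?case using log_rate_le_iff[OF P, of a n R] a by simp
qed

text \<open>The increase of the level in \<open>tail_transfer\<close> gives continuity from the right, its weak hypothesis gives continuity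
  from the left.\<close>

lemma rate_continuous:
  assumes P: "sandwiched P" and a: "a < 1/2" shows "isCont (rate P) a"
  unfolding continuous_at_eps_delta
proof (intro allI impI)
  fix e :: real assume e: "e > 0"
  define \<epsilon> where "\<epsilon> = e / 4"
  have \<epsilon>: "\<epsilon> > 0" using e by (simp add: \<epsilon>_def)
  have "\<exists>\<eta>>0. \<forall>\<^sub>F n in sequentially. exp (- real n * (rate P a + \<epsilon> + \<epsilon>)) \<le> P n (a + \<eta>)"
  proof (rule tail_transfer[OF P P a])
    fix \<eta> :: real assume "\<eta> > 0"
    have "\<forall>\<^sub>F n in sequentially. exp (- real n * (rate P a + \<epsilon>)) \<le> P n (a - \<eta>)"
      by (rule eventually_mono[OF tail_ge_of_rate[OF P a, of "rate P a + \<epsilon>"]])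
         (use \<epsilon> \<open>\<eta> > 0\<close> sandwichedD(3)[OF P, of "a - \<eta>" a] in \<open>auto intro: order_trans\<close>)
    then show "\<exists>\<^sub>F n in sequentially. exp (- real n * (rate P a + \<epsilon>)) \<le> P n (a - \<eta>)"
      by (rule eventually_frequently[OF sequentially_bot])
  qed (use rate_nonneg[OF P a] \<epsilon> in auto)
  then obtain \<eta>1 where \<eta>1: "\<eta>1 > 0" "\<forall>\<^sub>F n in sequentially. exp (- real n * (rate P a + \<epsilon> + \<epsilon>)) \<le> P n (a + \<eta>1)" by blast
  define \<eta>2 where "\<eta>2 = min \<eta>1 ((1/2 - a) / 2)"
  have \<eta>2: "0 < \<eta>2" "\<eta>2 \<le> \<eta>1" "a + \<eta>2 < 1/2" using \<eta>1 a by (auto simp: \<eta>2_def min_def field_simps)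
  have right: "rate P (a + \<eta>2) \<le> rate P a + \<epsilon> + \<epsilon>"
    by (rule rate_le_of_tail[OF P \<eta>2(3)], rule eventually_mono[OF \<eta>1(2)])
       (use \<eta>2 sandwichedD(3)[OF P, of "a + \<eta>2" "a + \<eta>1"] in \<open>auto intro: order_trans\<close>)
  have "\<exists>\<eta>>0. rate P a - 2 * \<epsilon> \<le> rate P (a - \<eta>)"
  proof (rule ccontr)
    assume "\<not> ?thesis"
    then have less: "rate P (a - \<eta>) < rate P a - 2 * \<epsilon>" if "\<eta> > 0" for \<eta> using that by force
    have "\<exists>\<eta>>0. \<forall>\<^sub>F n in sequentially. exp (- real n * (rate P a - 2 * \<epsilon> + \<epsilon>)) \<le> P n (a + \<eta>)"
    proof (rule tail_transfer[OF P P a _ \<epsilon>])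
      show "0 \<le> rate P a - 2 * \<epsilon>" using less[of 1] rate_nonneg[OF P, of "a - 1"] a by simp
      fix \<eta> :: real assume "\<eta> > 0"
      then have "\<forall>\<^sub>F n in sequentially. exp (- real n * (rate P a - 2 * \<epsilon>)) \<le> P n (a - \<eta>)"
        using a by (intro tail_ge_of_rate[OF P _ less]) auto
      then show "\<exists>\<^sub>F n in sequentially. exp (- real n * (rate P a - 2 * \<epsilon>)) \<le> P n (a - \<eta>)"
        by (rule eventually_frequently[OF sequentially_bot])
    qed
    then obtain \<eta> where \<eta>: "\<eta> > 0" "\<forall>\<^sub>F n in sequentially. exp (- real n * (rate P a - 2 * \<epsilon> + \<epsilon>)) \<le> P n (a + \<eta>)" by blast
    have "rate P a \<le> rate P a - 2 * \<epsilon> + \<epsilon>"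
      by (rule rate_le_of_tail[OF P a], rule eventually_mono[OF \<eta>(2)])
         (use \<eta>(1) sandwichedD(3)[OF P, of a "a + \<eta>"] in \<open>auto intro: order_trans\<close>)
    then show False using \<epsilon> by simp
  qed
  then obtain \<eta>3 where \<eta>3: "\<eta>3 > 0" "rate P a - 2 * \<epsilon> \<le> rate P (a - \<eta>3)" by blast
  show "\<exists>d>0. \<forall>x'. dist x' a < d \<longrightarrow> dist (rate P x') (rate P a) < e"
  proof (intro exI[of _ "min \<eta>2 \<eta>3"] conjI allI impI)
    fix x assume x: "dist x a < min \<eta>2 \<eta>3"
    then have "a - \<eta>3 \<le> x" "x \<le> a + \<eta>2" by (auto simp: dist_real_def abs_less_iff)
    then have "rate P (a - \<eta>3) \<le> rate P x" "rate P x \<le> rate P (a + \<eta>2)"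
      using \<eta>2 by (auto intro!: rate_mono[OF P])
    then have "\<bar>rate P x - rate P a\<bar> \<le> 2 * \<epsilon>" using right \<eta>3(2) by linarith
    then show "dist (rate P x) (rate P a) < e" using e by (simp add: dist_real_def \<epsilon>_def)
  qed (use \<eta>2 \<eta>3 in auto)
qed

section \<open>The rate at and above one half\<close>

lemma tail_zero_above_half:
  assumes P: "sandwiched P" and a: "a > 1/2" shows "\<forall>\<^sub>F n in sequentially. P n a = 0"
proof -
  have "(\<lambda>n. 1/2 - a + 300 / real n) \<longlonglongrightarrow> 1/2 - a + 0" by (intro tendsto_add tendsto_const) real_asymp
  then have "\<forall>\<^sub>F n in sequentially. 1/2 - a + 300 / real n < 0" by (rule order_tendstoD) (use a in simp)
  then show ?thesis using eventually_ge_at_top[of 6]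
  proof eventually_elim
    case (elim n)
    have "fail_prob (alphabet 0) (freq c) \<ge> 0" for c by (rule fail_prob_nonneg) (rule freq_nonneg)
    then have T: "{w \<in> words (alphabet 0) n. fail_prob (alphabet 0) (freq (mset w)) \<le> 1/2 - a + 300 / real n} = {}"
      using elim by (force simp: not_le intro: less_le_trans)
    have "P n a \<le> mass (upper_weight 1 0) {}" unfolding T[symmetric] by (rule sandwichedD(5)[OF P _ elim(2)]) simp
    then have "P n a \<le> 0" by (simp add: mass_def)
    then show ?case using sandwichedD(1)[OF P, of n a] by simp
  qed
qed

lemma upper_weight_tail:
  assumes "m \<ge> 2" "m \<le> K + 2" shows "sum (upper_weight d K) {m..K + 2} = exp (- d * (real m - 2))"
  using assms(2,1)
proof (induction m rule: inc_induct)
  case base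
  show ?case by (simp add: upper_weight_def)
next
  case (step m)
  have "sum (upper_weight d K) {m..K + 2} = upper_weight d K m + sum (upper_weight d K) {Suc m..K + 2}"
    using step by (subst sum.atLeast_Suc_atMost) auto
  also have "\<dots> = exp (- d * (real m - 2)) * (1 - exp (- d)) + exp (- d * (real (Suc m) - 2))"
    using step by (simp add: upper_weight_def)
  also have "\<dots> = exp (- d * (real m - 2))"
    by (simp add: algebra_simps exp_add[symmetric])
  finally show ?case .
qed

text \<open>With \<open>t = e\<^bsup>-dm\<^esup>\<close> the octave \<open>[m, 2 m)\<close> has weight \<open>e\<^bsup>2d\<^esup> (t - t\<^sup>2)\<close> unless it
  reaches the last cell, where \<open>t\<close> is small, and \<open>t - t\<^sup>2 \<le> 1/4\<close>.\<close>

lemma octave_weight_le: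
  assumes d: "d > 0" and K: "d * real K \<ge> 2 * ln 4" and m: "m \<in> alphabet K"
  shows "sum (upper_weight d K) (alphabet K \<inter> {m..<2 * m}) \<le> exp (2 * d) / 4"
proof -
  have m': "m \<ge> 2" "m \<le> K + 2" using m by (auto simp: alphabet_def)
  define t where "t = exp (- d * real m)"
  have em: "exp (- d * (real m - 2)) = exp (2 * d) * t" by (simp add: t_def exp_add[symmetric] algebra_simps)
  show ?thesis
  proof (cases "2 * m \<le> K + 2")
    case True
    have eq: "alphabet K \<inter> {m..<2 * m} = {m..K + 2} - {2 * m..K + 2}" using m' True by (auto simp: alphabet_def)
    have "sum (upper_weight d K) (alphabet K \<inter> {m..<2 * m}) = sum (upper_weight d K) {m..K + 2} - sum (upper_weight d K) {2 * m..K + 2}"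
      unfolding eq by (rule sum_diff) auto
    also have "\<dots> = exp (2 * d) * t - exp (- d * (real (2 * m) - 2))"
      using upper_weight_tail[of m K d] upper_weight_tail[of "2 * m" K d] m' True em by simp
    also have "exp (- d * (real (2 * m) - 2)) = exp (2 * d) * t\<^sup>2"
      by (simp add: t_def power2_eq_square exp_add[symmetric] algebra_simps)
    also have "exp (2 * d) * t - exp (2 * d) * t\<^sup>2 = exp (2 * d) * (1 / 4 - (t - 1 / 2)\<^sup>2)"
      by (simp add: power2_eq_square algebra_simps)
    also have "\<dots> \<le> exp (2 * d) * (1 / 4)" by (intro mult_left_mono) auto
    finally show ?thesis by simp
  next
    case False
    have "sum (upper_weight d K) (alphabet K \<inter> {m..<2 * m}) \<le> sum (upper_weight d K) {m..K + 2}"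
      by (rule sum_mono2) (use upper_weight_pos[OF d, of K] in \<open>auto simp: alphabet_def intro: less_imp_le\<close>)
    also have "\<dots> = exp (2 * d) * t" using upper_weight_tail[OF m', of d] em by simp
    also have "\<dots> \<le> exp (2 * d) * (1 / 4)"
    proof -
      have "real K \<le> 2 * real m" using False by linarith
      then have "d * real K \<le> d * (2 * real m)" using d by (intro mult_left_mono) auto
      then have "ln 4 \<le> d * real m" using K by simp
      then have "t \<le> exp (- ln 4)" by (simp add: t_def)
      then show ?thesis by (intro mult_left_mono) (auto simp: exp_minus)
    qed
    finally show ?thesis by simp
  qed
qed

text \<open>Take for \<open>m\<close> the \<open>\<eta>\<close>-quantile. Any letter \<open>x \<ge> 2 m\<close> fails against all \<open>y, u \<le> m\<close>, so few failures leave
  little mass above \<open>2 m\<close>.\<close>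

lemma few_failures_octave:
  assumes S: "finite S" and f: "\<And>v. v \<in> S \<Longrightarrow> f v \<ge> 0" "sum f S = 1" and \<eta>: "0 < \<eta>" "\<eta> < 1"
    and \<Phi>: "fail_prob S f < 4 * \<eta> ^ 5"
  shows "\<exists>m\<in>S. sum f (S - {m..<2 * m}) \<le> 2 * \<eta>"
proof -
  define G where "G m = sum f {v \<in> S. v \<le> m}" for m
  have "G (Max (insert 0 S)) = 1"
  proof -
    have "{v \<in> S. v \<le> Max (insert 0 S)} = S" using S by auto
    then show ?thesis using f(2) by (simp add: G_def)
  qed
  then have ex: "\<exists>m. G m > \<eta>" using \<eta> by metis
  define m where "m = (LEAST m. G m > \<eta>)"
  have m: "G m > \<eta>" unfolding m_def by (rule LeastI_ex[OF ex])
  have below: "G j \<le> \<eta>" if "j < m" for j using not_less_Least[of j "\<lambda>m. G m > \<eta>"] that unfolding m_def by simp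
  have lo: "sum f {v \<in> S. v < m} \<le> \<eta>"
  proof (cases m)
    case 0 then show ?thesis using \<eta> by simp
  next
    case (Suc j)
    then have "{v \<in> S. v < m} = {v \<in> S. v \<le> j}" by auto
    then show ?thesis using below[of j] Suc by (simp add: G_def)
  qed
  have mS: "m \<in> S"
  proof (rule ccontr)
    assume "m \<notin> S"
    then have "{v \<in> S. v \<le> m} = {v \<in> S. v < m}" by (auto simp: le_less)
    then show False using m lo by (simp add: G_def)
  qed
  define s where "s = sum f {v \<in> S. 2 * m \<le> v}"
  have s0: "s \<ge> 0" unfolding s_def using f by (intro sum_nonneg) auto
  have "s * (G m * G m ^ 3) \<le> (\<Sum>x\<in>S. \<Sum>y\<in>S. f x * f y * low S f x y ^ 3)"
  proof -
    have "s * (G m * G m ^ 3) = sum f {x \<in> S. 2 * m \<le> x} * (\<Sum>y | y \<in> S \<and> y \<le> m. f y * G m ^ 3)"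
      by (simp only: s_def sum_distrib_right[symmetric] G_def[symmetric])
    also have "\<dots> = (\<Sum>x | x \<in> S \<and> 2 * m \<le> x. \<Sum>y | y \<in> S \<and> y \<le> m. f x * f y * G m ^ 3)"
      by (simp only: sum_product mult.assoc)
    also have "\<dots> \<le> (\<Sum>x | x \<in> S \<and> 2 * m \<le> x. \<Sum>y | y \<in> S \<and> y \<le> m. f x * f y * low S f x y ^ 3)"
    proof (intro sum_mono mult_left_mono power_mono)
      fix x y assume "x \<in> {x \<in> S. 2 * m \<le> x}" "y \<in> {y \<in> S. y \<le> m}"
      then show "G m \<le> low S f x y" unfolding G_def low_def using S f by (intro sum_mono2) auto
    qed (use f in \<open>auto simp: G_def intro: sum_nonneg\<close>)
    also have "\<dots> \<le> (\<Sum>x | x \<in> S \<and> 2 * m \<le> x. \<Sum>y\<in>S. f x * f y * low S f x y ^ 3)"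
      using S f by (intro sum_mono sum_mono2) (auto intro!: mult_nonneg_nonneg zero_le_power low_nonneg)
    also have "\<dots> \<le> (\<Sum>x\<in>S. \<Sum>y\<in>S. f x * f y * low S f x y ^ 3)"
      using S f by (intro sum_mono2) (auto intro!: sum_nonneg mult_nonneg_nonneg zero_le_power low_nonneg)
    finally show ?thesis .
  qed
  then have "s * G m ^ 4 < \<eta> ^ 5" using \<Phi> by (simp add: fail_prob_def eval_nat_numeral)
  moreover have "s * \<eta> ^ 4 \<le> s * G m ^ 4" using m \<eta> s0 by (intro mult_left_mono power_mono) auto
  ultimately have "s * \<eta> ^ 4 < \<eta> * \<eta> ^ 4" by (simp add: eval_nat_numeral)
  then have "s < \<eta>" using \<eta> by simp
  moreover have "S - {m..<2 * m} = {v \<in> S. v < m} \<union> {v \<in> S. 2 * m \<le> v}" by auto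
  then have "sum f (S - {m..<2 * m}) = sum f {v \<in> S. v < m} + s"
    unfolding s_def using S by (simp only:) (rule sum.union_disjoint, auto)
  ultimately show ?thesis using mS lo by (intro bexI[of _ m]) auto
qed

text \<open>At this level almost no failures are allowed, so almost all letters lie in one octave.\<close>

lemma tail_at_half:
  assumes P: "sandwiched P" and \<epsilon>: "\<epsilon> > 0"
  shows "\<forall>\<^sub>F n in sequentially. P n (1/2) \<le> exp (- real n * (ln 4 - \<epsilon>))"
proof -
  define d where "d = \<epsilon> / 5"
  have d: "d > 0" using \<epsilon> by (simp add: d_def)
  define K where "K = nat \<lceil>2 * ln 4 / d\<rceil>"
  have "2 * ln 4 / d \<le> real K" unfolding K_def by (rule real_nat_ceiling_ge)
  then have K: "d * real K \<ge> 2 * ln 4" using d by (simp add: field_simps)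
  let ?S = "alphabet K" and ?p = "upper_weight d K"
  have p: "?p v \<ge> 0" for v using upper_weight_pos[OF d, of K v] by simp
  \<comment> \<open>Letters outside the octave are discounted by \<open>exp (- s)\<close>, which is negligible against the weight of the octave; few of them occur, so undoing the discount is cheap.\<close>
  define s where "s = max 0 (- ln (exp (2 * d) / 4 * d))"
  have s: "s \<ge> 0" "exp (- s) \<le> exp (2 * d) / 4 * d"
  proof -
    have pos: "exp (2 * d) / 4 * d > 0" using d by simp
    have "exp (- s) \<le> exp (ln (exp (2 * d) / 4 * d))" unfolding s_def exp_le_cancel_iff by linarith
    then show "exp (- s) \<le> exp (2 * d) / 4 * d" using pos by (simp only: exp_ln)
  qed (simp add: s_def)
  define \<eta> where "\<eta> = min (1/2) (d / (2 * (1 + s)))"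
  have \<eta>: "0 < \<eta>" "\<eta> < 1" "2 * \<eta> * s \<le> d"
  proof -
    show "0 < \<eta>" "\<eta> < 1" using d s by (auto simp: \<eta>_def)
    have "2 * \<eta> * s \<le> 2 * (d / (2 * (1 + s))) * (1 + s)" using s d by (intro mult_mono) (auto simp: \<eta>_def)
    also have "\<dots> = d"
    proof -
      have "2 * (1 + s) \<noteq> 0" using s by simp
      then have "d / (2 * (1 + s)) * (2 * (1 + s)) = d" by (rule nonzero_eq_divide_eq[THEN iffD1, OF _ refl])
      then show ?thesis by (simp only: mult_ac)
    qed
    finally show "2 * \<eta> * s \<le> d" .
  qed
  define E where "E n m = {w \<in> words ?S n. sum (freq (mset w)) (?S - {m..<2 * m}) \<le> 2 * \<eta>}" for n m
  have E: "mass ?p (E n m) \<le> exp (- real n * (ln 4 - 4 * d))" if m: "m \<in> ?S" for n m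
  proof -
    let ?O = "?S - {m..<2 * m}"
    let ?g = "\<lambda>v. if v \<in> ?O then - s else 0"
    have "mass ?p (E n m) \<le> exp (- (- real n * d)) * (\<Sum>v\<in>?S. ?p v * exp (?g v)) ^ n"
    proof (rule chernoff[OF alphabet(1) p])
      fix w assume w: "w \<in> E n m"
      then have eq: "sum_list (map ?g w) = real n * (\<Sum>v\<in>?S. freq (mset w) v * ?g v)"
        by (intro sum_list_eq_freq alphabet) (auto simp: E_def)
      have "(\<Sum>v\<in>?S. freq (mset w) v * ?g v) = (\<Sum>v\<in>?O. freq (mset w) v * - s)"
        by (intro sum.mono_neutral_cong_right alphabet) auto
      also have "\<dots> = - (sum (freq (mset w)) ?O * s)" by (simp add: sum_distrib_right sum_negf)
      also have "\<dots> \<ge> - d" using w s \<eta>(3) mult_right_mono[of "sum (freq (mset w)) ?O" "2 * \<eta>" s] by (simp add: E_def)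
      finally have "real n * - d \<le> sum_list (map ?g w)" unfolding eq by (intro mult_left_mono) auto
      then show "- real n * d \<le> sum_list (map ?g w)" by simp
    qed (auto simp: E_def)
    also have "(\<Sum>v\<in>?S. ?p v * exp (?g v)) \<le> exp (3 * d) / 4"
    proof -
      have "(\<Sum>v\<in>?S. ?p v * exp (?g v)) = (\<Sum>v\<in>?S \<inter> {m..<2 * m}. ?p v * exp (?g v)) + (\<Sum>v\<in>?O. ?p v * exp (?g v))"
        by (subst sum.union_disjoint[symmetric]) (auto simp: alphabet(1) Int_Diff_Un)
      also have "\<dots> = sum ?p (?S \<inter> {m..<2 * m}) + sum ?p ?O * exp (- s)"
        by (simp add: sum_distrib_right)
      also have "\<dots> \<le> exp (2 * d) / 4 + 1 * (exp (2 * d) / 4 * d)"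
      proof (intro add_mono mult_mono octave_weight_le[OF d K m] s)
        have "sum ?p ?O \<le> sum ?p ?S" by (rule sum_mono2) (use p alphabet(1) in auto)
        then show "sum ?p ?O \<le> 1" by (simp add: upper_weight_sum)
      qed auto
      also have "\<dots> = exp (2 * d) / 4 * (1 + d)" by (simp add: algebra_simps)
      also have "\<dots> \<le> exp (2 * d) / 4 * exp d" by (intro mult_left_mono exp_ge_add_one_self) auto
      also have "\<dots> = exp (3 * d) / 4" by (simp add: exp_add[symmetric])
      finally show ?thesis .
    qed
    then have "(\<Sum>v\<in>?S. ?p v * exp (?g v)) ^ n \<le> (exp (3 * d) / 4) ^ n"
      using p by (intro power_mono sum_nonneg) auto
    also have "exp (3 * d) / 4 = exp (3 * d - ln 4)" by (simp add: exp_diff)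
    also have "exp (3 * d - ln 4) ^ n = exp (real n * (3 * d - ln 4))" by (simp only: exp_of_nat_mult)
    finally have "mass ?p (E n m) \<le> exp (- (- real n * d)) * exp (real n * (3 * d - ln 4))" by simp
    then show ?thesis by (simp add: exp_add[symmetric] algebra_simps)
  qed
  have "\<forall>\<^sub>F n in sequentially. 300 / real n < 4 * \<eta> ^ 5"
  proof (rule order_tendstoD)
    show "(\<lambda>n. 300 / real n) \<longlonglongrightarrow> 0" by real_asymp
  qed (use \<eta> in simp)
  moreover have "\<forall>\<^sub>F n in sequentially. real (card ?S) * exp (- real n * d) < 1"
  proof (rule order_tendstoD)
    show "(\<lambda>n. real (card ?S) * exp (- real n * d)) \<longlonglongrightarrow> 0" using d by real_asymp
  qed simp
  ultimately show ?thesis using eventually_ge_at_top[of 6]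
  proof eventually_elim
    case (elim n)
    let ?T = "{w \<in> words ?S n. fail_prob ?S (freq (mset w)) \<le> 1/2 - 1/2 + 300 / real n}"
    have sub: "?T \<subseteq> (\<Union>m\<in>?S. E n m)"
    proof
      fix w assume w: "w \<in> ?T"
      have "\<exists>m\<in>?S. sum (freq (mset w)) (?S - {m..<2 * m}) \<le> 2 * \<eta>"
      proof (rule few_failures_octave[OF alphabet(1) freq_nonneg _ \<eta>(1,2)])
        show "sum (freq (mset w)) ?S = 1"
          using w elim(3) by (intro sum_freq alphabet) (auto simp: words_def)
        show "fail_prob ?S (freq (mset w)) < 4 * \<eta> ^ 5" using w elim(1) by simp
      qed
      then show "w \<in> (\<Union>m\<in>?S. E n m)" using w by (auto simp: E_def)
    qed
    have "P n (1/2) \<le> mass ?p ?T" by (rule sandwichedD(5)[OF P d elim(3)])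
    also have "\<dots> \<le> mass ?p (\<Union>m\<in>?S. E n m)"
      by (rule mass_mono[OF alphabet(1) _ sub p]) (auto simp: E_def)
    also have "\<dots> \<le> (\<Sum>m\<in>?S. mass ?p (E n m))"
      by (rule mass_UN_le[OF alphabet(1) alphabet(1) _ p]) (auto simp: E_def)
    also have "\<dots> \<le> (\<Sum>m\<in>?S. exp (- real n * (ln 4 - 4 * d)))" by (intro sum_mono E)
    also have "\<dots> = real (card ?S) * exp (- real n * d) * exp (- real n * (ln 4 - 5 * d))"
      by (simp add: mult.assoc exp_add[symmetric] algebra_simps)
    also have "\<dots> \<le> 1 * exp (- real n * (ln 4 - 5 * d))" using elim(2) by (intro mult_right_mono) auto
    finally show ?case by (simp add: d_def)
  qed
qed

lemma log_rate_at_half: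
  assumes P: "sandwiched P" shows "log_rate P (1/2) \<longlonglongrightarrow> ln 4"
proof (rule order_tendstoI)
  fix x :: real assume x: "x < ln 4"
  define \<epsilon> where "\<epsilon> = (ln 4 - x) / 2"
  have "\<epsilon> > 0" using x by (simp add: \<epsilon>_def)
  from tail_at_half[OF P this] eventually_ge_at_top[of 6]
  show "\<forall>\<^sub>F n in sequentially. x < log_rate P (1/2) n"
  proof eventually_elim
    case (elim n)
    have "ln (P n (1/2)) \<le> ln (exp (- real n * (ln 4 - \<epsilon>)))"
      using elim sandwiched_pos[OF P _ elim(2), of "1/2"] by (subst ln_le_cancel_iff) auto
    then have "ln 4 - \<epsilon> \<le> log_rate P (1/2) n" using elim(2) by (simp add: log_rate_def field_simps)
    then show ?case using x by (simp add: \<epsilon>_def field_simps)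
  qed
next
  fix x :: real assume x: "ln 4 < x"
  show "\<forall>\<^sub>F n in sequentially. log_rate P (1/2) n < x"
    using eventually_ge_at_top[of 6]
  proof eventually_elim
    case (elim n)
    then show ?case using x log_rate_bounds(2)[OF P, of "1/2" n] by linarith
  qed
qed

section \<open>The rate at small levels\<close>

lemma fail_deriv_bounds:
  assumes S: "finite S" and q: "\<And>v. v \<in> S \<Longrightarrow> q v \<ge> 0" "sum q S = 1"
  shows "0 \<le> fail_deriv S q k" "fail_deriv S q k \<le> 20"
proof -
  have low: "0 \<le> low S q x y" "low S q x y \<le> 1" for x y
    using low_nonneg[of S q] low_le_1[OF S q] q by auto
  show "0 \<le> fail_deriv S q k" unfolding fail_deriv_def using q low
    by (intro mult_nonneg_nonneg add_nonneg_nonneg sum_nonneg) auto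
  have 1: "(\<Sum>y\<in>S. q y * low S q k y ^ 3) \<le> (\<Sum>y\<in>S. q y * 1)"
    using q low by (intro sum_mono mult_left_mono power_le_one) auto
  have 2: "(\<Sum>x\<in>S. q x * low S q x k ^ 3) \<le> (\<Sum>y\<in>S. q y * 1)"
    using q low by (intro sum_mono mult_left_mono power_le_one) auto
  have 3: "(\<Sum>x\<in>S. \<Sum>y\<in>S. q x * q y * low S q x y ^ 2 * of_bool (k + y \<le> x)) \<le> (\<Sum>x\<in>S. \<Sum>y\<in>S. q x * q y * 1 * 1)"
    using q low by (intro sum_mono mult_mono power_le_one mult_nonneg_nonneg) auto
  have "(\<Sum>x\<in>S. \<Sum>y\<in>S. q x * q y * 1 * 1) = sum q S * sum q S" by (simp add: sum_product)
  then show "fail_deriv S q k \<le> 20" using 1 2 3 q(2) unfolding fail_deriv_def by simp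
qed

text \<open>Change of measure to the product law of \<open>r\<close>: typical words under \<open>r\<close> have few failures, and their weight under
  \<open>lower_weight\<close> is smaller by the exponential of the relative entropy.\<close>

lemma rate_le_relative_entropy:
  assumes P: "sandwiched P" and a: "a < 1/2" and d: "d > 0" and S: "finite S" "S \<subseteq> {1..}"
    and r: "\<And>v. v \<in> S \<Longrightarrow> r v > 0" "sum r S = 1" and \<Phi>: "fail_prob S r < 1/2 - a"
  shows "rate P a \<le> (\<Sum>v\<in>S. r v * ln (r v / lower_weight d v))"
proof -
  let ?p = "lower_weight d"
  define h where "h v = ln (r v / ?p v)" for v
  define KL where "KL = (\<Sum>v\<in>S. r v * h v)"
  have p: "?p v > 0" for v using lower_weight_pos[OF d] .
  define H where "H = (\<Sum>v\<in>S. \<bar>h v\<bar>)"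
  have H: "\<bar>h v\<bar> \<le> H" if "v \<in> S" for v unfolding H_def by (rule member_le_sum) (use that S in auto)
  have H0: "H \<ge> 0" unfolding H_def by (simp add: sum_nonneg)
  have r0: "r v \<ge> 0" if "v \<in> S" for v using r(1)[OF that] by simp
  have "rate P a \<le> KL + \<epsilon>" if \<epsilon>: "\<epsilon> > 0" for \<epsilon>
  proof -
    define gap where "gap = 1/2 - a - fail_prob S r"
    have gap: "gap > 0" using \<Phi> by (simp add: gap_def)
    define \<rho> where "\<rho> = min 1 (min (gap / 248) (\<epsilon> / (2 * (1 + H))))"
    have \<rho>: "0 < \<rho>" "\<rho> \<le> 1" "124 * \<rho> \<le> gap / 2" "\<rho> * H \<le> \<epsilon> / 2"
    proof -
      have "\<epsilon> / (2 * (1 + H)) > 0" using \<epsilon> H0 by (intro divide_pos_pos) auto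
      then show "0 < \<rho>" unfolding \<rho>_def using gap by linarith
      show "\<rho> \<le> 1" unfolding \<rho>_def by (rule min.cobounded1)
      have "\<rho> \<le> gap / 248" unfolding \<rho>_def by (rule order_trans[OF min.cobounded2 min.cobounded1])
      then show "124 * \<rho> \<le> gap / 2" by simp
      have "2 * (1 + H) > 0" using H0 by simp
      moreover have "\<rho> \<le> \<epsilon> / (2 * (1 + H))"
        unfolding \<rho>_def by (rule order_trans[OF min.cobounded2 min.cobounded2])
      ultimately have "\<rho> * (2 * (1 + H)) \<le> \<epsilon>" by (simp only: pos_le_divide_eq)
      then show "\<rho> * H \<le> \<epsilon> / 2" using \<open>0 < \<rho>\<close> by (simp add: algebra_simps)
    qed
    define T where "T n = {w \<in> words S n. (\<Sum>v\<in>S. \<bar>freq (mset w) v - r v\<bar>) < \<rho>}" for n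
    have T\<Phi>: "fail_prob S (freq (mset w)) \<le> 1/2 - a - gap / 2" if "w \<in> T n" for w n
    proof -
      define \<sigma> where "\<sigma> v = freq (mset w) v - r v" for v
      have s: "(\<Sum>v\<in>S. \<bar>\<sigma> v\<bar>) \<le> \<rho>" using that by (simp add: T_def \<sigma>_def)
      have eq: "(\<lambda>v. r v + \<sigma> v) = freq (mset w)" by (auto simp: \<sigma>_def)
      have "\<bar>\<Sum>k\<in>S. fail_deriv S r k * \<sigma> k\<bar> \<le> (\<Sum>k\<in>S. 20 * \<bar>\<sigma> k\<bar>)"
        using fail_deriv_bounds[OF S(1) r0 r(2)]
        by (intro order_trans[OF sum_abs] sum_mono) (auto simp: abs_mult intro!: mult_right_mono)
      also have "\<dots> \<le> 20 * \<rho>" using s by (simp add: sum_distrib_left[symmetric])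
      finally have "\<bar>\<Sum>k\<in>S. fail_deriv S r k * \<sigma> k\<bar> \<le> 20 * \<rho>" .
      moreover have "\<bar>fail_prob S (freq (mset w)) - fail_prob S r - (\<Sum>k\<in>S. fail_deriv S r k * \<sigma> k)\<bar> \<le> 104 * \<rho>\<^sup>2"
        using fail_prob_expansion[OF S(1) r0 r(2) s \<rho>(2)] unfolding eq .
      moreover have "\<rho>\<^sup>2 \<le> \<rho>" using \<rho> by (simp add: power2_eq_square mult_left_le)
      ultimately show ?thesis using \<rho>(3) by (simp add: gap_def field_simps abs_le_iff)
    qed
    have Tw: "weight ?p w \<ge> weight r w * exp (- real n * (KL + \<epsilon> / 2))" if w: "w \<in> T n" for w n
    proof -
      have ws: "set w \<subseteq> S" using w by (auto simp: T_def words_def)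
      then have eq: "weight ?p w = weight r w * exp (- sum_list (map h w))"
      proof (induction w)
        case (Cons v w)
        then have "exp (- h v) = ?p v / r v" using p[of v] r(1)[of v] by (simp add: h_def exp_minus)
        then show ?case using Cons r(1)[of v] by (simp add: exp_add field_simps exp_diff exp_minus)
      qed simp
      have sl: "sum_list (map h w) = real n * (\<Sum>v\<in>S. freq (mset w) v * h v)"
        using w by (intro sum_list_eq_freq S) (auto simp: T_def)
      have "(\<Sum>v\<in>S. (freq (mset w) v - r v) * h v) \<le> (\<Sum>v\<in>S. \<bar>freq (mset w) v - r v\<bar> * H)"
      proof (rule sum_mono)
        fix v assume "v \<in> S"
        then have "\<bar>freq (mset w) v - r v\<bar> * \<bar>h v\<bar> \<le> \<bar>freq (mset w) v - r v\<bar> * H" by (intro mult_left_mono H) auto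
        then show "(freq (mset w) v - r v) * h v \<le> \<bar>freq (mset w) v - r v\<bar> * H"
          by (simp only: abs_mult[symmetric] abs_le_iff)
      qed
      also have "\<dots> = (\<Sum>v\<in>S. \<bar>freq (mset w) v - r v\<bar>) * H" by (simp only: sum_distrib_right)
      also have "\<dots> \<le> \<rho> * H" using w H0 by (intro mult_right_mono) (auto simp: T_def)
      also have "\<dots> \<le> \<epsilon> / 2" by (rule \<rho>)
      finally have "(\<Sum>v\<in>S. freq (mset w) v * h v) \<le> KL + \<epsilon> / 2"
        by (simp add: KL_def left_diff_distrib sum_subtractf)
      then have "sum_list (map h w) \<le> real n * (KL + \<epsilon> / 2)" unfolding sl by (intro mult_left_mono) auto
      then show ?thesis unfolding eq using ws r0 by (intro mult_left_mono weight_nonneg) auto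
    qed
    have "\<forall>\<^sub>F n in sequentially. 2 ^ card S * exp (- real n * (\<rho>\<^sup>2 / 16)) < 1/2"
    proof (rule order_tendstoD)
      have "\<rho>\<^sup>2 > 0" using \<rho> by simp
      then show "(\<lambda>n. 2 ^ card S * exp (- real n * (\<rho>\<^sup>2 / 16))) \<longlonglongrightarrow> 0" by real_asymp
    qed simp
    moreover have "\<forall>\<^sub>F n in sequentially. exp (- real n * (\<epsilon> / 2)) < 1/2"
    proof (rule order_tendstoD)
      show "(\<lambda>n. exp (- real n * (\<epsilon> / 2))) \<longlonglongrightarrow> 0" using \<epsilon> by real_asymp
    qed simp
    moreover have "\<forall>\<^sub>F n in sequentially. 300 / real n < gap / 2"
    proof (rule order_tendstoD)
      show "(\<lambda>n. 300 / real n) \<longlonglongrightarrow> 0" by real_asymp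
    qed (use gap in simp)
    ultimately have "\<forall>\<^sub>F n in sequentially. exp (- real n * (KL + \<epsilon>)) \<le> P n a"
      using eventually_ge_at_top[of 6]
    proof eventually_elim
      case (elim n)
      have fin: "finite (words S n)" using S finite_words by blast
      let ?D = "{w \<in> words S n. \<rho> \<le> (\<Sum>v\<in>S. \<bar>freq (mset w) v - r v\<bar>)}"
      have "T n \<union> ?D = words S n" by (auto simp: T_def)
      moreover have "mass r (T n \<union> ?D) = mass r (T n) + mass r ?D"
        unfolding mass_def by (rule sum.union_disjoint) (use fin in \<open>auto simp: T_def\<close>)
      ultimately have "mass r (words S n) = mass r (T n) + mass r ?D" by (rule subst)
      moreover have "mass r ?D \<le> 1/2"
        using l1_deviation[OF S(1) r0 r(2), of \<rho> n] \<rho> elim by auto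
      ultimately have half: "mass r (T n) \<ge> 1/2" using mass_words[OF S(1), of r n] r(2) by simp
      have "exp (- real n * (KL + \<epsilon>)) = exp (- real n * (\<epsilon> / 2)) * exp (- real n * (KL + \<epsilon> / 2))"
        by (simp add: exp_add[symmetric] algebra_simps)
      also have "\<dots> \<le> mass r (T n) * exp (- real n * (KL + \<epsilon> / 2))"
        using half elim by (intro mult_right_mono) auto
      also have "\<dots> \<le> mass ?p (T n)" unfolding mass_def sum_distrib_right by (intro sum_mono Tw)
      also have "\<dots> \<le> mass ?p {w \<in> words S n. fail_prob S (freq (mset w)) < 1/2 - a - 300 / real n}"
      proof (rule mass_mono[OF S(1)])
        show "T n \<subseteq> {w \<in> words S n. fail_prob S (freq (mset w)) < 1/2 - a - 300 / real n}"
        proof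
          fix w assume "w \<in> T n"
          then show "w \<in> {w \<in> words S n. fail_prob S (freq (mset w)) < 1/2 - a - 300 / real n}"
            using T\<Phi>[of w n] elim(3) by (simp add: T_def)
        qed
      qed (use p in \<open>auto intro: less_imp_le\<close>)
      also have "\<dots> \<le> P n a" by (rule sandwichedD(6)[OF P d elim(4) S])
      finally show ?case .
    qed
    then show ?thesis by (rule rate_le_of_tail[OF P a])
  qed
  then show ?thesis unfolding KL_def h_def by (rule field_le_epsilon)
qed

lemma centered_deriv:
  assumes "finite S" "\<And>v. v \<in> S \<Longrightarrow> q v \<ge> 0" "sum q S = 1"
  defines "g \<equiv> \<lambda>v. 5 * fail_prob S q - fail_deriv S q v"
  shows "(\<Sum>v\<in>S. q v * g v) = 0" "\<bar>g v\<bar> \<le> 20" "(\<Sum>v\<in>S. fail_deriv S q v * (q v * g v)) = - (\<Sum>v\<in>S. q v * (g v)\<^sup>2)"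
proof -
  note D = fail_deriv_bounds[OF assms(1-3)]
  have eu: "(\<Sum>v\<in>S. fail_deriv S q v * q v) = 5 * fail_prob S q" by (rule fail_deriv_euler[OF assms(1)])
  have "(\<Sum>v\<in>S. q v * g v) = sum q S * (5 * fail_prob S q) - (\<Sum>v\<in>S. fail_deriv S q v * q v)"
    by (simp only: g_def right_diff_distrib sum_subtractf sum_distrib_right mult.commute[of "fail_deriv S q _"])
  then show 0: "(\<Sum>v\<in>S. q v * g v) = 0" using eu assms(3) by simp
  have nn: "0 \<le> fail_prob S q" using assms(2) by (rule fail_prob_nonneg)
  have "(\<Sum>v\<in>S. fail_deriv S q v * q v) \<le> (\<Sum>v\<in>S. 20 * q v)" using D assms(2) by (intro sum_mono mult_right_mono) auto
  then have "5 * fail_prob S q \<le> 20" using eu assms(3) by (simp add: sum_distrib_left[symmetric])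
  then show "\<bar>g v\<bar> \<le> 20" using D[of v] nn by (simp add: g_def abs_le_iff)
  have "(\<Sum>v\<in>S. fail_deriv S q v * (q v * g v)) = (\<Sum>v\<in>S. 5 * fail_prob S q * (q v * g v) - q v * (g v)\<^sup>2)"
    by (intro sum.cong refl) (simp add: g_def power2_eq_square algebra_simps)
  also have "\<dots> = 5 * fail_prob S q * (\<Sum>v\<in>S. q v * g v) - (\<Sum>v\<in>S. q v * (g v)\<^sup>2)"
    by (simp only: sum_subtractf sum_distrib_left)
  finally show "(\<Sum>v\<in>S. fail_deriv S q v * (q v * g v)) = - (\<Sum>v\<in>S. q v * (g v)\<^sup>2)" using 0 by simp
qed

text \<open>The variance under \<open>q\<close> of the derivative of \<open>fail_prob\<close>, whose mean is \<open>5 * fail_prob S q\<close> by Euler's identity.\<close>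

definition fail_var :: "nat set \<Rightarrow> (nat \<Rightarrow> real) \<Rightarrow> real" where
  "fail_var S q = (\<Sum>v\<in>S. q v * (5 * fail_prob S q - fail_deriv S q v)\<^sup>2)"

text \<open>Outside an event of exponent \<open>4 a\<^sup>2\<close> the empirical law is within \<open>8 a\<close> of \<open>p\<close>, where the expansion of
  \<open>fail_prob\<close> has error \<open>104 * (8 a)\<^sup>2 = 6656 a\<^sup>2\<close>. There the event is a deviation of a sum of independent terms.\<close>

lemma rate_lower_bound:
  fixes K :: nat
  assumes P: "sandwiched P" and a: "0 < a" "8 * a \<le> 1" and d: "d > 0" and \<theta>: "\<theta> \<ge> 0"
  defines "S \<equiv> alphabet K" and "p \<equiv> upper_weight d K"
  shows "min (4 * a\<^sup>2) (\<theta> * (a - 6656 * a\<^sup>2 - (1/2 - fail_prob S p)) - \<theta>\<^sup>2 * fail_var S p / 2 * exp (20 * \<theta>)) \<le> rate P a"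
proof -
  define E where "E = \<theta> * (a - 6656 * a\<^sup>2 - (1/2 - fail_prob S p)) - \<theta>\<^sup>2 * fail_var S p / 2 * exp (20 * \<theta>)"
  have S: "finite S" using alphabet by (simp add: S_def)
  have p: "p v \<ge> 0" for v using upper_weight_pos[OF d, of K v] by (simp add: p_def)
  have p1: "sum p S = 1" by (simp add: p_def S_def upper_weight_sum)
  let ?g = "\<lambda>v. 5 * fail_prob S p - fail_deriv S p v"
  note g = centered_deriv[OF S p p1]
  have "min (4 * a\<^sup>2) E - \<epsilon> \<le> rate P a" if \<epsilon>: "\<epsilon> > 0" for \<epsilon>
  proof (rule rate_ge_of_tail[OF P])
    show "a < 1/2" using a by simp
    have "\<forall>\<^sub>F n in sequentially. 2 ^ card S * exp (- real n * \<epsilon>) < 1/2"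
    proof (rule order_tendstoD)
      show "(\<lambda>n. 2 ^ card S * exp (- real n * \<epsilon>)) \<longlonglongrightarrow> 0" using \<epsilon> by real_asymp
    qed simp
    moreover have "\<forall>\<^sub>F n in sequentially. exp (300 * \<theta>) * exp (- real n * \<epsilon>) < 1/2"
    proof (rule order_tendstoD)
      show "(\<lambda>n. exp (300 * \<theta>) * exp (- real n * \<epsilon>)) \<longlonglongrightarrow> 0" using \<epsilon> by real_asymp
    qed simp
    ultimately show "\<forall>\<^sub>F n in sequentially. P n a \<le> exp (- real n * (min (4 * a\<^sup>2) E - \<epsilon>))"
      using eventually_ge_at_top[of 6]
    proof eventually_elim
      case (elim n)
      let ?A = "{w \<in> words S n. fail_prob S (freq (mset w)) \<le> 1/2 - a + 300 / real n}"
      let ?B = "{w \<in> words S n. 8 * a \<le> (\<Sum>v\<in>S. \<bar>freq (mset w) v - p v\<bar>)}"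
      define b where "b = a - 6656 * a\<^sup>2 - (1/2 - fail_prob S p) - 300 / real n"
      have fin: "finite (words S n)" using S finite_words by blast
      have lin: "mass p (?A - ?B) \<le> exp (- real n * (\<theta> * b - \<theta>\<^sup>2 * fail_var S p / 2 * exp (\<theta> * 20)))"
      proof (rule chernoff_variance[OF S p p1 g(1) g(2) _ \<theta>])
        show "(\<Sum>v\<in>S. p v * (?g v)\<^sup>2) \<le> fail_var S p" by (simp add: fail_var_def)
        show "?A - ?B \<subseteq> words S n" by auto
        fix w assume w: "w \<in> ?A - ?B"
        define \<sigma> where "\<sigma> v = freq (mset w) v - p v" for v
        have eq: "(\<lambda>v. p v + \<sigma> v) = freq (mset w)" by (auto simp: \<sigma>_def)
        have s: "(\<Sum>v\<in>S. \<bar>\<sigma> v\<bar>) \<le> 8 * a" using w by (auto simp: \<sigma>_def)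
        have "\<bar>fail_prob S (freq (mset w)) - fail_prob S p - (\<Sum>k\<in>S. fail_deriv S p k * \<sigma> k)\<bar> \<le> 104 * (8 * a)\<^sup>2"
          using fail_prob_expansion[OF S p p1 s a(2)] unfolding eq .
        then have "(\<Sum>k\<in>S. fail_deriv S p k * \<sigma> k) \<le> 1/2 - a + 300 / real n - fail_prob S p + 6656 * a\<^sup>2"
          using w by (simp add: power_mult_distrib abs_le_iff)
        moreover have "(\<Sum>v\<in>S. freq (mset w) v * ?g v) = - (\<Sum>k\<in>S. fail_deriv S p k * \<sigma> k)"
        proof -
          have "sum (freq (mset w)) S = 1" using w elim(3) by (intro sum_freq S) (auto simp: words_def)
          then have "sum \<sigma> S = 0" using p1 by (simp add: \<sigma>_def sum_subtractf)
          have "(\<Sum>v\<in>S. freq (mset w) v * ?g v) = (\<Sum>v\<in>S. p v * ?g v + (5 * fail_prob S p * \<sigma> v - fail_deriv S p v * \<sigma> v))"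
            by (intro sum.cong refl) (simp add: \<sigma>_def algebra_simps)
          also have "\<dots> = (\<Sum>v\<in>S. p v * ?g v) + (5 * fail_prob S p * sum \<sigma> S - (\<Sum>k\<in>S. fail_deriv S p k * \<sigma> k))"
            by (simp only: sum.distrib sum_subtractf sum_distrib_left)
          finally show ?thesis using g(1) \<open>sum \<sigma> S = 0\<close> by simp
        qed
        ultimately show "b \<le> (\<Sum>v\<in>S. freq (mset w) v * ?g v)" by (simp add: b_def)
      qed
      have "P n a \<le> mass p ?A" using sandwichedD(5)[OF P d elim(3), of a K] by (simp add: p_def S_def)
      also have "\<dots> \<le> mass p ((?A - ?B) \<union> ?B)" by (rule mass_mono[OF S _ _ p]) auto
      also have "\<dots> = mass p (?A - ?B) + mass p ?B" unfolding mass_def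
        by (rule sum.union_disjoint) (use fin in auto)
      also have "\<dots> \<le> exp (- real n * (\<theta> * b - \<theta>\<^sup>2 * fail_var S p / 2 * exp (\<theta> * 20))) + 2 ^ card S * exp (- real n * ((8 * a)\<^sup>2 / 16))"
        using lin l1_deviation[OF S p p1, of "8 * a" n] a elim by (intro add_mono) auto
      also have "exp (- real n * (\<theta> * b - \<theta>\<^sup>2 * fail_var S p / 2 * exp (\<theta> * 20))) = exp (300 * \<theta>) * exp (- real n * \<epsilon>) * exp (- real n * (E - \<epsilon>))"
        using elim(3) by (simp add: E_def b_def exp_add[symmetric] algebra_simps)
      also have "\<dots> \<le> 1/2 * exp (- real n * (min (4 * a\<^sup>2) E - \<epsilon>))"
      proof (rule mult_mono)
        show "exp (- real n * (E - \<epsilon>)) \<le> exp (- real n * (min (4 * a\<^sup>2) E - \<epsilon>))"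
          unfolding exp_le_cancel_iff by (rule mult_left_mono_neg) auto
      qed (use elim(2) in auto)
      also have "2 ^ card S * exp (- real n * ((8 * a)\<^sup>2 / 16)) = 2 ^ card S * exp (- real n * \<epsilon>) * exp (- real n * (4 * a\<^sup>2 - \<epsilon>))"
        by (simp add: mult.assoc exp_add[symmetric] power_mult_distrib algebra_simps)
      also have "\<dots> \<le> 1/2 * exp (- real n * (min (4 * a\<^sup>2) E - \<epsilon>))"
      proof (rule mult_mono)
        show "exp (- real n * (4 * a\<^sup>2 - \<epsilon>)) \<le> exp (- real n * (min (4 * a\<^sup>2) E - \<epsilon>))"
          unfolding exp_le_cancel_iff by (rule mult_left_mono_neg) auto
      qed (use elim(1) in auto)
      finally show ?case by simp
    qed
  qed
  then have "min (4 * a\<^sup>2) E \<le> rate P a + \<epsilon>" if "\<epsilon> > 0" for \<epsilon> using that by (simp add: diff_le_eq)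
  then show ?thesis unfolding E_def by (rule field_le_epsilon)
qed

text \<open>The cubic remainder suffices, since the tilting parameter tends to 0.\<close>

lemma one_plus_log_bound:
  fixes x :: real assumes "\<bar>x\<bar> \<le> 1/2" shows "(1 + x) * ln (1 + x) \<le> x + x\<^sup>2 / 2 + 2 * \<bar>x\<bar> ^ 3"
proof -
  have "ln (1 + x) \<le> x - x\<^sup>2 / 2 + 2 / 3 * \<bar>x\<bar> ^ 3"
  proof (cases "x \<ge> 0")
    case True
    have "ln (1 + x) \<le> x - x\<^sup>2 / 2 + 2 / 3 * x ^ 3"
    proof -
      define f where "f y = y - y\<^sup>2 / 2 + 2 / 3 * y ^ 3 - ln (1 + y)" for y :: real
      have "f 0 \<le> f x"
      proof (rule DERIV_nonneg_imp_nondecreasing[where f = f and a = 0 and b = x, OF True])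
        fix y :: real assume y: "0 \<le> y" "y \<le> x"
        have "(f has_real_derivative (1 - y + 2 * y\<^sup>2 - 1 / (1 + y))) (at y)"
          unfolding f_def using y by (auto intro!: derivative_eq_intros simp: power2_eq_square)
        moreover have "1 - y + 2 * y\<^sup>2 - 1 / (1 + y) = (y\<^sup>2 + 2 * y ^ 3) / (1 + y)"
          using y by (simp add: field_simps power2_eq_square power3_eq_cube)
        then have "0 \<le> 1 - y + 2 * y\<^sup>2 - 1 / (1 + y)" using y by simp
        ultimately show "\<exists>z. (f has_real_derivative z) (at y) \<and> 0 \<le> z" by blast
      qed
      then show ?thesis by (simp add: f_def)
    qed
    then show ?thesis using True by simp
  next
    case False
    have "ln (1 + x) \<le> x - x\<^sup>2 / 2 - 2 / 3 * x ^ 3"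
    proof -
      define f where "f y = y - y\<^sup>2 / 2 - 2 / 3 * y ^ 3 - ln (1 + y)" for y :: real
      have "f 0 \<le> f x"
      proof (rule DERIV_nonpos_imp_nonincreasing[where f = f and a = x and b = 0])
        show "x \<le> 0" using False by simp
        fix y :: real assume y: "x \<le> y" "y \<le> 0"
        have y1: "1 + y > 0" using y assms by linarith
        have "(f has_real_derivative (1 - y - 2 * y\<^sup>2 - 1 / (1 + y))) (at y)"
          unfolding f_def using y1 by (auto intro!: derivative_eq_intros simp: power2_eq_square)
        moreover have "1 - y - 2 * y\<^sup>2 - 1 / (1 + y) = - (y\<^sup>2 * (3 + 2 * y)) / (1 + y)"
          using y1 by (simp add: field_simps power2_eq_square)
        moreover have "- (y\<^sup>2 * (3 + 2 * y)) / (1 + y) \<le> 0"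
          using y1 y assms by (intro divide_nonpos_pos) auto
        ultimately show "\<exists>z. (f has_real_derivative z) (at y) \<and> z \<le> 0" by metis
      qed
      then show ?thesis by (simp add: f_def)
    qed
    moreover have "\<bar>x\<bar> ^ 3 = - (x ^ 3)" using False by (simp add: power3_eq_cube)
    ultimately show ?thesis by simp
  qed
  then have "(1 + x) * ln (1 + x) \<le> (1 + x) * (x - x\<^sup>2 / 2 + 2 / 3 * \<bar>x\<bar> ^ 3)"
    using assms by (intro mult_left_mono) auto
  also have "\<dots> \<le> x + x\<^sup>2 / 2 + 2 * \<bar>x\<bar> ^ 3"
  proof (cases "x \<ge> 0")
    case True
    have "(1 + x) * (x - x\<^sup>2 / 2 + 2 / 3 * x ^ 3) = x + x\<^sup>2 / 2 + x ^ 3 * (1/6 + 2/3 * x)"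
      by (simp add: field_simps power2_eq_square power3_eq_cube)
    also have "\<dots> \<le> x + x\<^sup>2 / 2 + x ^ 3 * 2" using True assms by (intro add_left_mono mult_left_mono) auto
    finally show ?thesis using True by simp
  next
    case False
    define y where "y = - x"
    have y: "0 \<le> y" "y \<le> 1/2" using False assms by (auto simp: y_def)
    have "(1 - y) * (- y - y\<^sup>2 / 2 + 2 / 3 * y ^ 3) = - y + y\<^sup>2 / 2 + y ^ 3 * (7/6 - 2/3 * y)"
      by (simp add: field_simps power2_eq_square power3_eq_cube)
    also have "\<dots> \<le> - y + y\<^sup>2 / 2 + y ^ 3 * 2" using y by (intro add_left_mono mult_left_mono) auto
    finally show ?thesis using y by (simp add: y_def)
  qed
  finally show ?thesis .
qed

text \<open>The tilted law \<open>r = p (1 + \<theta> g)\<close> moves \<open>fail_prob\<close> by \<open>- \<theta> fail_var\<close> up to \<open>104 * (20 \<theta>)\<^sup>2\<close>, and its relative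
  entropy is \<open>\<theta>\<^sup>2 fail_var / 2\<close> up to third order. The last two summands are the price of passing from
  \<open>upper_weight\<close> to \<open>lower_weight\<close>.\<close>

lemma rate_upper_bound:
  fixes K :: nat
  assumes P: "sandwiched P" and a: "a < 1/2" and d: "d > 0" and \<theta>: "0 \<le> \<theta>" "\<theta> \<le> 1/40"
  defines "S \<equiv> alphabet K" and "p \<equiv> upper_weight d K"
  assumes gap: "fail_prob S p - \<theta> * fail_var S p + 41600 * \<theta>\<^sup>2 < 1/2 - a"
  shows "rate P a \<le> \<theta>\<^sup>2 * fail_var S p / 2 + 16000 * \<theta> ^ 3 + 2 * d + 2 * exp (- d * real K) * (- ln (1 - exp (- d)))"
proof -
  have S: "finite S" "S \<subseteq> {1..}" "K + 2 \<in> S" using alphabet by (auto simp: S_def)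
  have p: "p v > 0" for v using upper_weight_pos[OF d, of K v] by (simp add: p_def)
  then have p0: "p v \<ge> 0" for v by (simp add: less_imp_le)
  have p1: "sum p S = 1" by (simp add: p_def S_def upper_weight_sum)
  define g where "g v = 5 * fail_prob S p - fail_deriv S p v" for v
  note g = centered_deriv[OF S(1) p0 p1, folded g_def]
  have V: "(\<Sum>v\<in>S. p v * (g v)\<^sup>2) = fail_var S p" by (simp add: fail_var_def g_def)
  define r where "r v = p v * (1 + \<theta> * g v)" for v
  have tg: "\<bar>\<theta> * g v\<bar> \<le> 20 * \<theta>" "\<bar>\<theta> * g v\<bar> \<le> 1/2" for v
  proof -
    show "\<bar>\<theta> * g v\<bar> \<le> 20 * \<theta>" using mult_left_mono[OF g(2)[of v] \<theta>(1)] \<theta>(1) by (simp add: abs_mult mult.commute)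
    then show "\<bar>\<theta> * g v\<bar> \<le> 1/2" using \<theta> by linarith
  qed
  have tg': "1 + \<theta> * g v > 0" "1 + \<theta> * g v \<le> 2" for v using tg(2)[of v] by (auto simp: abs_le_iff)
  have r: "r v > 0" for v unfolding r_def using p tg' by simp
  have r1: "sum r S = 1"
  proof -
    have "sum r S = (\<Sum>v\<in>S. p v + \<theta> * (p v * g v))" by (intro sum.cong) (auto simp: r_def algebra_simps)
    also have "\<dots> = sum p S + \<theta> * (\<Sum>v\<in>S. p v * g v)" by (simp only: sum.distrib sum_distrib_left)
    finally show ?thesis using g(1) p1 by simp
  qed
  have "fail_prob S r < 1/2 - a"
  proof -
    define \<sigma> where "\<sigma> v = \<theta> * (p v * g v)" for v
    have eq: "(\<lambda>v. p v + \<sigma> v) = r" by (auto simp: \<sigma>_def r_def algebra_simps)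
    have "(\<Sum>v\<in>S. \<bar>\<sigma> v\<bar>) \<le> (\<Sum>v\<in>S. p v * (20 * \<theta>))"
    proof (rule sum_mono)
      fix v
      have "\<bar>\<sigma> v\<bar> = p v * \<bar>\<theta> * g v\<bar>" using p0[of v] by (simp add: \<sigma>_def abs_mult mult_ac)
      then show "\<bar>\<sigma> v\<bar> \<le> p v * (20 * \<theta>)" using tg(1)[of v] p0[of v] by (simp add: mult_left_mono)
    qed
    also have "\<dots> = 20 * \<theta>" using p1 by (simp add: sum_distrib_right[symmetric])
    finally have s: "(\<Sum>v\<in>S. \<bar>\<sigma> v\<bar>) \<le> 20 * \<theta>" .
    have "(\<Sum>k\<in>S. fail_deriv S p k * \<sigma> k) = \<theta> * (\<Sum>k\<in>S. fail_deriv S p k * (p k * g k))"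
      by (simp add: \<sigma>_def sum_distrib_left mult_ac)
    also have "\<dots> = - \<theta> * fail_var S p" using g(3) V by simp
    finally have "\<bar>fail_prob S r - fail_prob S p + \<theta> * fail_var S p\<bar> \<le> 104 * (20 * \<theta>)\<^sup>2"
      using fail_prob_expansion[OF S(1) p0 p1 s] \<theta>(2) unfolding eq by simp
    then show ?thesis using gap by (simp add: power_mult_distrib abs_le_iff)
  qed
  from rate_le_relative_entropy[OF P a d S(1,2) r r1 this]
  have "rate P a \<le> (\<Sum>v\<in>S. r v * ln (r v / lower_weight d v))" .
  also have "\<dots> \<le> (\<Sum>v\<in>S. \<theta> * (p v * g v) + \<theta>\<^sup>2 / 2 * (p v * (g v)\<^sup>2) + 16000 * \<theta> ^ 3 * p v + 2 * d * r v
       + (if v = K + 2 then r v * (- ln (1 - exp (- d))) else 0))"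
  proof (rule sum_mono)
    fix v
    have e1: "0 < 1 - exp (- d)" using d by simp
    have l1: "ln (p v / lower_weight d v) = 2 * d + (if v = K + 2 then - ln (1 - exp (- d)) else 0)"
      using e1 p[of v] unfolding lower_weight_eq[of d v K] p_def[symmetric]
      by (auto simp: ln_div ln_mult)
    have l2: "ln (r v / lower_weight d v) = ln (1 + \<theta> * g v) + ln (p v / lower_weight d v)"
      using p[of v] tg'(1)[of v] lower_weight_pos[OF d, of v] by (simp add: r_def ln_mult ln_div)
    have l3: "r v * ln (1 + \<theta> * g v) \<le> \<theta> * (p v * g v) + \<theta>\<^sup>2 / 2 * (p v * (g v)\<^sup>2) + 16000 * \<theta> ^ 3 * p v"
    proof -
      have "(1 + \<theta> * g v) * ln (1 + \<theta> * g v) \<le> \<theta> * g v + (\<theta> * g v)\<^sup>2 / 2 + 2 * \<bar>\<theta> * g v\<bar> ^ 3"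
        by (rule one_plus_log_bound[OF tg(2)])
      also have "\<dots> \<le> \<theta> * g v + (\<theta> * g v)\<^sup>2 / 2 + 2 * (20 * \<theta>) ^ 3"
        using tg(1)[of v] by (intro add_left_mono mult_left_mono power_mono) auto
      also have "\<dots> = \<theta> * g v + \<theta>\<^sup>2 / 2 * (g v)\<^sup>2 + 16000 * \<theta> ^ 3" by (simp add: power_mult_distrib)
      finally have le: "p v * ((1 + \<theta> * g v) * ln (1 + \<theta> * g v)) \<le> p v * (\<theta> * g v + \<theta>\<^sup>2 / 2 * (g v)\<^sup>2 + 16000 * \<theta> ^ 3)"
        using p0[of v] by (rule mult_left_mono)
      have eq1: "r v * ln (1 + \<theta> * g v) = p v * ((1 + \<theta> * g v) * ln (1 + \<theta> * g v))" by (simp only: r_def mult.assoc)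
      have eq2: "p v * (\<theta> * g v + \<theta>\<^sup>2 / 2 * (g v)\<^sup>2 + 16000 * \<theta> ^ 3)
          = \<theta> * (p v * g v) + \<theta>\<^sup>2 / 2 * (p v * (g v)\<^sup>2) + 16000 * \<theta> ^ 3 * p v" by (simp add: algebra_simps)
      show ?thesis unfolding eq1 eq2[symmetric] by (rule le)
    qed
    have l4: "r v * (x + (2 * d + (if v = K + 2 then l else 0))) = r v * x + 2 * d * r v + (if v = K + 2 then r v * l else 0)" for x l
      by (simp add: algebra_simps)
    show "r v * ln (r v / lower_weight d v) \<le> \<theta> * (p v * g v) + \<theta>\<^sup>2 / 2 * (p v * (g v)\<^sup>2) + 16000 * \<theta> ^ 3 * p v
       + 2 * d * r v + (if v = K + 2 then r v * (- ln (1 - exp (- d))) else 0)"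
      unfolding l2 l1 l4 by (intro add_right_mono l3)
  qed
  also have "\<dots> = \<theta> * (\<Sum>v\<in>S. p v * g v) + \<theta>\<^sup>2 / 2 * (\<Sum>v\<in>S. p v * (g v)\<^sup>2) + 16000 * \<theta> ^ 3 * sum p S + 2 * d * sum r S
      + r (K + 2) * (- ln (1 - exp (- d)))"
    using S(1,3) by (simp add: sum.distrib sum_distrib_left)
  also have "\<dots> = \<theta>\<^sup>2 * fail_var S p / 2 + 16000 * \<theta> ^ 3 + 2 * d + r (K + 2) * (- ln (1 - exp (- d)))"
    using g(1) V p1 r1 by simp
  finally have main: "rate P a \<le> \<theta>\<^sup>2 * fail_var S p / 2 + 16000 * \<theta> ^ 3 + 2 * d + r (K + 2) * (- ln (1 - exp (- d)))" .
  have "r (K + 2) * (- ln (1 - exp (- d))) \<le> 2 * exp (- d * real K) * (- ln (1 - exp (- d)))"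
  proof (rule mult_right_mono)
    have "r (K + 2) \<le> p (K + 2) * 2" unfolding r_def using p0 tg' by (intro mult_left_mono) auto
    then show "r (K + 2) \<le> 2 * exp (- d * real K)" by (simp add: p_def upper_weight_def)
    show "0 \<le> - ln (1 - exp (- d))" using d by simp
  qed
  with main show ?thesis by linarith
qed

text \<open>Both bounds hold on every grid, so one may pass to the limit of the grids first and to \<open>a \<rightarrow> 0\<close> afterwards. The
  assumption \<open>8 V > 1\<close> says that the exponent \<open>4 a\<^sup>2\<close> of the excluded event exceeds \<open>a\<^sup>2/(2 V)\<close>.\<close>

lemma rate_quadratic:
  fixes K :: "nat \<Rightarrow> nat"
  assumes P: "sandwiched P" and d: "\<And>m. d m > 0"
    and err: "(\<lambda>m. 2 * d m + 2 * exp (- d m * real (K m)) * (- ln (1 - exp (- d m)))) \<longlonglongrightarrow> 0"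
    and \<Phi>: "(\<lambda>m. fail_prob (alphabet (K m)) (upper_weight (d m) (K m))) \<longlonglongrightarrow> 1/2"
    and V: "(\<lambda>m. fail_var (alphabet (K m)) (upper_weight (d m) (K m))) \<longlonglongrightarrow> V" "8 * V > 1"
  shows "((\<lambda>a. rate P a / (a\<^sup>2 / (2 * V))) \<longlongrightarrow> 1) (at_right 0)"
proof -
  let ?\<Phi> = "\<lambda>m. fail_prob (alphabet (K m)) (upper_weight (d m) (K m))"
  let ?V = "\<lambda>m. fail_var (alphabet (K m)) (upper_weight (d m) (K m))"
  have V0: "V > 0" using V(2) by simp
  have lower: "min (4 * a\<^sup>2) (\<theta> * (a - 6656 * a\<^sup>2) - \<theta>\<^sup>2 * V / 2 * exp (20 * \<theta>)) \<le> rate P a"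
    if a: "0 < a" "8 * a \<le> 1" and \<theta>: "\<theta> \<ge> 0" for a \<theta>
  proof (rule tendsto_upperbound)
    have "(\<lambda>m. min (4 * a\<^sup>2) (\<theta> * (a - 6656 * a\<^sup>2 - (1/2 - ?\<Phi> m)) - \<theta>\<^sup>2 * ?V m / 2 * exp (20 * \<theta>)))
       \<longlonglongrightarrow> min (4 * a\<^sup>2) (\<theta> * (a - 6656 * a\<^sup>2 - (1/2 - 1/2)) - \<theta>\<^sup>2 * V / 2 * exp (20 * \<theta>))"
      by (intro tendsto_intros \<Phi> V(1)) auto
    then show "(\<lambda>m. min (4 * a\<^sup>2) (\<theta> * (a - 6656 * a\<^sup>2 - (1/2 - ?\<Phi> m)) - \<theta>\<^sup>2 * ?V m / 2 * exp (20 * \<theta>)))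
       \<longlonglongrightarrow> min (4 * a\<^sup>2) (\<theta> * (a - 6656 * a\<^sup>2) - \<theta>\<^sup>2 * V / 2 * exp (20 * \<theta>))" by simp
    show "\<forall>\<^sub>F m in sequentially. min (4 * a\<^sup>2) (\<theta> * (a - 6656 * a\<^sup>2 - (1/2 - ?\<Phi> m)) - \<theta>\<^sup>2 * ?V m / 2 * exp (20 * \<theta>)) \<le> rate P a"
      using rate_lower_bound[OF P a d \<theta>] by (intro always_eventually allI)
  qed simp
  have upper: "rate P a \<le> \<theta>\<^sup>2 * V / 2 + 16000 * \<theta> ^ 3"
    if a: "a < 1/2" and \<theta>: "0 \<le> \<theta>" "\<theta> \<le> 1/40" and gap: "a < \<theta> * V - 41600 * \<theta>\<^sup>2" for a \<theta>
  proof (rule tendsto_lowerbound)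
    have "(\<lambda>m. \<theta>\<^sup>2 * ?V m / 2 + 16000 * \<theta> ^ 3 + (2 * d m + 2 * exp (- d m * real (K m)) * (- ln (1 - exp (- d m)))))
      \<longlonglongrightarrow> \<theta>\<^sup>2 * V / 2 + 16000 * \<theta> ^ 3 + 0"
      by (intro tendsto_intros V(1) err) auto
    then show "(\<lambda>m. \<theta>\<^sup>2 * ?V m / 2 + 16000 * \<theta> ^ 3 + (2 * d m + 2 * exp (- d m * real (K m)) * (- ln (1 - exp (- d m)))))
      \<longlonglongrightarrow> \<theta>\<^sup>2 * V / 2 + 16000 * \<theta> ^ 3" by simp
    have "(\<lambda>m. ?\<Phi> m - \<theta> * ?V m + 41600 * \<theta>\<^sup>2) \<longlonglongrightarrow> 1/2 - \<theta> * V + 41600 * \<theta>\<^sup>2"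
      by (intro tendsto_intros V(1) \<Phi>)
    then have "\<forall>\<^sub>F m in sequentially. ?\<Phi> m - \<theta> * ?V m + 41600 * \<theta>\<^sup>2 < 1/2 - a"
      by (rule order_tendstoD) (use gap in simp)
    then show "\<forall>\<^sub>F m in sequentially. rate P a \<le> \<theta>\<^sup>2 * ?V m / 2 + 16000 * \<theta> ^ 3 + (2 * d m + 2 * exp (- d m * real (K m)) * (- ln (1 - exp (- d m))))"
    proof eventually_elim
      case (elim m)
      show ?case using rate_upper_bound[OF P a d \<theta> elim] by linarith
    qed
  qed simp
  \<comment> \<open>The slope \<open>c\<close> compensates the quadratic error \<open>41600 \<theta>\<^sup>2\<close> at \<open>\<theta> = a / V * (1 + c a)\<close>, as \<open>(1 + c a)\<^sup>2 < 4\<close>.\<close>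
  define c where "c = 4 * 41600 / V\<^sup>2"
  have c: "c > 0" using V0 by (simp add: c_def)
  show ?thesis
  proof (rule tendsto_sandwich)
    \<comment> \<open>The lower bound is used at the optimal parameter \<open>\<theta> = a / V\<close> of the Gaussian approximation.\<close>
    show "\<forall>\<^sub>F a in at_right 0. min (8 * V) (2 - 13312 * a - exp (20 * (a / V))) \<le> rate P a / (a\<^sup>2 / (2 * V))"
      unfolding eventually_at_right_field
    proof (intro exI[of _ "1/8"] conjI allI impI)
      fix a :: real assume a: "0 < a" "a < 1/8"
      have "a\<^sup>2 / (2 * V) * min (8 * V) (2 - 13312 * a - exp (20 * (a / V)))
          = min (a\<^sup>2 / (2 * V) * (8 * V)) (a\<^sup>2 / (2 * V) * (2 - 13312 * a - exp (20 * (a / V))))"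
        using V0 by (simp add: min_mult_distrib_left)
      also have "a\<^sup>2 / (2 * V) * (8 * V) = 4 * a\<^sup>2" using V0 by simp
      also have "a\<^sup>2 / (2 * V) * (2 - 13312 * a - exp (20 * (a / V))) = (a / V) * (a - 6656 * a\<^sup>2) - (a / V)\<^sup>2 * V / 2 * exp (20 * (a / V))"
        using V0 by (simp add: power2_eq_square field_simps)
      also have "min (4 * a\<^sup>2) \<dots> \<le> rate P a" using a V0 by (intro lower) auto
      finally have "a\<^sup>2 / (2 * V) * min (8 * V) (2 - 13312 * a - exp (20 * (a / V))) \<le> rate P a" .
      moreover have "a\<^sup>2 / (2 * V) > 0" using a V0 by simp
      ultimately show "min (8 * V) (2 - 13312 * a - exp (20 * (a / V))) \<le> rate P a / (a\<^sup>2 / (2 * V))"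
        by (simp only: pos_le_divide_eq mult.commute)
    qed simp
    have "((\<lambda>a. min (8 * V) (2 - 13312 * a - exp (20 * (a / V)))) \<longlongrightarrow> min (8 * V) (2 - 13312 * 0 - exp (20 * (0 / V)))) (at_right 0)"
      using V0 by (intro tendsto_intros) auto
    then show "((\<lambda>a. min (8 * V) (2 - 13312 * a - exp (20 * (a / V)))) \<longlongrightarrow> 1) (at_right 0)" using V(2) by simp
    define b where "b = min (1/4) (min (1 / (2 * c)) (V / 60))"
    have b: "b > 0" using c V0 by (simp add: b_def)
    show "\<forall>\<^sub>F a in at_right 0. rate P a / (a\<^sup>2 / (2 * V)) \<le> (1 + c * a)\<^sup>2 + 32000 * a / V\<^sup>2 * (1 + c * a) ^ 3"
      unfolding eventually_at_right_field
    proof (intro exI[of _ b] conjI allI impI b)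
      fix a assume a: "0 < a" "a < b"
      define \<theta> where "\<theta> = a / V * (1 + c * a)"
      have "a * c < 1 / (2 * c) * c" using a c by (intro mult_strict_right_mono) (auto simp: b_def)
      then have ca: "0 < c * a" "c * a < 1/2" using a c by (auto simp: mult.commute)
      have \<theta>0: "0 \<le> \<theta>" unfolding \<theta>_def using a V0 ca by (intro mult_nonneg_nonneg) auto
      have \<theta>1: "\<theta> \<le> 1/40"
      proof -
        have "\<theta> \<le> (V / 60 / V) * (3 / 2)" unfolding \<theta>_def using a V0 ca by (intro mult_mono divide_right_mono) (auto simp: b_def)
        then show ?thesis using V0 by simp
      qed
      have gap: "a < \<theta> * V - 41600 * \<theta>\<^sup>2"
      proof -
        have "(1 + c * a)\<^sup>2 < 2\<^sup>2" using ca by (intro power_strict_mono) auto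
        then have "41600 * a\<^sup>2 / V\<^sup>2 * (1 + c * a)\<^sup>2 < 41600 * a\<^sup>2 / V\<^sup>2 * 4" using a V0 by (intro mult_strict_left_mono) auto
        moreover have "41600 * a\<^sup>2 / V\<^sup>2 * 4 = c * a\<^sup>2" by (simp add: c_def)
        moreover have "41600 * \<theta>\<^sup>2 = 41600 * a\<^sup>2 / V\<^sup>2 * (1 + c * a)\<^sup>2" by (simp add: \<theta>_def power_mult_distrib power_divide)
        moreover have "\<theta> * V = a + c * a\<^sup>2" using V0 by (simp add: \<theta>_def power2_eq_square algebra_simps)
        ultimately show ?thesis by linarith
      qed
      have "rate P a \<le> \<theta>\<^sup>2 * V / 2 + 16000 * \<theta> ^ 3"
        using a by (intro upper \<theta>0 \<theta>1 gap) (auto simp: b_def)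
      also have "\<dots> = ((1 + c * a)\<^sup>2 + 32000 * a / V\<^sup>2 * (1 + c * a) ^ 3) * (a\<^sup>2 / (2 * V))"
      proof -
        define u where "u = 1 + c * a"
        show ?thesis unfolding \<theta>_def u_def[symmetric]
          using V0 by (simp add: field_simps power2_eq_square power3_eq_cube)
      qed
      finally have "rate P a \<le> ((1 + c * a)\<^sup>2 + 32000 * a / V\<^sup>2 * (1 + c * a) ^ 3) * (a\<^sup>2 / (2 * V))" .
      moreover have "a\<^sup>2 / (2 * V) > 0" using a V0 by simp
      ultimately show "rate P a / (a\<^sup>2 / (2 * V)) \<le> (1 + c * a)\<^sup>2 + 32000 * a / V\<^sup>2 * (1 + c * a) ^ 3"
        by (simp only: pos_divide_le_eq)
    qed
    have "((\<lambda>a. (1 + c * a)\<^sup>2 + 32000 * a / V\<^sup>2 * (1 + c * a) ^ 3) \<longlongrightarrow> (1 + c * 0)\<^sup>2 + 32000 * 0 / V\<^sup>2 * (1 + c * 0) ^ 3) (at_right 0)"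
      using V0 by (intro tendsto_intros) auto
    then show "((\<lambda>a. (1 + c * a)\<^sup>2 + 32000 * a / V\<^sup>2 * (1 + c * a) ^ 3) \<longlongrightarrow> 1) (at_right 0)" by simp
  qed
qed

section \<open>Cells of a Pareto variable\<close>

text \<open>The index of the cell \<open>(d k, d (k + 1)]\<close> that contains \<open>lam * ln x\<close>. Cells are closed on the right, so that their
  probabilities are differences of the distribution function. Values \<open>x \<le> 1\<close>, which have probability 0, are sent to cell 0.\<close>

definition cell :: "real \<Rightarrow> real \<Rightarrow> real \<Rightarrow> nat" where
  "cell d lam x = nat (\<lceil>lam * ln (max 1 x) / d\<rceil> - 1)"

definition letter :: "real \<Rightarrow> nat \<Rightarrow> real \<Rightarrow> real \<Rightarrow> nat" where
  "letter d K lam x = min (cell d lam x) K + 2"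

lemma measurable_cell [measurable]: "cell d lam \<in> borel \<rightarrow>\<^sub>M count_space UNIV"
  unfolding cell_def by measurable

lemma measurable_letter [measurable]: "letter d K lam \<in> borel \<rightarrow>\<^sub>M count_space UNIV"
  unfolding letter_def by measurable

lemma letter_in_alphabet: "letter d K lam x \<in> alphabet K"
  by (auto simp: letter_def alphabet_def)

lemma cell_le_iff:
  assumes "d > 0" "lam > 0" shows "cell d lam x \<le> k \<longleftrightarrow> x \<le> exp (real (Suc k) * d / lam)"
proof -
  have "cell d lam x \<le> k \<longleftrightarrow> \<lceil>lam * ln (max 1 x) / d\<rceil> \<le> int (Suc k)" by (auto simp: cell_def)
  also have "\<dots> \<longleftrightarrow> lam * ln (max 1 x) / d \<le> real (Suc k)" by (simp only: ceiling_le_iff of_int_of_nat_eq)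
  also have "\<dots> \<longleftrightarrow> ln (max 1 x) \<le> real (Suc k) * d / lam" using assms by (simp only: field_simps)
  also have "\<dots> \<longleftrightarrow> max 1 x \<le> exp (real (Suc k) * d / lam)"
    using exp_le_cancel_iff[of "ln (max 1 x)" "real (Suc k) * d / lam"] by (simp del: exp_le_cancel_iff)
  also have "\<dots> \<longleftrightarrow> x \<le> exp (real (Suc k) * d / lam)" using assms by auto
  finally show ?thesis .
qed

lemma cell_bounds:
  assumes "d > 0" "lam > 0" "x > 1"
  shows "d * real (cell d lam x) < lam * ln x" "lam * ln x \<le> d * (real (cell d lam x) + 1)"
proof -
  have pos: "lam * ln x / d > 0" using assms by simp
  then have "real (cell d lam x) = of_int (\<lceil>lam * ln x / d\<rceil> - 1)" using assms(3) by (simp add: cell_def)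
  then have "real (cell d lam x) < lam * ln x / d" "lam * ln x / d \<le> real (cell d lam x) + 1" by linarith+
  then show "d * real (cell d lam x) < lam * ln x" "lam * ln x \<le> d * (real (cell d lam x) + 1)"
    using assms(1) by (simp_all add: field_simps)
qed

context
  fixes N :: "real measure" and lam :: real
  assumes N: "real_distribution N" and cdf: "cdf N = pareto_cdf lam" and lam: "lam > 0"
begin

interpretation real_distribution N by (rule N)

lemma cdf_cell: "d > 0 \<Longrightarrow> measure N {x. cell d lam x \<le> k} = 1 - exp (- d * real (Suc k))"
proof -
  assume d: "d > 0"
  have "{x. cell d lam x \<le> k} = {.. exp (real (Suc k) * d / lam)}" using cell_le_iff[OF d lam] by auto
  then have "measure N {x. cell d lam x \<le> k} = pareto_cdf lam (exp (real (Suc k) * d / lam))"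
    using cdf by (simp add: cdf_def fun_eq_iff)
  also have "\<dots> = 1 - exp (- d * real (Suc k))"
  proof -
    have "real (Suc k) * d / lam \<ge> 0" using d lam by simp
    then have "exp (real (Suc k) * d / lam) \<ge> 1" by simp
    moreover have "exp (real (Suc k) * d / lam) powr (- lam) = exp (- d * real (Suc k))"
      using lam by (simp add: powr_def)
    ultimately show ?thesis by (simp add: pareto_cdf_def)
  qed
  finally show ?thesis .
qed

lemma cell_law:
  assumes d: "d > 0" shows "measure N {x. cell d lam x = k} = lower_weight d k"
proof (cases k)
  case 0
  have "{x. cell d lam x = k} = {x. cell d lam x \<le> 0}" using 0 by auto
  then show ?thesis using cdf_cell[OF d, of 0] 0 by (simp add: lower_weight_def)
next
  case (Suc j)
  have "{x. cell d lam x = k} = {x. cell d lam x \<le> k} - {x. cell d lam x \<le> j}" using Suc by auto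
  moreover have "measure N ({x. cell d lam x \<le> k} - {x. cell d lam x \<le> j})
      = measure N {x. cell d lam x \<le> k} - measure N {x. cell d lam x \<le> j}"
  proof (rule finite_measure_Diff)
    show "{x. cell d lam x \<le> k} \<in> events" "{x. cell d lam x \<le> j} \<in> events" by (simp_all add: cell_le_iff[OF d lam])
    show "{x. cell d lam x \<le> j} \<subseteq> {x. cell d lam x \<le> k}" using Suc by auto
  qed
  moreover have "exp (- d * real (Suc k)) = exp (- d * real k) * exp (- d)" by (simp add: exp_add[symmetric] algebra_simps)
  ultimately show ?thesis
    using cdf_cell[OF d, of k] cdf_cell[OF d, of j] Suc by (simp add: lower_weight_def algebra_simps)
qed

lemma letter_law:
  assumes d: "d > 0" and v: "v \<in> alphabet K"
  shows "measure N {x. letter d K lam x = v} = upper_weight d K v"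
proof (cases "v = K + 2")
  case False
  then have "{x. letter d K lam x = v} = {x. cell d lam x = v - 2}" using v by (auto simp: letter_def alphabet_def min_def)
  then show ?thesis using cell_law[OF d, of "v - 2"] False v by (simp add: upper_weight_def lower_weight_def alphabet_def of_nat_diff)
next
  case True
  show ?thesis
  proof (cases K)
    case 0
    then have "{x. letter d K lam x = v} = UNIV" using True by (auto simp: letter_def)
    then show ?thesis using 0 True prob_space by (simp add: upper_weight_def)
  next
    case (Suc j)
    have "{x. letter d K lam x = v} = space N - {x. cell d lam x \<le> j}" using True Suc by (auto simp: letter_def min_def)
    moreover have "{x. cell d lam x \<le> j} \<in> events" by (simp add: cell_le_iff[OF d lam])
    ultimately show ?thesis using cdf_cell[OF d, of j] prob_compl[of "{x. cell d lam x \<le> j}"] True Suc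
      by (simp add: upper_weight_def)
  qed
qed

lemma integral_letter:
  assumes d: "d > 0"
  shows "(\<integral>x. f (letter d K lam x) \<partial>N) = (\<Sum>v\<in>alphabet K. upper_weight d K v * f v)"
proof -
  let ?L = "letter d K lam"
  have ev: "{x. ?L x = v} \<in> sets N" for v
  proof -
    have "?L -` {v} \<inter> space borel \<in> sets borel" by (rule measurable_sets[OF measurable_letter]) auto
    then show ?thesis by (simp add: vimage_def)
  qed
  have "f (?L x) = (\<Sum>v\<in>alphabet K. indicator {x. ?L x = v} x * f v)" for x
    using letter_in_alphabet[of d K lam x] alphabet(1)[of K] by (simp add: indicator_def if_distrib if_distribR cong: if_cong)
  then have "(\<integral>x. f (?L x) \<partial>N) = (\<integral>x. (\<Sum>v\<in>alphabet K. indicator {x. ?L x = v} x * f v) \<partial>N)" by simp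
  also have "\<dots> = (\<Sum>v\<in>alphabet K. \<integral>x. indicator {x. ?L x = v} x * f v \<partial>N)"
    using ev by (intro Bochner_Integration.integral_sum integrable_mult_left integrable_real_indicator) (auto simp: emeasure_eq_measure)
  also have "\<dots> = (\<Sum>v\<in>alphabet K. upper_weight d K v * f v)"
    using ev letter_law[OF d] by (intro sum.cong refl) simp
  finally show ?thesis .
qed

end

section \<open>Integrals under the Pareto law\<close>

text \<open>The Pareto law with exponent 1. All exponents lead to the same exponential variables \<open>Y\<^sub>i\<close>; this one
  turns the integrals below into integrals of rational functions.\<close>

definition pareto :: "real measure" where
  "pareto = density lborel (\<lambda>s. ennreal (indicator {1..} s / s\<^sup>2))"

lemma sets_pareto [measurable_cong, simp]: "sets pareto = sets borel"
  by (simp add: pareto_def)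

lemma space_pareto [simp]: "space pareto = UNIV"
  by (simp add: pareto_def)

lemma prob_space_pareto: "prob_space pareto"
proof (rule prob_spaceI)
  have "emeasure pareto (space pareto) = (\<integral>\<^sup>+s. ennreal (indicator {1..} s / s\<^sup>2) \<partial>lborel)"
    by (simp add: pareto_def emeasure_density)
  also have "\<dots> = (\<integral>\<^sup>+s. ennreal (1 / s\<^sup>2) * indicator {1..} s \<partial>lborel)"
    by (intro nn_integral_cong) (auto simp: indicator_def)
  also have "\<dots> = ennreal (0 - (- 1 / 1))"
  proof (rule nn_integral_FTC_atLeast[where F = "\<lambda>s. - 1 / s" and a = 1 and T = 0])
    show "((\<lambda>s::real. - 1 / s) has_real_derivative 1 / s\<^sup>2) (at s)" if "1 \<le> s" for s
      using that by (auto intro!: derivative_eq_intros simp: power2_eq_square)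
    show "((\<lambda>s::real. - 1 / s) \<longlongrightarrow> 0) at_top" by real_asymp
  qed auto
  finally show "emeasure pareto (space pareto) = 1" by simp
qed

interpretation pareto: prob_space pareto by (rule prob_space_pareto)

lemma AE_pareto: "AE x in pareto. 1 < x \<and> x \<noteq> c"
proof -
  have "AE x in lborel. x \<noteq> (1::real) \<and> x \<noteq> c" using AE_lborel_singleton[of 1] AE_lborel_singleton[of c] by eventually_elim auto
  then have "AE x in lborel. 0 < ennreal (indicator {1..} x / x\<^sup>2) \<longrightarrow> 1 < x \<and> x \<noteq> c"
    by (rule eventually_mono) (auto simp: indicator_def split: if_splits)
  then show ?thesis unfolding pareto_def by (subst AE_density) auto
qed

lemma pareto_integral_atLeast:
  assumes a: "a \<ge> 1" and f [measurable]: "f \<in> borel_measurable borel" and f0: "\<And>x. x \<ge> a \<Longrightarrow> f x \<ge> 0"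
    and F: "\<And>x. x \<ge> a \<Longrightarrow> (F has_real_derivative f x / x\<^sup>2) (at x)" and T: "(F \<longlongrightarrow> T) at_top"
  shows "(\<integral>x. indicator {a..} x * f x \<partial>pareto) = T - F a"
proof -
  have "(\<integral>x. indicator {a..} x * f x \<partial>pareto) = (\<integral>x. (indicator {1..} x / x\<^sup>2) *\<^sub>R (indicator {a..} x * f x) \<partial>lborel)"
    unfolding pareto_def by (rule integral_density) auto
  also have "\<dots> = (\<integral>x. f x / x\<^sup>2 * indicator {a..} x \<partial>lborel)"
    using a by (intro Bochner_Integration.integral_cong) (auto simp: indicator_def)
  also have "\<dots> = enn2real (\<integral>\<^sup>+x. ennreal (f x / x\<^sup>2 * indicator {a..} x) \<partial>lborel)"
    using f0 by (intro integral_eq_nn_integral AE_I2) (auto simp: indicator_def)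
  also have "(\<integral>\<^sup>+x. ennreal (f x / x\<^sup>2 * indicator {a..} x) \<partial>lborel) = (\<integral>\<^sup>+x. ennreal (f x / x\<^sup>2) * indicator {a..} x \<partial>lborel)"
    by (intro nn_integral_cong) (auto simp: indicator_def)
  also have "\<dots> = ennreal (T - F a)"
    by (rule nn_integral_FTC_atLeast) (use F f0 T in auto)
  also have "enn2real (ennreal (T - F a)) = T - F a"
  proof -
    have "F a \<le> T"
    proof (rule tendsto_lowerbound[OF T])
      show "\<forall>\<^sub>F x in at_top. F a \<le> F x"
        using eventually_ge_at_top[of a]
      proof eventually_elim
        case (elim x)
        show ?case using F f0 elim by (intro DERIV_nonneg_imp_nondecreasing[of a x F]) (metis divide_nonneg_nonneg zero_le_power2)+
      qed
    qed simp
    then show ?thesis by simp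
  qed
  finally show ?thesis .
qed

lemma pareto_integral_Icc:
  assumes a: "1 \<le> a" "a \<le> b" and f [measurable]: "f \<in> borel_measurable borel" and f0: "\<And>x. a \<le> x \<Longrightarrow> x \<le> b \<Longrightarrow> f x \<ge> 0"
    and F: "\<And>x. a \<le> x \<Longrightarrow> x \<le> b \<Longrightarrow> (F has_real_derivative f x / x\<^sup>2) (at x)"
  shows "(\<integral>x. indicator {a..b} x * f x \<partial>pareto) = F b - F a"
proof -
  have "(\<integral>x. indicator {a..b} x * f x \<partial>pareto) = (\<integral>x. (indicator {1..} x / x\<^sup>2) *\<^sub>R (indicator {a..b} x * f x) \<partial>lborel)"
    unfolding pareto_def by (rule integral_density) auto
  also have "\<dots> = (\<integral>x. f x / x\<^sup>2 * indicator {a..b} x \<partial>lborel)"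
    using a by (intro Bochner_Integration.integral_cong) (auto simp: indicator_def)
  also have "\<dots> = F b - F a"
    by (rule has_bochner_integral_integral_eq, rule has_bochner_integral_FTC_Icc_nonneg)
       (use F f0 a in \<open>auto intro: DERIV_subset\<close>)
  finally show ?thesis .
qed

lemma cdf_pareto: "cdf pareto = pareto_cdf 1"
proof
  fix x :: real
  show "cdf pareto x = pareto_cdf 1 x"
  proof (cases "x \<ge> 1")
    case True
    have "cdf pareto x = (\<integral>y. indicator {..x} y \<partial>pareto)" by (simp add: cdf_def)
    also have "\<dots> = (\<integral>y. indicator {1..x} y * 1 \<partial>pareto)"
      using AE_pareto[of 1] by (intro integral_cong_AE) (auto elim!: eventually_mono simp: indicator_def)
    also have "\<dots> = - 1 / x - (- 1 / 1)"
    proof (rule pareto_integral_Icc[where F = "\<lambda>s. - 1 / s", OF _ True])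
      show "((\<lambda>s::real. - 1 / s) has_real_derivative 1 / s\<^sup>2) (at s)" if "1 \<le> s" for s
        using that by (auto intro!: derivative_eq_intros simp: power2_eq_square)
    qed auto
    finally show ?thesis using True by (simp add: pareto_cdf_def powr_minus_divide)
  next
    case False
    have "AE y in pareto. y \<notin> {..x}" using AE_pareto[of 1] False by (auto elim!: eventually_mono)
    then have "measure pareto {..x} = 0" by (intro pareto.prob_eq_0[THEN iffD2]) auto
    then show ?thesis using False by (simp add: cdf_def pareto_cdf_def)
  qed
qed

lemma real_distribution_pareto: "real_distribution pareto"
  by (rule real_distribution.intro[OF prob_space_pareto]) (simp add: real_distribution_axioms_def)

text \<open>Pointwise convergence may fail on a null set; in the applications this is the one point \<open>c\<close> where a comparison
  is an equality.\<close>

lemma pareto_dominated: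
  fixes \<phi> :: "nat \<Rightarrow> real \<Rightarrow> real"
  assumes [measurable]: "\<And>m. \<phi> m \<in> borel_measurable borel" "f \<in> borel_measurable borel"
    and B: "\<And>m x. \<bar>\<phi> m x\<bar> \<le> B" and lim: "\<And>x. 1 < x \<Longrightarrow> x \<noteq> c \<Longrightarrow> (\<lambda>m. \<phi> m x) \<longlonglongrightarrow> f x"
  shows "(\<lambda>m. \<integral>x. \<phi> m x \<partial>pareto) \<longlonglongrightarrow> (\<integral>x. f x \<partial>pareto)"
proof (rule integral_dominated_convergence[where w = "\<lambda>_. B"])
  show "AE x in pareto. (\<lambda>m. \<phi> m x) \<longlonglongrightarrow> f x" using AE_pareto[of c] by (rule eventually_mono) (use lim in auto)
qed (use B in auto)

section \<open>The limit of fine grids\<close>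

text \<open>A grid that becomes fine and long at the same time: the cells have width \<open>1/(m + 1)\<close> and reach up to \<open>m + 1\<close>.\<close>

definition mesh :: "nat \<Rightarrow> real" where "mesh m = 1 / real (Suc m)"
definition depth :: "nat \<Rightarrow> nat" where "depth m = (Suc m)\<^sup>2"

abbreviation "grid_letter m \<equiv> letter (mesh m) (depth m) 1"
abbreviation "grid_alphabet m \<equiv> alphabet (depth m)"
abbreviation "grid_weight m \<equiv> upper_weight (mesh m) (depth m)"

lemma mesh_pos: "mesh m > 0" by (simp add: mesh_def)

lemma sum_letter: "(\<Sum>v\<in>grid_alphabet m. grid_weight m v * f v) = (\<integral>x. f (grid_letter m x) \<partial>pareto)"
  by (rule integral_letter[symmetric, OF real_distribution_pareto cdf_pareto _ mesh_pos]) simp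

text \<open>The rounding errors are bounded by three cells, while a strict inequality between logarithms eventually
  amounts to arbitrarily many cells.\<close>

lemma letter_le_eventually:
  assumes "1 < u" "1 < y" "1 < x" "x \<noteq> u * y"
  shows "\<forall>\<^sub>F m in sequentially. (grid_letter m u + grid_letter m y \<le> grid_letter m x) = (u * y \<le> x)"
proof -
  let ?c = "\<lambda>m. cell (mesh m) 1"
  have b: "mesh m * real (?c m z) < ln z" "ln z \<le> mesh m * (real (?c m z) + 1)" if "z > 1" for m z
    using cell_bounds[OF mesh_pos, of 1 z m] that by auto
  have scale: "real (?c m z) < real (Suc m) * ln z" "real (Suc m) * ln z \<le> real (?c m z) + 1" if "z > 1" for m z
    using b[OF that, of m] by (auto simp: mesh_def field_simps)
  have ln_mult': "ln (u * y) = ln u + ln y" using assms by (simp add: ln_mult)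
  show ?thesis
  proof (cases "u * y \<le> x")
    case True
    then have "ln (u * y) < ln x" using assms by simp
    then have gap: "ln x - (ln u + ln y) > 0" by (simp add: ln_mult')
    have "\<forall>\<^sub>F m in sequentially. 3 < real (Suc m) * (ln x - (ln u + ln y))"
      using gap by real_asymp
    moreover have "\<forall>\<^sub>F m in sequentially. ln x < real (Suc m)" by real_asymp
    ultimately show ?thesis
    proof eventually_elim
      case (elim m)
      have "real (?c m u) + real (?c m y) + 2 \<le> real (?c m x)"
        using scale[of u m] scale[of y m] scale[of x m] assms elim(1) by (simp add: algebra_simps)
      then have 1: "?c m u + ?c m y + 2 \<le> ?c m x" by linarith
      have "real (Suc m) * ln x \<le> real (Suc m) * real (Suc m)" using elim(2) by (intro mult_left_mono) auto
      then have "real (?c m x) \<le> real (Suc m) * real (Suc m)" using scale(1)[OF \<open>1 < x\<close>, of m] by linarith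
      then have "?c m x \<le> depth m" unfolding depth_def power2_eq_square by (simp only: of_nat_mult[symmetric] of_nat_le_iff)
      then have "grid_letter m u + grid_letter m y \<le> grid_letter m x" using 1 by (simp add: letter_def)
      then show ?case using True by simp
    qed
  next
    case False
    have "\<not> grid_letter m u + grid_letter m y \<le> grid_letter m x" for m
    proof
      assume le: "grid_letter m u + grid_letter m y \<le> grid_letter m x"
      then have "min (?c m u) (depth m) + min (?c m y) (depth m) + 2 \<le> min (?c m x) (depth m)" by (simp add: letter_def)
      then have "?c m u + ?c m y + 2 \<le> ?c m x" by linarith
      then have "real (?c m u) + real (?c m y) + 2 \<le> real (?c m x)" by linarith
      then have "real (Suc m) * (ln u + ln y) < real (Suc m) * ln x"
        using scale[of u m] scale[of y m] scale[of x m] assms by (simp add: algebra_simps)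
      then have "ln (u * y) < ln x" by (simp add: ln_mult')
      then show False using assms False by (simp add: ln_less_cancel_iff)
    qed
    then show ?thesis using False by simp
  qed
qed

lemma letter_le_tendsto:
  assumes "1 < u" "1 < y" "1 < x" "x \<noteq> u * y"
  shows "(\<lambda>m. of_bool (grid_letter m u + grid_letter m y \<le> grid_letter m x) :: real) \<longlonglongrightarrow> of_bool (u * y \<le> x)"
  by (rule tendsto_eventually) (rule eventually_mono[OF letter_le_eventually[OF assms]], simp)

text \<open>The Pareto probability of \<open>{u. u * y \<le> x}\<close> for positive \<open>x\<close> and \<open>y\<close>.\<close>

definition below :: "real \<Rightarrow> real \<Rightarrow> real" where "below x y = max 0 (1 - y / x)"

lemma measurable_below [measurable]:
  "(\<lambda>x. below x y) \<in> borel_measurable borel" "(\<lambda>y. below x y) \<in> borel_measurable borel"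
  unfolding below_def by measurable

abbreviation "grid_low m x y \<equiv> low (grid_alphabet m) (grid_weight m) (grid_letter m x) (grid_letter m y)"

lemma grid_low_bounds: "0 \<le> grid_low m x y" "grid_low m x y \<le> 1"
proof -
  have p: "grid_weight m v \<ge> 0" for v using upper_weight_pos[OF mesh_pos, of m "depth m" v] by simp
  show "0 \<le> grid_low m x y" by (rule low_nonneg) (rule p)
  show "grid_low m x y \<le> 1" by (rule low_le_1) (use p alphabet(1) upper_weight_sum in auto)
qed

lemma low_tendsto:
  assumes "1 < x" "1 < y"
  shows "(\<lambda>m. grid_low m x y) \<longlonglongrightarrow> below x y"
proof -
  have eq: "grid_low m x y = (\<integral>u. of_bool (grid_letter m u + grid_letter m y \<le> grid_letter m x) \<partial>pareto)" for m
    unfolding low_alt[OF alphabet(1)] mult.commute[of "of_bool _"] by (rule sum_letter)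
  have "(\<lambda>m. \<integral>u. (of_bool (grid_letter m u + grid_letter m y \<le> grid_letter m x) :: real) \<partial>pareto) \<longlonglongrightarrow> (\<integral>u. of_bool (u * y \<le> x) \<partial>pareto)"
  proof (rule pareto_dominated[where B = 1 and c = "x / y"])
    fix u assume "1 < u" "u \<noteq> x / y"
    then show "(\<lambda>m. of_bool (grid_letter m u + grid_letter m y \<le> grid_letter m x) :: real) \<longlonglongrightarrow> of_bool (u * y \<le> x)"
      using assms by (intro letter_le_tendsto) auto
  qed auto
  also have "(\<integral>u. of_bool (u * y \<le> x) \<partial>pareto) = (\<integral>u. indicator {..x / y} u \<partial>pareto)"
    using assms by (intro Bochner_Integration.integral_cong) (auto simp: indicator_def field_simps)
  also have "\<dots> = cdf pareto (x / y)" by (simp add: cdf_def)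
  also have "\<dots> = below x y" using assms unfolding cdf_pareto
    by (auto simp: pareto_cdf_def below_def powr_minus_divide field_simps max_def)
  finally show ?thesis unfolding eq .
qed

lemma measurable_letter_fun [measurable]: "(\<lambda>x. f (letter d K lam x)) \<in> borel_measurable borel" for f :: "nat \<Rightarrow> real"
  by (rule measurable_compose[OF measurable_letter]) simp

lemma power_bound: "0 \<le> t \<Longrightarrow> t \<le> 1 \<Longrightarrow> \<bar>t ^ k\<bar> \<le> (1::real)"
  by (simp add: power_le_one)

text \<open>On fine grids each summand of \<open>fail_deriv\<close> tends to an integral that can be evaluated in closed form. The lemmas
  are named after the role of \<open>z\<close> in a failing configuration: maximum, threshold, or one of the three smaller values.\<close>

lemma integral_as_threshold:
  assumes "1 < z"
  shows "(\<integral>x. below x z ^ 3 \<partial>pareto) = 1 / (4 * z)"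
proof -
  have "(\<integral>x. below x z ^ 3 \<partial>pareto) = (\<integral>x. indicator {z..} x * (1 - z / x) ^ 3 \<partial>pareto)"
    using AE_pareto[of 1] by (intro integral_cong_AE) (use assms in \<open>auto elim!: eventually_mono simp: below_def indicator_def max_def field_simps\<close>)
  also have "\<dots> = 1 / (4 * z) - (1 - z / z) ^ 4 / (4 * z)"
  proof (rule pareto_integral_atLeast[where F = "\<lambda>x. (1 - z / x) ^ 4 / (4 * z)"])
    show "((\<lambda>x. (1 - z / x) ^ 4 / (4 * z)) has_real_derivative (1 - z / x) ^ 3 / x\<^sup>2) (at x)" if "z \<le> x" for x
      using that assms by (auto intro!: derivative_eq_intros simp: power2_eq_square field_simps)
    show "((\<lambda>x. (1 - z / x) ^ 4 / (4 * z)) \<longlongrightarrow> 1 / (4 * z)) at_top"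
    proof -
      have "1 / (4 * z) = inverse z / 4" by (simp add: field_simps)
      then show ?thesis using assms by (simp only:) real_asymp
    qed
  qed (use assms in auto)
  finally show ?thesis using assms by simp
qed

definition mean_as_competitor :: "real \<Rightarrow> real \<Rightarrow> real" where
  "mean_as_competitor z y = (1 - (1 - 1 / z) ^ 3) / (3 * y)"

lemma integral_as_competitor:
  assumes "1 < z" "1 < y"
  shows "(\<integral>x. (below x y)\<^sup>2 * of_bool (z * y \<le> x) \<partial>pareto) = mean_as_competitor z y"
proof -
  have zy: "1 < z * y" using assms less_1_mult by blast
  have yz: "y \<le> z * y" using assms by simp
  have "(\<integral>x. (below x y)\<^sup>2 * of_bool (z * y \<le> x) \<partial>pareto) = (\<integral>x. indicator {z * y..} x * (1 - y / x)\<^sup>2 \<partial>pareto)"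
    using yz zy by (intro Bochner_Integration.integral_cong) (auto simp: below_def indicator_def max_def field_simps)
  also have "\<dots> = 1 / (3 * y) - (1 - y / (z * y)) ^ 3 / (3 * y)"
  proof (rule pareto_integral_atLeast[where F = "\<lambda>x. (1 - y / x) ^ 3 / (3 * y)"])
    show "((\<lambda>x. (1 - y / x) ^ 3 / (3 * y)) has_real_derivative (1 - y / x)\<^sup>2 / x\<^sup>2) (at x)" if "z * y \<le> x" for x
    proof -
      have "x > 0" using that zy by linarith
      then show ?thesis using assms by (auto intro!: derivative_eq_intros simp: power2_eq_square field_simps)
    qed
    show "((\<lambda>x. (1 - y / x) ^ 3 / (3 * y)) \<longlongrightarrow> 1 / (3 * y)) at_top"
    proof -
      have "1 / (3 * y) = inverse y / 3" by (simp add: field_simps)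
      then show ?thesis using assms by (simp only:) real_asymp
    qed
  qed (use zy in auto)
  also have "\<dots> = mean_as_competitor z y" using assms by (simp add: mean_as_competitor_def diff_divide_distrib)
  finally show ?thesis .
qed

lemma integral_inverse: "(\<integral>y. c / y \<partial>pareto) = c / 2"
proof -
  have "(\<integral>y. 1 / y \<partial>pareto) = (\<integral>y. indicator {1..} y * (1 / y) \<partial>pareto)"
    using AE_pareto[of 1] by (intro integral_cong_AE) (auto elim!: eventually_mono simp: indicator_def)
  also have "\<dots> = 0 - (- 1 / (2 * 1\<^sup>2))"
  proof (rule pareto_integral_atLeast[where F = "\<lambda>y. - 1 / (2 * y\<^sup>2)"])
    show "((\<lambda>y. - 1 / (2 * y\<^sup>2)) has_real_derivative (1 / y) / y\<^sup>2) (at y)" if "1 \<le> y" for y :: real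
      using that by (auto intro!: derivative_eq_intros simp: power2_eq_square field_simps)
    show "((\<lambda>y::real. - 1 / (2 * y\<^sup>2)) \<longlongrightarrow> 0) at_top" by real_asymp
  qed auto
  finally have "(\<integral>y. 1 / y \<partial>pareto) = 1 / 2" by simp
  then have "c * (\<integral>y. 1 / y \<partial>pareto) = c / 2" by simp
  then show ?thesis by (simp only: integral_mult_right_zero[symmetric] times_divide_eq_right mult_1_right)
qed

definition mean_as_maximum :: "real \<Rightarrow> real" where
  "mean_as_maximum z = 1 + 3 / (2 * z) - 3 * ln z / z - 3 / z\<^sup>2 + 1 / (2 * z ^ 3)"

lemma integral_as_maximum:
  assumes "1 < z"
  shows "(\<integral>y. below z y ^ 3 \<partial>pareto) = mean_as_maximum z"
proof -
  let ?F = "\<lambda>y. - 1 / y - 3 * ln y / z + 3 * y / z\<^sup>2 - y\<^sup>2 / (2 * z ^ 3)"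
  have "(\<integral>y. below z y ^ 3 \<partial>pareto) = (\<integral>y. indicator {1..z} y * (1 - y / z) ^ 3 \<partial>pareto)"
    using AE_pareto[of 1] by (intro integral_cong_AE) (use assms in \<open>auto elim!: eventually_mono simp: below_def indicator_def max_def field_simps\<close>)
  also have "\<dots> = ?F z - ?F 1"
  proof (rule pareto_integral_Icc[where F = ?F])
    show "(?F has_real_derivative (1 - y / z) ^ 3 / y\<^sup>2) (at y)" if "1 \<le> y" "y \<le> z" for y
    proof -
      have "(?F has_real_derivative (1 / y\<^sup>2 - 3 / (y * z) + 3 / z\<^sup>2 - y / z ^ 3)) (at y)"
        using that assms by (auto intro!: derivative_eq_intros simp: power2_eq_square power3_eq_cube field_simps)
      also have "1 / y\<^sup>2 - 3 / (y * z) + 3 / z\<^sup>2 - y / z ^ 3 = (1 - y / z) ^ 3 / y\<^sup>2"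
        using that assms by (simp add: power2_eq_square power3_eq_cube field_simps)
      finally show ?thesis .
    qed
  qed (use assms in auto)
  also have "\<dots> = mean_as_maximum z" using assms by (simp add: mean_as_maximum_def power2_eq_square power3_eq_cube field_simps)
  finally show ?thesis .
qed

lemma fail_prob_swap: "fail_prob S q = 4 * (\<Sum>y\<in>S. q y * (\<Sum>x\<in>S. q x * low S q x y ^ 3))"
  unfolding fail_prob_def by (subst sum.swap) (simp add: sum_distrib_left mult_ac)

lemma fail_deriv_swap: "fail_deriv S q k = 4 * ((\<Sum>y\<in>S. q y * low S q k y ^ 3) + (\<Sum>x\<in>S. q x * low S q x k ^ 3)
     + 3 * (\<Sum>y\<in>S. q y * (\<Sum>x\<in>S. q x * (low S q x y ^ 2 * of_bool (k + y \<le> x)))))"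
proof -
  have "(\<Sum>x\<in>S. \<Sum>y\<in>S. q x * q y * low S q x y ^ 2 * of_bool (k + y \<le> x)) = (\<Sum>y\<in>S. q y * (\<Sum>x\<in>S. q x * (low S q x y ^ 2 * of_bool (k + y \<le> x))))"
    by (subst sum.swap) (simp add: sum_distrib_left mult_ac)
  then show ?thesis unfolding fail_deriv_def by simp
qed

lemma abs_integral_pareto_le:
  fixes f :: "real \<Rightarrow> real"
  assumes [measurable]: "f \<in> borel_measurable borel" and B: "\<And>x. \<bar>f x\<bar> \<le> B"
  shows "\<bar>\<integral>x. f x \<partial>pareto\<bar> \<le> B"
proof -
  have "integrable pareto f" by (rule pareto.integrable_const_bound[of _ B]) (use B in auto)
  have "\<bar>\<integral>x. f x \<partial>pareto\<bar> \<le> (\<integral>x. \<bar>f x\<bar> \<partial>pareto)" by (rule integral_abs_bound)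
  also have "\<dots> \<le> (\<integral>x. B \<partial>pareto)"
    using \<open>integrable pareto f\<close> B by (intro integral_mono) auto
  finally show ?thesis using pareto.prob_space by simp
qed

lemma limit_as_threshold:
  assumes "1 < z" shows "(\<lambda>m. \<Sum>x\<in>grid_alphabet m. grid_weight m x * low (grid_alphabet m) (grid_weight m) x (grid_letter m z) ^ 3) \<longlonglongrightarrow> 1 / (4 * z)"
  unfolding sum_letter integral_as_threshold[OF assms, symmetric]
  by (rule pareto_dominated[where B = 1 and c = 1])
     (use assms in \<open>auto intro!: tendsto_power low_tendsto power_bound grid_low_bounds\<close>)

lemma limit_as_maximum:
  assumes "1 < z" shows "(\<lambda>m. \<Sum>y\<in>grid_alphabet m. grid_weight m y * low (grid_alphabet m) (grid_weight m) (grid_letter m z) y ^ 3) \<longlonglongrightarrow> mean_as_maximum z"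
  unfolding sum_letter integral_as_maximum[OF assms, symmetric]
  by (rule pareto_dominated[where B = 1 and c = 1])
     (use assms in \<open>auto intro!: tendsto_power low_tendsto power_bound grid_low_bounds\<close>)

lemma limit_as_competitor:
  assumes z: "1 < z"
  shows "(\<lambda>m. \<Sum>y\<in>grid_alphabet m. grid_weight m y * (\<Sum>x\<in>grid_alphabet m. grid_weight m x * (low (grid_alphabet m) (grid_weight m) x y ^ 2 * of_bool (grid_letter m z + y \<le> x))))
     \<longlonglongrightarrow> (1 - (1 - 1 / z) ^ 3) / 6"
proof -
  have bd: "\<bar>(grid_low m x y)\<^sup>2 * of_bool (grid_letter m z + grid_letter m y \<le> grid_letter m x)\<bar> \<le> 1" for m x y
    using power_bound[OF grid_low_bounds, of m x y 2] by (simp add: abs_mult)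
  have in_lim: "(\<lambda>m. \<integral>x. (grid_low m x y)\<^sup>2 * of_bool (grid_letter m z + grid_letter m y \<le> grid_letter m x) \<partial>pareto) \<longlonglongrightarrow> mean_as_competitor z y" if y: "1 < y" for y
    unfolding integral_as_competitor[OF z y, symmetric]
  proof (rule pareto_dominated[where B = 1 and c = "z * y"])
    fix x assume "1 < x" "x \<noteq> z * y"
    then show "(\<lambda>m. (grid_low m x y)\<^sup>2 * of_bool (grid_letter m z + grid_letter m y \<le> grid_letter m x)) \<longlonglongrightarrow> (below x y)\<^sup>2 * of_bool (z * y \<le> x)"
      using y z by (intro tendsto_mult tendsto_power low_tendsto letter_le_tendsto) auto
  qed (use bd in auto)
  have "(\<lambda>m. \<integral>y. (\<integral>x. (grid_low m x y)\<^sup>2 * of_bool (grid_letter m z + grid_letter m y \<le> grid_letter m x) \<partial>pareto) \<partial>pareto) \<longlonglongrightarrow> (\<integral>y. mean_as_competitor z y \<partial>pareto)"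
  proof (rule pareto_dominated[where B = 1 and c = 1])
    show "(\<lambda>y. \<integral>x. (grid_low m x y)\<^sup>2 * of_bool (grid_letter m z + grid_letter m y \<le> grid_letter m x) \<partial>pareto) \<in> borel_measurable borel" for m
    proof -
      have "(\<lambda>y. \<integral>x. (grid_low m x y)\<^sup>2 * of_bool (grid_letter m z + grid_letter m y \<le> grid_letter m x) \<partial>pareto)
          = (\<lambda>y. \<Sum>v\<in>grid_alphabet m. grid_weight m v * ((low (grid_alphabet m) (grid_weight m) v (grid_letter m y))\<^sup>2 * of_bool (grid_letter m z + grid_letter m y \<le> v)))"
        by (rule ext, rule sum_letter[symmetric])
      also have "\<dots> \<in> borel_measurable borel"
        by (rule measurable_letter_fun[where f = "\<lambda>k. \<Sum>v\<in>grid_alphabet m. grid_weight m v * ((low (grid_alphabet m) (grid_weight m) v k)\<^sup>2 * of_bool (grid_letter m z + k \<le> v))"])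
      finally show ?thesis .
    qed
    show "\<bar>\<integral>x. (grid_low m x y)\<^sup>2 * of_bool (grid_letter m z + grid_letter m y \<le> grid_letter m x) \<partial>pareto\<bar> \<le> 1" for m y
      by (rule abs_integral_pareto_le) (use bd in auto)
  qed (use in_lim in \<open>auto simp: mean_as_competitor_def\<close>)
  moreover have "(\<integral>y. mean_as_competitor z y \<partial>pareto) = (1 - (1 - 1 / z) ^ 3) / 6"
    using integral_inverse[of "(1 - (1 - 1 / z) ^ 3) / 3"] by (simp add: mean_as_competitor_def)
  ultimately show ?thesis unfolding sum_letter by simp
qed

lemma fail_prob_tendsto: "(\<lambda>m. fail_prob (grid_alphabet m) (grid_weight m)) \<longlonglongrightarrow> 1/2"
proof -
  have "(\<lambda>m. \<integral>y. (\<Sum>x\<in>grid_alphabet m. grid_weight m x * low (grid_alphabet m) (grid_weight m) x (grid_letter m y) ^ 3) \<partial>pareto) \<longlonglongrightarrow> (\<integral>y. (1/4) / y \<partial>pareto)"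
  proof (rule pareto_dominated[where B = 1 and c = 1])
    show "\<bar>\<Sum>x\<in>grid_alphabet m. grid_weight m x * low (grid_alphabet m) (grid_weight m) x (grid_letter m y) ^ 3\<bar> \<le> 1" for m y
      unfolding sum_letter by (rule abs_integral_pareto_le) (auto intro!: power_bound grid_low_bounds)
  qed (use limit_as_threshold in auto)
  then have "(\<lambda>m. 4 * (\<integral>y. (\<Sum>x\<in>grid_alphabet m. grid_weight m x * low (grid_alphabet m) (grid_weight m) x (grid_letter m y) ^ 3) \<partial>pareto)) \<longlonglongrightarrow> 4 * (1/8)"
    unfolding integral_inverse by (intro tendsto_mult tendsto_const) auto
  then show ?thesis unfolding fail_prob_swap sum_letter by simp
qed

text \<open>The three summands are the limits for \<open>z\<close> as maximum, as threshold and as one of the three smaller letters.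
  This is where \<open>psi4\<close> comes from: \<open>5 psi4\<close> is, up to sign, the centred derivative of the failure probability.\<close>

lemma fail_deriv_tendsto:
  assumes z: "1 < z"
  shows "(\<lambda>m. fail_deriv (grid_alphabet m) (grid_weight m) (grid_letter m z)) \<longlonglongrightarrow> 5/2 - 5 * psi4 z"
proof -
  have "(\<lambda>m. fail_deriv (grid_alphabet m) (grid_weight m) (grid_letter m z)) \<longlonglongrightarrow> 4 * (mean_as_maximum z + 1 / (4 * z) + 3 * ((1 - (1 - 1 / z) ^ 3) / 6))"
    unfolding fail_deriv_swap by (intro tendsto_intros limit_as_threshold limit_as_maximum limit_as_competitor z)
  also have "4 * (mean_as_maximum z + 1 / (4 * z) + 3 * ((1 - (1 - 1 / z) ^ 3) / 6)) = 5/2 - 5 * psi4 z"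
    using z by (simp add: mean_as_maximum_def psi4_def power2_eq_square power3_eq_cube field_simps)
  finally show ?thesis .
qed

text \<open>The square \<open>psi4\<^sup>2 / s\<^sup>2\<close> is a combination of terms \<open>(ln s)\<^sup>i / s\<^sup>j\<close>, which are integrated one by one.\<close>

lemma Delta4_sq_value: "Delta4_sq = 271 / 52500"
  and Delta4_sq_pareto: "(\<integral>z. (psi4 z)\<^sup>2 \<partial>pareto) = Delta4_sq"
proof -
  have [measurable]: "psi4 \<in> borel_measurable borel" unfolding psi4_def by measurable
  let ?F = "\<lambda>s::real. - (9/100) / s - (21/50) / s\<^sup>2 - (43/75) / s ^ 3 + (87/25) / s ^ 4 - (2044/625) / s ^ 5 + (24/25) / s ^ 6
     - (16/175) / s ^ 7 + (18/25) * ln s / s\<^sup>2 + (72/25) * ln s / s ^ 3 - (108/25) * ln s / s ^ 4 + (96/125) * ln s / s ^ 5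
     - (48/25) * (ln s)\<^sup>2 / s ^ 3"
  have "(\<integral>z. (psi4 z)\<^sup>2 \<partial>pareto) = (\<integral>z. indicator {1..} z * (psi4 z)\<^sup>2 \<partial>pareto)"
    using AE_pareto[of 1] by (intro integral_cong_AE) (auto elim!: eventually_mono simp: indicator_def)
  also have "\<dots> = 0 - ?F 1"
  proof (rule pareto_integral_atLeast[where F = ?F])
    show "(?F has_real_derivative (psi4 s)\<^sup>2 / s\<^sup>2) (at s)" if "1 \<le> s" for s
      using that unfolding psi4_def
      by (auto intro!: derivative_eq_intros simp: field_simps eval_nat_numeral)
    show "(?F \<longlongrightarrow> 0) at_top" by real_asymp
  qed auto
  finally have 1: "(\<integral>z. (psi4 z)\<^sup>2 \<partial>pareto) = 271 / 52500" by simp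
  have "Delta4_sq = (\<integral>s. (indicator {1..} s / s\<^sup>2) *\<^sub>R (psi4 s)\<^sup>2 \<partial>lborel)"
    unfolding Delta4_sq_def set_lebesgue_integral_def
    by (intro Bochner_Integration.integral_cong) (auto simp: indicator_def)
  also have "\<dots> = (\<integral>z. (psi4 z)\<^sup>2 \<partial>pareto)"
    unfolding pareto_def by (rule integral_density[symmetric]) auto
  finally show "(\<integral>z. (psi4 z)\<^sup>2 \<partial>pareto) = Delta4_sq" ..
  then show "Delta4_sq = 271 / 52500" using 1 by simp
qed

lemma fail_var_tendsto: "(\<lambda>m. fail_var (grid_alphabet m) (grid_weight m)) \<longlonglongrightarrow> 25 * Delta4_sq"
proof -
  have [measurable]: "psi4 \<in> borel_measurable borel" unfolding psi4_def by measurable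
  have "(\<lambda>m. \<integral>z. (5 * fail_prob (grid_alphabet m) (grid_weight m) - fail_deriv (grid_alphabet m) (grid_weight m) (grid_letter m z))\<^sup>2 \<partial>pareto) \<longlonglongrightarrow> (\<integral>z. 25 * (psi4 z)\<^sup>2 \<partial>pareto)"
  proof (rule pareto_dominated[where B = 400 and c = 1])
    fix m z
    have p: "grid_weight m v \<ge> 0" for v using upper_weight_pos[OF mesh_pos, of m "depth m" v] by simp
    have "\<bar>5 * fail_prob (grid_alphabet m) (grid_weight m) - fail_deriv (grid_alphabet m) (grid_weight m) (grid_letter m z)\<bar> \<le> 20"
      by (rule centered_deriv(2)) (use p alphabet(1) upper_weight_sum in auto)
    then show "\<bar>(5 * fail_prob (grid_alphabet m) (grid_weight m) - fail_deriv (grid_alphabet m) (grid_weight m) (grid_letter m z))\<^sup>2\<bar> \<le> 400"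
      using abs_le_square_iff[of "5 * fail_prob (grid_alphabet m) (grid_weight m) - fail_deriv (grid_alphabet m) (grid_weight m) (grid_letter m z)" 20] by simp
  next
    fix z :: real assume "1 < z"
    then have "(\<lambda>m. (5 * fail_prob (grid_alphabet m) (grid_weight m) - fail_deriv (grid_alphabet m) (grid_weight m) (grid_letter m z))\<^sup>2) \<longlonglongrightarrow> (5 * (1/2) - (5/2 - 5 * psi4 z))\<^sup>2"
      by (intro tendsto_intros fail_prob_tendsto fail_deriv_tendsto)
    then show "(\<lambda>m. (5 * fail_prob (grid_alphabet m) (grid_weight m) - fail_deriv (grid_alphabet m) (grid_weight m) (grid_letter m z))\<^sup>2) \<longlonglongrightarrow> 25 * (psi4 z)\<^sup>2"
      by (simp add: power_mult_distrib)
  qed auto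
  then show ?thesis unfolding fail_var_def sum_letter by (simp add: Delta4_sq_pareto)
qed

lemma rate_asymptotics:
  assumes "sandwiched P"
  shows "((\<lambda>a. rate P a / (a\<^sup>2 / (50 * Delta4_sq))) \<longlongrightarrow> 1) (at_right 0)"
proof -
  have "((\<lambda>a. rate P a / (a\<^sup>2 / (2 * (25 * Delta4_sq)))) \<longlongrightarrow> 1) (at_right 0)"
  proof (rule rate_quadratic[OF assms mesh_pos _ fail_prob_tendsto fail_var_tendsto])
    have "(\<lambda>m. 2 * (1 / real (Suc m)) + 2 * exp (- real (Suc m)) * (- ln (1 - exp (- (1 / real (Suc m)))))) \<longlonglongrightarrow> 0"
      by real_asymp
    moreover have "- mesh m * real (depth m) = - real (Suc m)" for m
      unfolding mesh_def depth_def power2_eq_square of_nat_mult by (simp del: of_nat_Suc)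
    ultimately show "(\<lambda>m. 2 * mesh m + 2 * exp (- mesh m * real (depth m)) * - ln (1 - exp (- mesh m))) \<longlonglongrightarrow> 0"
      by (simp add: mesh_def)
    show "1 < 8 * (25 * Delta4_sq)" by (simp add: Delta4_sq_value)
  qed
  then show ?thesis by simp
qed

section \<open>The statistic as a count of triples\<close>

lemma sum_of_bool_card: "finite F \<Longrightarrow> (\<Sum>x\<in>F. of_bool (P x) :: real) = real (card {x \<in> F. P x})"
  by (subst sum_of_bool_eq) (auto simp: Int_def)

text \<open>Order statistics are handled through this counting criterion, which needs no case distinction on ties and yields
  measurability as well.\<close>

lemma sort_nth_le_iff:
  fixes xs :: "'a :: linorder list"
  assumes "k < length xs" shows "sort xs ! k \<le> c \<longleftrightarrow> k < length (filter (\<lambda>y. y \<le> c) xs)"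
proof -
  have sorted: "ys ! k \<le> c \<longleftrightarrow> k < length (filter (\<lambda>y. y \<le> c) ys)" if "sorted ys" "k < length ys" for ys k
    using that
  proof (induction ys arbitrary: k)
    case (Cons y ys)
    show ?case
    proof (cases "y \<le> c")
      case True
      then show ?thesis using Cons by (cases k) auto
    next
      case False
      then have big: "\<not> z \<le> c" if "z \<in> set (y # ys)" for z using Cons.prems(1) that by auto
      then have "filter (\<lambda>y. y \<le> c) (y # ys) = []" by (simp only: filter_empty_conv) blast
      moreover have "\<not> (y # ys) ! k \<le> c" using big nth_mem[OF Cons.prems(2)] by blast
      ultimately show ?thesis by simp
    qed
  qed simp
  have "length (filter (\<lambda>y. y \<le> c) (sort xs)) = length (filter (\<lambda>y. y \<le> c) xs)"
    by (metis mset_filter mset_sort size_mset)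
  then show ?thesis using sorted[of "sort xs" k] assms by simp
qed

lemma order_stat_le_iff:
  assumes "finite A" "1 \<le> s" "s \<le> card A"
  shows "order_stat s x A \<le> c \<longleftrightarrow> s \<le> card {i \<in> A. x i \<le> c}"
proof -
  have "length (filter (\<lambda>y. y \<le> c) (map x (sorted_list_of_set A))) = length (filter (\<lambda>i. x i \<le> c) (sorted_list_of_set A))"
    by (simp add: filter_map o_def)
  also have "\<dots> = card {i \<in> A. x i \<le> c}"
    using assms(1) by (subst distinct_card[symmetric]) auto
  finally show ?thesis
    unfolding order_stat_def using assms by (subst sort_nth_le_iff) auto
qed

text \<open>On the multiplicative scale: one member exceeds all others by the factor \<open>t\<close> at least.\<close>

definition dominating :: "(nat \<Rightarrow> real) \<Rightarrow> real \<Rightarrow> nat set \<Rightarrow> bool" where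
  "dominating x t A \<longleftrightarrow> (\<exists>i\<in>A. \<forall>j\<in>A - {i}. x j * t \<le> x i)"

text \<open>The third order statistic is at most \<open>max / t\<close> exactly if three members are at most \<open>max / t\<close>; for \<open>t > 1\<close>
  these are all members but the maximum.\<close>

lemma ratio_less_iff:
  assumes A: "finite A" "card A = 4" and x: "\<And>i. i \<in> A \<Longrightarrow> x i > 0" and t: "t > 1"
  shows "order_stat 4 x A / order_stat 3 x A < t \<longleftrightarrow> \<not> dominating x t A"
proof -
  have all: "{i \<in> A. x i \<le> c} = A \<longleftrightarrow> order_stat 4 x A \<le> c" for c
  proof -
    have "order_stat 4 x A \<le> c \<longleftrightarrow> card A \<le> card {i \<in> A. x i \<le> c}"
      using order_stat_le_iff[of A 4 x c] A by simp
    also have "\<dots> \<longleftrightarrow> {i \<in> A. x i \<le> c} = A"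
      using A card_seteq[of A "{i \<in> A. x i \<le> c}"] by auto
    finally show ?thesis by simp
  qed
  have "A \<noteq> {}" using A by auto
  obtain i0 where i0: "i0 \<in> A" "\<And>j. j \<in> A \<Longrightarrow> x j \<le> x i0"
  proof -
    have "Max (x ` A) \<in> x ` A" using A \<open>A \<noteq> {}\<close> by (intro Max_in) auto
    then obtain i where "i \<in> A" "x i = Max (x ` A)" by auto
    then show ?thesis using A by (intro that[of i]) auto
  qed
  have m4: "order_stat 4 x A = x i0"
  proof (rule antisym)
    show "order_stat 4 x A \<le> x i0" using all[of "x i0"] i0 by auto
    show "x i0 \<le> order_stat 4 x A" using all[of "order_stat 4 x A"] i0(1) by auto
  qed
  have m3: "order_stat 3 x A > 0"
  proof (rule ccontr)
    assume "\<not> ?thesis"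
    then have "3 \<le> card {i \<in> A. x i \<le> 0}" using order_stat_le_iff[of A 3 x 0] A by simp
    moreover have "{i \<in> A. x i \<le> 0} = {}" using x by force
    ultimately show False by (metis card.empty not_numeral_le_zero)
  qed
  have "order_stat 4 x A / order_stat 3 x A < t \<longleftrightarrow> \<not> order_stat 3 x A \<le> x i0 / t"
    using m3 t by (simp add: m4 field_simps not_le)
  also have "order_stat 3 x A \<le> x i0 / t \<longleftrightarrow> 3 \<le> card {j \<in> A. x j \<le> x i0 / t}"
    using order_stat_le_iff[of A 3 x "x i0 / t"] A by simp
  also have "\<dots> \<longleftrightarrow> dominating x t A"
  proof
    assume c: "3 \<le> card {j \<in> A. x j \<le> x i0 / t}"
    have "\<not> x i0 \<le> x i0 / t" using x[OF i0(1)] t by (simp add: field_simps)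
    then have "{j \<in> A. x j \<le> x i0 / t} \<subseteq> A - {i0}" by auto
    then have "{j \<in> A. x j \<le> x i0 / t} = A - {i0}"
      using A i0(1) c by (intro card_seteq) auto
    then have "x j \<le> x i0 / t" if "j \<in> A - {i0}" for j using that by blast
    then have "x j * t \<le> x i0" if "j \<in> A - {i0}" for j using that t by (simp add: pos_le_divide_eq)
    then show "dominating x t A" unfolding dominating_def using i0(1) by blast
  next
    assume "dominating x t A"
    then obtain i where i: "i \<in> A" "\<And>j. j \<in> A - {i} \<Longrightarrow> x j * t \<le> x i" unfolding dominating_def by blast
    have "A - {i} \<subseteq> {j \<in> A. x j \<le> x i0 / t}"
    proof
      fix j assume j: "j \<in> A - {i}"
      have "x j * t \<le> x i0" using i(2)[OF j] i0(2)[OF i(1)] by linarith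
      then show "j \<in> {j \<in> A. x j \<le> x i0 / t}" using j t by (simp add: pos_le_divide_eq)
    qed
    moreover have "card (A - {i}) = 3" using A i(1) by simp
    ultimately show "3 \<le> card {j \<in> A. x j \<le> x i0 / t}" using card_mono[of "{j \<in> A. x j \<le> x i0 / t}" "A - {i}"] A by simp
  qed
  finally show ?thesis .
qed

text \<open>For \<open>t > 1\<close> the dominating member of a quadruple is unique, so dominated quadruples correspond to
  pairs of a member \<open>i\<close> and three indices that it dominates.\<close>

lemma card_dominating:
  assumes I: "finite I" and x: "\<And>i. i \<in> I \<Longrightarrow> x i > 0" and t: "t > 1"
  shows "card {A. A \<subseteq> I \<and> card A = 4 \<and> dominating x t A} = (\<Sum>i\<in>I. card {j \<in> I. x j * t \<le> x i} choose 3)"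
proof -
  define D where "D i = {j \<in> I. x j * t \<le> x i}" for i
  have grow: "x i < x i * t" if "i \<in> I" for i
    using mult_strict_left_mono[OF t x[OF that]] by (simp only: mult_1_right)
  have nD: "i \<notin> D i" if "i \<in> I" for i
  proof
    assume "i \<in> D i"
    then have "x i * t \<le> x i" unfolding D_def by blast
    then show False using grow[OF that] by linarith
  qed
  have subD: "D i \<subseteq> I" for i unfolding D_def by (rule Collect_restrict)
  have finD: "finite (D i)" for i by (rule finite_subset[OF subD I])
  define P where "P = Sigma I (\<lambda>i. {B. B \<subseteq> D i \<and> card B = 3})"
  have unique: "i = i' \<and> B = B'"
    if P: "i \<in> I" "B \<subseteq> D i" "i' \<in> I" "B' \<subseteq> D i'" and eq: "insert i B = insert i' B'" for i B i' B'
  proof -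
    have "i = i'"
    proof (rule ccontr)
      assume "i \<noteq> i'"
      moreover have "i \<in> insert i' B'" unfolding eq[symmetric] by (rule insertI1)
      moreover have "i' \<in> insert i B" unfolding eq by (rule insertI1)
      ultimately have "i \<in> B'" "i' \<in> B" by (simp_all only: insert_iff) metis+
      then have "i \<in> D i'" "i' \<in> D i" using P by blast+
      then have "x i * t \<le> x i'" "x i' * t \<le> x i" unfolding D_def by blast+
      then show False using grow[OF P(1)] grow[OF P(3)] by linarith
    qed
    moreover have "i \<notin> B" "i' \<notin> B'" using nD P by blast+
    ultimately show ?thesis using eq insert_ident[of i B B'] by simp
  qed
  have into: "insert i B \<in> {A. A \<subseteq> I \<and> card A = 4 \<and> dominating x t A}"
    if P: "i \<in> I" "B \<subseteq> D i" "card B = 3" for i B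
  proof -
    have "i \<notin> B" using nD P by blast
    moreover have "finite B" using finite_subset[OF P(2) finD] .
    ultimately have "card (insert i B) = 4" using P(3) by simp
    moreover have "x j * t \<le> x i" if "j \<in> insert i B - {i}" for j using that P(2) unfolding D_def by blast
    then have "dominating x t (insert i B)" unfolding dominating_def by blast
    moreover have "insert i B \<subseteq> I" using P(1,2) subD[of i] by blast
    ultimately show ?thesis by blast
  qed
  have onto: "\<exists>i B. i \<in> I \<and> B \<subseteq> D i \<and> card B = 3 \<and> A = insert i B"
    if A: "A \<subseteq> I" "card A = 4" "dominating x t A" for A
  proof -
    obtain i where i: "i \<in> A" "\<And>j. j \<in> A - {i} \<Longrightarrow> x j * t \<le> x i" using A(3) unfolding dominating_def by blast
    have "A - {i} \<subseteq> D i" unfolding D_def using A i(2) by blast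
    moreover have "card (A - {i}) = 3" using A i(1) by simp
    moreover have "A = insert i (A - {i})" using i(1) by blast
    ultimately show ?thesis using A(1) i(1) by blast
  qed
  have "bij_betw (\<lambda>p. insert (fst p) (snd p)) P {A. A \<subseteq> I \<and> card A = 4 \<and> dominating x t A}"
  proof (rule bij_betw_imageI)
    show "inj_on (\<lambda>p. insert (fst p) (snd p)) P"
    proof (rule inj_onI)
      fix p q assume "p \<in> P" "q \<in> P" "insert (fst p) (snd p) = insert (fst q) (snd q)"
      then have "fst p = fst q \<and> snd p = snd q" unfolding P_def by (intro unique) force+
      then show "p = q" by (simp add: prod_eq_iff)
    qed
    show "(\<lambda>p. insert (fst p) (snd p)) ` P = {A. A \<subseteq> I \<and> card A = 4 \<and> dominating x t A}" (is "?f ` P = ?R")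
    proof (rule equalityI; rule subsetI)
      fix A assume "A \<in> ?f ` P"
      then obtain p where "p \<in> P" "A = insert (fst p) (snd p)" by blast
      then show "A \<in> ?R" using into[of "fst p" "snd p"] unfolding P_def by force
    next
      fix A assume "A \<in> ?R"
      then obtain i B where "i \<in> I" "B \<subseteq> D i" "card B = 3" "A = insert i B" using onto[of A] by blast
      then show "A \<in> ?f ` P" unfolding P_def by (intro image_eqI[of _ _ "(i, B)"]) simp_all
    qed
  qed
  then have "card {A. A \<subseteq> I \<and> card A = 4 \<and> dominating x t A} = card P" by (rule bij_betw_same_card[symmetric])
  also have "\<dots> = (\<Sum>i\<in>I. card (D i) choose 3)"
  proof -
    have "finite {B. B \<subseteq> D i \<and> card B = 3}" for i by (rule finite_subset[of _ "Pow (D i)"]) (use finD in auto)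
    then have "card P = (\<Sum>i\<in>I. card {B. B \<subseteq> D i \<and> card B = 3})" unfolding P_def using I by (intro card_SigmaI) auto
    also have "\<dots> = (\<Sum>i\<in>I. card (D i) choose 3)" by (intro sum.cong refl n_subsets finD)
    finally show ?thesis .
  qed
  finally show ?thesis by (simp add: D_def)
qed

definition triple_count :: "(nat \<Rightarrow> nat \<Rightarrow> nat \<Rightarrow> bool) \<Rightarrow> nat \<Rightarrow> nat" where
  "triple_count R n = (\<Sum>l=1..n. \<Sum>i=1..n. card {j \<in> {1..n}. R j l i} choose 3)"

text \<open>The fraction of failing pairs of a quadruple and an index \<open>l\<close>; \<open>R j l i\<close> says that \<open>i\<close> dominates \<open>j\<close> at level \<open>l\<close>.
  The relation is a parameter in order to compare samples with words of letters.\<close>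

definition triple_frac :: "(nat \<Rightarrow> nat \<Rightarrow> nat \<Rightarrow> bool) \<Rightarrow> nat \<Rightarrow> real" where
  "triple_frac R n = real (triple_count R n) / (real n * real (n choose 4))"

lemma triple_frac_mono:
  assumes "\<And>j l i. j \<in> {1..n} \<Longrightarrow> l \<in> {1..n} \<Longrightarrow> i \<in> {1..n} \<Longrightarrow> R j l i \<Longrightarrow> R' j l i"
  shows "triple_frac R n \<le> triple_frac R' n"
proof -
  have "triple_count R n \<le> triple_count R' n" unfolding triple_count_def
  proof (intro sum_mono)
    fix l i assume "l \<in> {1..n}" "i \<in> {1..n}"
    then have "{j \<in> {1..n}. R j l i} \<subseteq> {j \<in> {1..n}. R' j l i}" using assms by blast
    then show "card {j \<in> {1..n}. R j l i} choose 3 \<le> card {j \<in> {1..n}. R' j l i} choose 3"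
      by (intro binomial_right_mono card_mono) simp_all
  qed
  then show ?thesis unfolding triple_frac_def by (intro divide_right_mono) auto
qed

lemma H_emp_sum:
  assumes n: "n \<ge> 4" and x: "\<And>i. i \<in> {1..n} \<Longrightarrow> x i > 1"
  shows "(\<Sum>l=1..n. H_emp x n (x l)) / real n = 1 - triple_frac (\<lambda>j l i. x j * x l \<le> x i) n"
proof -
  have C: "real (n choose 4) > 0" using n by simp
  have x0: "x i > 0" if "i \<in> {1..n}" for i using x[OF that] by simp
  let ?F = "{A. A \<subseteq> {1..n} \<and> card A = 4}"
  have finF: "finite ?F" by (rule finite_subset[of _ "Pow {1..n}"]) auto
  have cardF: "card ?F = n choose 4" by (subst n_subsets) simp_all
  have H: "H_emp x n (x l) = 1 - real (\<Sum>i=1..n. card {j \<in> {1..n}. x j * x l \<le> x i} choose 3) / real (n choose 4)"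
    if l: "l \<in> {1..n}" for l
  proof -
    let ?t = "x l"
    have "(\<Sum>A\<in>?F. of_bool (order_stat 4 x A / order_stat 3 x A < ?t)) = (\<Sum>A\<in>?F. 1 - of_bool (dominating x ?t A) :: real)"
    proof (intro sum.cong refl)
      fix A assume A: "A \<in> ?F"
      then have sub: "A \<subseteq> {1..n}" and c4: "card A = 4" by blast+
      have "order_stat 4 x A / order_stat 3 x A < ?t \<longleftrightarrow> \<not> dominating x ?t A"
      proof (rule ratio_less_iff[OF finite_subset[OF sub] c4 _ x[OF l]])
        show "0 < x i" if "i \<in> A" for i using x0 sub that by blast
      qed simp
      then show "of_bool (order_stat 4 x A / order_stat 3 x A < ?t) = (1 - of_bool (dominating x ?t A) :: real)"
        by (simp only: of_bool_not_iff)
    qed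
    also have "\<dots> = real (n choose 4) - real (card {A \<in> ?F. dominating x ?t A})"
      unfolding sum_subtractf sum_of_bool_card[OF finF] cardF[symmetric] by simp
    also have "{A \<in> ?F. dominating x ?t A} = {A. A \<subseteq> {1..n} \<and> card A = 4 \<and> dominating x ?t A}" by blast
    also have "card \<dots> = (\<Sum>i=1..n. card {j \<in> {1..n}. x j * x l \<le> x i} choose 3)"
      by (rule card_dominating[OF finite_atLeastAtMost x0 x[OF l]])
    finally show ?thesis unfolding H_emp_def using C by (simp add: diff_divide_distrib)
  qed
  have "(\<Sum>l=1..n. H_emp x n (x l)) = (\<Sum>l=1..n. 1 - real (\<Sum>i=1..n. card {j \<in> {1..n}. x j * x l \<le> x i} choose 3) / real (n choose 4))"
    by (intro sum.cong refl H)
  also have "\<dots> = real n - real (triple_count (\<lambda>j l i. x j * x l \<le> x i) n) / real (n choose 4)"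
    by (simp only: sum_subtractf triple_count_def of_nat_sum sum_divide_distrib[symmetric]) simp
  finally have "(\<Sum>l=1..n. H_emp x n (x l)) / real n
      = (real n - real (triple_count (\<lambda>j l i. x j * x l \<le> x i) n) / real (n choose 4)) / real n" by (simp only:)
  also have "\<dots> = 1 - real (triple_count (\<lambda>j l i. x j * x l \<le> x i) n) / (real n * real (n choose 4))"
    using n by (simp only: diff_divide_distrib divide_divide_eq_left mult.commute) simp
  finally show ?thesis unfolding triple_frac_def .
qed

text \<open>Each pair of distinct indices contributes at most one strict inequality, and exactly one if there are no ties.\<close>

lemma F_emp_sum:
  fixes x :: "nat \<Rightarrow> real"
  assumes n: "n \<ge> 1"
  shows "(\<Sum>l=1..n. F_emp x n (x l)) / real n \<le> 1/2 - 1 / (2 * real n)"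
    and "inj_on x {1..n} \<Longrightarrow> (\<Sum>l=1..n. F_emp x n (x l)) / real n = 1/2 - 1 / (2 * real n)"
proof -
  define T where "T = (\<Sum>l=1..n. \<Sum>j=1..n. of_bool (x j < x l) :: real)"
  have T': "T = (\<Sum>l=1..n. \<Sum>j=1..n. of_bool (x l < x j))" unfolding T_def by (rule sum.swap)
  have E: "(\<Sum>l=1..n. \<Sum>j=1..n. of_bool (l \<noteq> j) :: real) = real n * real n - real n"
  proof -
    have "(\<Sum>j=1..n. of_bool (l \<noteq> j) :: real) = real n - 1" if "l \<in> {1..n}" for l
    proof -
      have "(\<Sum>j=1..n. of_bool (l \<noteq> j) :: real) = (\<Sum>j=1..n. 1 - of_bool (j = l))" by (intro sum.cong) auto
      also have "\<dots> = real n - 1" using that by (simp add: sum_subtractf of_bool_def)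
      finally show ?thesis .
    qed
    then have "(\<Sum>l=1..n. \<Sum>j=1..n. of_bool (l \<noteq> j) :: real) = (\<Sum>l=1..n. real n - 1)" by (intro sum.cong) auto
    then show ?thesis by (simp add: algebra_simps)
  qed
  have eq: "(\<Sum>l=1..n. F_emp x n (x l)) / real n = T / (real n * real n)"
    unfolding F_emp_def sum_divide_distrib[symmetric] T_def by simp
  have val: "(real n * real n - real n) / 2 / (real n * real n) = 1/2 - 1 / (2 * real n)" using n by (simp add: field_simps)
  have TT: "2 * T = (\<Sum>l=1..n. \<Sum>j=1..n. of_bool (x j < x l) + of_bool (x l < x j))"
  proof -
    have "2 * T = T + (\<Sum>l=1..n. \<Sum>j=1..n. of_bool (x l < x j))" using T' by linarith
    then show ?thesis unfolding T_def by (simp only: sum.distrib)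
  qed
  have "2 * T = (\<Sum>l=1..n. \<Sum>j=1..n. of_bool (x j < x l) + of_bool (x l < x j))" by (rule TT)
  also have "\<dots> \<le> (\<Sum>l=1..n. \<Sum>j=1..n. of_bool (l \<noteq> j))" by (intro sum_mono) (auto simp: of_bool_def)
  finally have "2 * T \<le> real n * real n - real n" unfolding E .
  then have "T \<le> (real n * real n - real n) / 2" by simp
  then have "T / (real n * real n) \<le> (real n * real n - real n) / 2 / (real n * real n)" by (intro divide_right_mono) auto
  then show "(\<Sum>l=1..n. F_emp x n (x l)) / real n \<le> 1/2 - 1 / (2 * real n)" by (simp only: eq val)
  assume inj: "inj_on x {1..n}"
  have "2 * T = (\<Sum>l=1..n. \<Sum>j=1..n. of_bool (x j < x l) + of_bool (x l < x j))" by (rule TT)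
  also have "\<dots> = (\<Sum>l=1..n. \<Sum>j=1..n. of_bool (l \<noteq> j))"
  proof (intro sum.cong refl)
    fix l j assume "l \<in> {1..n}" "j \<in> {1..n}"
    then have "x l = x j \<longleftrightarrow> l = j" by (rule inj_on_eq_iff[OF inj])
    then show "of_bool (x j < x l) + of_bool (x l < x j) = (of_bool (l \<noteq> j) :: real)"
      by (cases "x j" "x l" rule: linorder_cases) auto
  qed
  finally have "2 * T = real n * real n - real n" unfolding E .
  then have "T = (real n * real n - real n) / 2" by simp
  then show "(\<Sum>l=1..n. F_emp x n (x l)) / real n = 1/2 - 1 / (2 * real n)" by (simp only: eq val)
qed

lemma I_stat_triples:
  assumes n: "n \<ge> 4" and x: "\<And>i. i \<in> {1..n} \<Longrightarrow> x i > 1"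
  shows "1/2 + 1 / (2 * real n) - triple_frac (\<lambda>j l i. x j * x l \<le> x i) n \<le> I_stat x n"
    and "inj_on x {1..n} \<Longrightarrow> I_stat x n = 1/2 + 1 / (2 * real n) - triple_frac (\<lambda>j l i. x j * x l \<le> x i) n"
proof -
  have eq: "I_stat x n = (\<Sum>l=1..n. H_emp x n (x l)) / real n - (\<Sum>l=1..n. F_emp x n (x l)) / real n"
    by (simp add: I_stat_def sum_subtractf diff_divide_distrib)
  have h: "(\<Sum>l=1..n. H_emp x n (x l)) / real n = 1 - triple_frac (\<lambda>j l i. x j * x l \<le> x i) n"
    by (rule H_emp_sum[OF n x])
  show "1/2 + 1 / (2 * real n) - triple_frac (\<lambda>j l i. x j * x l \<le> x i) n \<le> I_stat x n"
    using F_emp_sum(1)[of n x] n h unfolding eq by linarith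
  assume "inj_on x {1..n}"
  then show "I_stat x n = 1/2 + 1 / (2 * real n) - triple_frac (\<lambda>j l i. x j * x l \<le> x i) n"
    using F_emp_sum(2)[of n x] n h unfolding eq by linarith
qed

lemma choose_3: "real (m choose 3) = real m * (real m - 1) * (real m - 2) / 6"
proof -
  have 2: "real (m choose 2) = real m * (real m - 1) / 2" for m
    by (induction m) (auto simp: numeral_2_eq_2 field_simps)
  show ?thesis
  proof (induction m)
    case (Suc m)
    have "Suc m choose 3 = (m choose 2) + (m choose 3)" by (simp add: numeral_3_eq_3 numeral_2_eq_2)
    then show ?case using Suc 2[of m] by (simp add: field_simps)
  qed simp
qed

lemma choose_4: "real (m choose 4) = real m * (real m - 1) * (real m - 2) * (real m - 3) / 24"
proof (induction m)
  case (Suc m)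
  have "Suc m choose 4 = (m choose 3) + (m choose 4)" by (simp add: numeral_3_eq_3 eval_nat_numeral)
  then show ?case using Suc choose_3[of m] by (simp add: field_simps)
qed simp

text \<open>Falling factorials against powers: the error that replaces a U-statistic by a V-statistic.\<close>

lemma without_replacement_error:
  fixes m n :: real
  assumes m: "0 \<le> m" "m \<le> n" and n: "n \<ge> 6"
  shows "\<bar>m * (m - 1) * (m - 2) / ((n - 1) * (n - 2) * (n - 3)) - m ^ 3 / n ^ 3\<bar> \<le> 72 / n"
proof -
  let ?D = "(n - 1) * (n - 2) * (n - 3)"
  have D: "n ^ 3 / 8 \<le> ?D"
  proof -
    have "(n / 2) * (n / 2) * (n / 2) \<le> ?D" using n by (intro mult_mono) auto
    then show ?thesis by (simp add: power3_eq_cube)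
  qed
  have n3: "n ^ 3 > 0" using n by simp
  then have D0: "?D > 0" using D by linarith
  have eq: "m * (m - 1) * (m - 2) / ?D - m ^ 3 / n ^ 3 = (n ^ 3 * (2 * m - 3 * m\<^sup>2) + m ^ 3 * (6 * n\<^sup>2 - 11 * n + 6)) / (?D * n ^ 3)"
  proof -
    have "m * (m - 1) * (m - 2) * n ^ 3 - m ^ 3 * ?D = n ^ 3 * (2 * m - 3 * m\<^sup>2) + m ^ 3 * (6 * n\<^sup>2 - 11 * n + 6)"
      by (simp add: power2_eq_square power3_eq_cube algebra_simps)
    moreover have "m * (m - 1) * (m - 2) / ?D - m ^ 3 / n ^ 3 = (m * (m - 1) * (m - 2) * n ^ 3 - m ^ 3 * ?D) / (?D * n ^ 3)"
      by (rule diff_frac_eq) (use D0 n3 in linarith)+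
    ultimately show ?thesis by (simp only:)
  qed
  have num: "\<bar>n ^ 3 * (2 * m - 3 * m\<^sup>2) + m ^ 3 * (6 * n\<^sup>2 - 11 * n + 6)\<bar> \<le> 9 * n ^ 5"
  proof -
    have m2: "m\<^sup>2 \<le> n\<^sup>2" "m ^ 3 \<le> n ^ 3" using m by (auto intro: power_mono)
    have "n \<le> n\<^sup>2" using n by (simp add: power2_eq_square)
    then have "\<bar>2 * m - 3 * m\<^sup>2\<bar> \<le> 3 * n\<^sup>2" 
      unfolding abs_le_iff using m m2 zero_le_power2[of m] by (intro conjI) linarith+
    then have "\<bar>n ^ 3 * (2 * m - 3 * m\<^sup>2)\<bar> \<le> n ^ 3 * (3 * n\<^sup>2)" using n3 by (simp add: abs_mult)
    moreover have "\<bar>6 * n\<^sup>2 - 11 * n + 6\<bar> \<le> 6 * n\<^sup>2" 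
      unfolding abs_le_iff using n \<open>n \<le> n\<^sup>2\<close> zero_le_power2[of n] by (intro conjI) linarith+
    then have "\<bar>m ^ 3 * (6 * n\<^sup>2 - 11 * n + 6)\<bar> \<le> n ^ 3 * (6 * n\<^sup>2)"
      unfolding abs_mult using m m2 n3 by (intro mult_mono) auto
    moreover have "n ^ 3 * (3 * n\<^sup>2) + n ^ 3 * (6 * n\<^sup>2) = 9 * n ^ 5" by algebra
    ultimately show ?thesis by linarith
  qed
  have den: "n ^ 3 / 8 * n ^ 3 \<le> ?D * n ^ 3" using D n3 by (intro mult_right_mono) auto
  have pos: "0 < n ^ 3 / 8 * n ^ 3" using n3 by simp
  then have "0 < ?D * n ^ 3" using den by linarith
  then have "\<bar>m * (m - 1) * (m - 2) / ?D - m ^ 3 / n ^ 3\<bar> = \<bar>n ^ 3 * (2 * m - 3 * m\<^sup>2) + m ^ 3 * (6 * n\<^sup>2 - 11 * n + 6)\<bar> / (?D * n ^ 3)"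
    unfolding eq by (rule abs_div_pos[symmetric])
  also have "\<dots> \<le> 9 * n ^ 5 / (n ^ 3 / 8 * n ^ 3)"
    by (rule frac_le[OF _ num pos den]) (use n in simp)
  also have "\<dots> = 72 / n"
  proof -
    have "n ^ 3 / 8 * n ^ 3 = n ^ 5 * (n / 8)" by algebra
    then show ?thesis using n by simp
  qed
  finally show ?thesis .
qed

lemma map_upt_sum: "sum_list (map g (map f [1..<Suc n])) = (\<Sum>i=1..n. g (f i))"
  by (simp only: map_map interv_sum_list_conv_sum_set_nat set_upt o_def) (simp add: atLeastLessThanSuc_atLeastAtMost)

lemma fail_prob_word:
  assumes n: "n \<ge> 1" and S: "finite S" "\<And>i. i \<in> {1..n} \<Longrightarrow> f i \<in> S"
  shows "fail_prob S (freq (mset (map f [1..<Suc n])))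
    = 4 * (\<Sum>i=1..n. \<Sum>l=1..n. (real (card {j \<in> {1..n}. f j + f l \<le> f i}) / real n) ^ 3) / (real n)\<^sup>2"
proof -
  define q where "q = freq (mset (map f [1..<Suc n]))"
  have w: "map f [1..<Suc n] \<in> words S n" using S(2) by (auto simp: words_def)
  have avg: "(\<Sum>v\<in>S. q v * g v) = (\<Sum>i=1..n. g (f i)) / real n" for g
  proof -
    have "real n * (\<Sum>v\<in>S. q v * g v) = (\<Sum>i=1..n. g (f i))"
      unfolding q_def using sum_list_eq_freq[OF S(1) w, of g] unfolding map_upt_sum by (rule sym)
    then show ?thesis using n by (simp add: field_simps)
  qed
  have low: "low S q x y = real (card {j \<in> {1..n}. f j + y \<le> x}) / real n" for x y
  proof -
    have "low S q x y = (\<Sum>v\<in>S. q v * of_bool (v + y \<le> x))" unfolding low_alt[OF S(1)] by (simp add: mult.commute)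
    also have "\<dots> = (\<Sum>i=1..n. of_bool (f i + y \<le> x)) / real n" by (rule avg)
    also have "(\<Sum>i=1..n. of_bool (f i + y \<le> x) :: real) = real (card {j \<in> {1..n}. f j + y \<le> x})"
      by (rule sum_of_bool_card) simp
    finally show ?thesis .
  qed
  have "fail_prob S q = 4 * (\<Sum>x\<in>S. q x * (\<Sum>y\<in>S. q y * low S q x y ^ 3))"
    unfolding fail_prob_def by (simp add: sum_distrib_left mult_ac)
  also have "\<dots> = 4 * ((\<Sum>i=1..n. (\<Sum>l=1..n. low S q (f i) (f l) ^ 3) / real n) / real n)"
    by (simp only: avg)
  also have "\<dots> = 4 * (\<Sum>i=1..n. \<Sum>l=1..n. low S q (f i) (f l) ^ 3) / (real n)\<^sup>2"
    unfolding sum_divide_distrib[symmetric] by (simp add: power2_eq_square)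
  finally have "fail_prob S q = 4 * (\<Sum>i=1..n. \<Sum>l=1..n. (real (card {j \<in> {1..n}. f j + f l \<le> f i}) / real n) ^ 3) / (real n)\<^sup>2"
    unfolding low .
  then show ?thesis unfolding q_def .
qed

text \<open>Each of the \<open>n\<^sup>2\<close> terms has an error of at most \<open>4 / n\<^sup>2 * 72 / n\<close>.\<close>

lemma triple_frac_word:
  assumes n: "n \<ge> 6" and S: "finite S" "\<And>i. i \<in> {1..n} \<Longrightarrow> f i \<in> S"
  shows "\<bar>triple_frac (\<lambda>j l i. f j + f l \<le> f i) n - fail_prob S (freq (mset (map f [1..<Suc n])))\<bar> \<le> 288 / real n"
proof -
  define m where "m i l = real (card {j \<in> {1..n}. f j + f l \<le> f i})" for i l
  have m: "0 \<le> m i l" "m i l \<le> real n" for i l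
  proof -
    have "card {j \<in> {1..n}. f j + f l \<le> f i} \<le> card {1..n}" by (rule card_mono) auto
    then show "0 \<le> m i l" "m i l \<le> real n" by (auto simp: m_def)
  qed
  let ?N = "real n" and ?D = "(real n - 1) * (real n - 2) * (real n - 3)"
  have nn: "?N \<ge> 6" using n by simp
  have "triple_frac (\<lambda>j l i. f j + f l \<le> f i) n = (\<Sum>l=1..n. \<Sum>i=1..n. m i l * (m i l - 1) * (m i l - 2) / 6) / (?N * (?N * ?D / 24))"
    unfolding triple_frac_def triple_count_def choose_4 by (simp add: choose_3 m_def mult.assoc)
  also have "\<dots> = (\<Sum>l=1..n. \<Sum>i=1..n. m i l * (m i l - 1) * (m i l - 2) / 6 / (?N * (?N * ?D / 24)))"
    by (simp only: sum_divide_distrib)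
  also have "\<dots> = (\<Sum>l=1..n. \<Sum>i=1..n. 4 / ?N\<^sup>2 * (m i l * (m i l - 1) * (m i l - 2) / ?D))"
    by (intro sum.cong refl) (simp add: power2_eq_square)
  finally have Q: "triple_frac (\<lambda>j l i. f j + f l \<le> f i) n = (\<Sum>l=1..n. \<Sum>i=1..n. 4 / ?N\<^sup>2 * (m i l * (m i l - 1) * (m i l - 2) / ?D))" .
  have "fail_prob S (freq (mset (map f [1..<Suc n]))) = 4 * (\<Sum>i=1..n. \<Sum>l=1..n. (m i l / ?N) ^ 3) / ?N\<^sup>2"
    unfolding m_def by (rule fail_prob_word) (use n S in auto)
  also have "\<dots> = 4 * (\<Sum>l=1..n. \<Sum>i=1..n. (m i l / ?N) ^ 3) / ?N\<^sup>2" by (subst sum.swap) simp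
  also have "\<dots> = (\<Sum>l=1..n. \<Sum>i=1..n. 4 / ?N\<^sup>2 * (m i l ^ 3 / ?N ^ 3))"
    by (simp add: sum_distrib_left sum_divide_distrib power_divide)
  finally have F: "fail_prob S (freq (mset (map f [1..<Suc n]))) = (\<Sum>l=1..n. \<Sum>i=1..n. 4 / ?N\<^sup>2 * (m i l ^ 3 / ?N ^ 3))" .
  have "\<bar>triple_frac (\<lambda>j l i. f j + f l \<le> f i) n - fail_prob S (freq (mset (map f [1..<Suc n])))\<bar>
      = \<bar>\<Sum>l=1..n. \<Sum>i=1..n. 4 / ?N\<^sup>2 * (m i l * (m i l - 1) * (m i l - 2) / ?D - m i l ^ 3 / ?N ^ 3)\<bar>"
    unfolding Q F sum_subtractf[symmetric] right_diff_distrib ..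
  also have "\<dots> \<le> (\<Sum>l=1..n. \<Sum>i=1..n. 4 / ?N\<^sup>2 * (72 / ?N))"
  proof (intro order_trans[OF sum_abs] sum_mono)
    fix l i
    have "\<bar>4 / ?N\<^sup>2 * (m i l * (m i l - 1) * (m i l - 2) / ?D - m i l ^ 3 / ?N ^ 3)\<bar>
        = 4 / ?N\<^sup>2 * \<bar>m i l * (m i l - 1) * (m i l - 2) / ?D - m i l ^ 3 / ?N ^ 3\<bar>"
      unfolding abs_mult by (subst abs_of_nonneg[of "4 / ?N\<^sup>2"]) auto
    also have "\<dots> \<le> 4 / ?N\<^sup>2 * (72 / ?N)" using without_replacement_error[OF m nn] by (intro mult_left_mono) auto
    finally show "\<bar>4 / ?N\<^sup>2 * (m i l * (m i l - 1) * (m i l - 2) / ?D - m i l ^ 3 / ?N ^ 3)\<bar> \<le> 4 / ?N\<^sup>2 * (72 / ?N)" .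
  qed
  also have "\<dots> = 288 / ?N" using nn by (simp add: power2_eq_square)
  finally show ?thesis .
qed

section \<open>Pareto samples\<close>

text \<open>The shift by two makes the comparison of letters stronger than that of the values: each of the two summands on the
  left may be rounded down by one cell. A capped letter is the largest one, so it cannot occur on the left.\<close>

lemma letter_imp_fail:
  assumes "d > 0" "lam > 0" "1 < u" "1 < y" "1 < x" and le: "letter d K lam u + letter d K lam y \<le> letter d K lam x"
  shows "u * y \<le> x"
proof -
  let ?c = "cell d lam"
  have "min (?c u) K + min (?c y) K + 2 \<le> min (?c x) K" using le by (simp add: letter_def)
  then have "?c u + ?c y + 2 \<le> ?c x" by linarith
  then have "d * (real (?c u) + 1 + (real (?c y) + 1)) \<le> d * real (?c x)" using assms(1) by (intro mult_left_mono) auto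
  then have "lam * ln u + lam * ln y \<le> lam * ln x"
    using cell_bounds[OF assms(1,2,3)] cell_bounds[OF assms(1,2,4)] cell_bounds[OF assms(1,2,5)] by (simp only: distrib_left)
  then have "lam * ln (u * y) \<le> lam * ln x" using assms by (simp add: ln_mult distrib_left)
  then have "ln (u * y) \<le> ln x" using assms(2) by simp
  then show ?thesis using assms by (subst (asm) ln_le_cancel_iff) auto
qed

text \<open>Without the shift the comparison of cells is weaker than that of the values.\<close>

lemma fail_imp_cell:
  assumes "d > 0" "lam > 0" "1 < u" "1 < y" "1 < x" and le: "u * y \<le> x"
  shows "cell d lam u + cell d lam y \<le> cell d lam x"
proof -
  let ?c = "cell d lam"
  have "ln (u * y) \<le> ln x" using assms by (subst ln_le_cancel_iff) auto
  then have "lam * ln (u * y) \<le> lam * ln x" using assms(2) by (intro mult_left_mono) auto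
  then have "lam * ln u + lam * ln y \<le> lam * ln x" using assms by (simp add: ln_mult distrib_left)
  then have "d * real (?c u) + d * real (?c y) < d * (real (?c x) + 1)"
    using cell_bounds[OF assms(1,2,3)] cell_bounds[OF assms(1,2,4)] cell_bounds[OF assms(1,2,5)] by linarith
  then have "d * (real (?c u) + real (?c y)) < d * (real (?c x) + 1)" by (simp only: distrib_left)
  then have "real (?c u) + real (?c y) < real (?c x) + 1" using assms(1) by (simp only: mult_less_cancel_left_pos)
  then show ?thesis by linarith
qed

lemma weight_word: "weight p (map f [1..<Suc n]) = (\<Prod>i=1..n. p (f i))"
proof -
  have "(\<Prod>i\<in>set [1..<Suc n]. p (f i)) = prod_list (map (\<lambda>i. p (f i)) [1..<Suc n])"
    by (rule prod.distinct_set_conv_list) simp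
  moreover have "set [1..<Suc n] = {1..n}" by (simp only: set_upt atLeastLessThanSuc_atLeastAtMost)
  ultimately show ?thesis by (simp only: weight_def map_map o_def)
qed

lemma word_eq_iff:
  assumes "length w = n" shows "map f [1..<Suc n] = w \<longleftrightarrow> (\<forall>i\<in>{1..n}. f i = w ! (i - 1))"
proof -
  have "map f [1..<Suc n] = w \<longleftrightarrow> (\<forall>k<n. f (Suc k) = w ! k)"
    using assms by (auto simp: list_eq_iff_nth_eq nth_append simp del: upt_Suc)
  also have "\<dots> \<longleftrightarrow> (\<forall>i\<in>{1..n}. f i = w ! (i - 1))"
  proof safe
    fix i assume "\<forall>k<n. f (Suc k) = w ! k" "i \<in> {1..n}"
    then show "f i = w ! (i - 1)" by (cases i) auto
  next
    fix k assume "\<forall>i\<in>{1..n}. f i = w ! (i - 1)" "k < n"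
    then show "f (Suc k) = w ! k" by (auto dest: bspec[of _ _ "Suc k"])
  qed
  finally show ?thesis .
qed

locale pareto_sample = prob_space M for M :: "'a measure" +
  fixes X :: "nat \<Rightarrow> 'a \<Rightarrow> real" and lam :: real
  assumes lam: "lam > 0" and indep: "indep_vars (\<lambda>_. borel) X {1..}"
    and law: "\<And>i. i \<ge> 1 \<Longrightarrow> cdf (distr M borel (X i)) = pareto_cdf lam"
begin

definition tail :: "nat \<Rightarrow> real \<Rightarrow> real" where
  "tail n a = prob {\<omega> \<in> space M. I_stat (\<lambda>i. X i \<omega>) n > a}"

lemma rv: "i \<ge> 1 \<Longrightarrow> X i \<in> borel_measurable M"
  using indep unfolding indep_vars_def by auto

lemma law_distribution: "i \<ge> 1 \<Longrightarrow> real_distribution (distr M borel (X i))"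
  by (rule real_distribution_distr) (rule rv)

lemma order_stat_measurable:
  assumes A: "finite A" "A \<subseteq> {1..}" "1 \<le> s" "s \<le> card A"
  shows "(\<lambda>\<omega>. order_stat s (\<lambda>i. X i \<omega>) A) \<in> borel_measurable M"
  unfolding borel_measurable_iff_le
proof
  fix c
  have "{\<omega> \<in> space M. order_stat s (\<lambda>i. X i \<omega>) A \<le> c} = {\<omega> \<in> space M. real s \<le> (\<Sum>i\<in>A. if X i \<omega> \<le> c then 1 else 0)}"
  proof (intro Collect_cong conj_cong refl)
    fix \<omega>
    have "(\<Sum>i\<in>A. of_bool (X i \<omega> \<le> c) :: real) = real (card {i \<in> A. X i \<omega> \<le> c})" by (rule sum_of_bool_card[OF A(1)])
    then show "order_stat s (\<lambda>i. X i \<omega>) A \<le> c \<longleftrightarrow> real s \<le> (\<Sum>i\<in>A. if X i \<omega> \<le> c then 1 else 0)"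
      using order_stat_le_iff[OF A(1,3,4), of "\<lambda>i. X i \<omega>" c] by (simp add: of_bool_def)
  qed
  moreover have "(\<lambda>\<omega>. \<Sum>i\<in>A. if X i \<omega> \<le> c then 1 else 0 :: real) \<in> borel_measurable M"
  proof (rule borel_measurable_sum)
    fix i assume "i \<in> A"
    then have [measurable]: "X i \<in> borel_measurable M" using A(2) by (intro rv) auto
    show "(\<lambda>\<omega>. if X i \<omega> \<le> c then 1 else 0 :: real) \<in> borel_measurable M" by measurable
  qed
  ultimately show "{\<omega> \<in> space M. order_stat s (\<lambda>i. X i \<omega>) A \<le> c} \<in> sets M" by (simp only: borel_measurable_iff_ge)
qed

lemma I_stat_measurable: "(\<lambda>\<omega>. I_stat (\<lambda>i. X i \<omega>) n) \<in> borel_measurable M"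
proof -
  have H: "(\<lambda>\<omega>. H_emp (\<lambda>i. X i \<omega>) n (X l \<omega>)) \<in> borel_measurable M" if l: "l \<in> {1..n}" for l
  proof -
    have [measurable]: "X l \<in> borel_measurable M" using l by (intro rv) auto
    have "(\<lambda>\<omega>. of_bool (order_stat 4 (\<lambda>i. X i \<omega>) A / order_stat 3 (\<lambda>i. X i \<omega>) A < X l \<omega>) :: real) \<in> borel_measurable M"
      if "A \<in> {A. A \<subseteq> {1..n} \<and> card A = 4}" for A
    proof -
      have A: "finite A" "A \<subseteq> {1..}" "card A = 4" using that finite_subset[of A "{1..n}"] by auto
      have [measurable]: "(\<lambda>\<omega>. order_stat 4 (\<lambda>i. X i \<omega>) A) \<in> borel_measurable M" "(\<lambda>\<omega>. order_stat 3 (\<lambda>i. X i \<omega>) A) \<in> borel_measurable M"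
        using A by (auto intro!: order_stat_measurable)
      show ?thesis unfolding of_bool_def by measurable
    qed
    then have [measurable]: "(\<lambda>\<omega>. \<Sum>A | A \<subseteq> {1..n} \<and> card A = 4. of_bool (order_stat 4 (\<lambda>i. X i \<omega>) A / order_stat 3 (\<lambda>i. X i \<omega>) A < X l \<omega>) :: real) \<in> borel_measurable M"
      by (rule borel_measurable_sum)
    show ?thesis unfolding H_emp_def by measurable
  qed
  have F: "(\<lambda>\<omega>. F_emp (\<lambda>i. X i \<omega>) n (X l \<omega>)) \<in> borel_measurable M" if l: "l \<in> {1..n}" for l
  proof -
    have "(\<lambda>\<omega>. of_bool (X i \<omega> < X l \<omega>) :: real) \<in> borel_measurable M" if "i \<in> {1..n}" for i
    proof -
      have [measurable]: "X i \<in> borel_measurable M" "X l \<in> borel_measurable M" using l that by (auto intro!: rv)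
      show ?thesis unfolding of_bool_def by measurable
    qed
    then have [measurable]: "(\<lambda>\<omega>. \<Sum>i=1..n. of_bool (X i \<omega> < X l \<omega>) :: real) \<in> borel_measurable M" by (rule borel_measurable_sum)
    show ?thesis unfolding F_emp_def by measurable
  qed
  have [measurable]: "(\<lambda>\<omega>. \<Sum>l=1..n. H_emp (\<lambda>i. X i \<omega>) n (X l \<omega>) - F_emp (\<lambda>i. X i \<omega>) n (X l \<omega>)) \<in> borel_measurable M"
    by (intro borel_measurable_sum borel_measurable_diff H F)
  show ?thesis unfolding I_stat_def by measurable
qed

lemma tail_event: "{\<omega> \<in> space M. I_stat (\<lambda>i. X i \<omega>) n > a} \<in> events"
proof -
  note [measurable] = I_stat_measurable[of n]
  show ?thesis by measurable
qed

lemma word_prob: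
  assumes c [measurable]: "c \<in> borel \<rightarrow>\<^sub>M count_space UNIV" and S: "finite S"
    and p: "\<And>i v. i \<ge> 1 \<Longrightarrow> v \<in> S \<Longrightarrow> measure (distr M borel (X i)) {x. c x = v} = p v"
    and B: "B \<subseteq> words S n" and n: "n \<ge> 1"
  shows "{\<omega> \<in> space M. map (\<lambda>i. c (X i \<omega>)) [1..<Suc n] \<in> B} \<in> events"
    and "prob {\<omega> \<in> space M. map (\<lambda>i. c (X i \<omega>)) [1..<Suc n] \<in> B} = mass p B"
proof -
  define E where "E w = {\<omega> \<in> space M. map (\<lambda>i. c (X i \<omega>)) [1..<Suc n] = w}" for w
  have cs: "{x. c x = v} \<in> sets borel" for v
  proof -
    have "c -` {v} \<inter> space borel \<in> sets borel" by (rule measurable_sets[OF c]) auto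
    then show ?thesis by (simp add: vimage_def)
  qed
  have E: "E w \<in> events \<and> prob (E w) = weight p w" if w: "w \<in> words S n" for w
  proof -
    have len: "length w = n" and wS: "w ! (i - 1) \<in> S" if "i \<in> {1..n}" for i
      using w that by (auto simp: words_def intro!: subsetD[OF _ nth_mem])
    have len': "length w = n" using w by (simp add: words_def)
    let ?A = "\<lambda>i. {x. c x = w ! (i - 1)}"
    have ne: "{1..n} \<noteq> {}" using n by simp
    have "E w = (\<Inter>i\<in>{1..n}. X i -` ?A i \<inter> space M)"
      unfolding E_def word_eq_iff[OF len'] using ne by auto
    moreover have "X i -` ?A i \<inter> space M \<in> events" if "i \<in> {1..n}" for i
      using that cs by (intro measurable_sets[OF rv]) auto
    then have "(\<Inter>i\<in>{1..n}. X i -` ?A i \<inter> space M) \<in> events" using ne by (intro sets.finite_INT) auto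
    moreover have "prob (\<Inter>i\<in>{1..n}. X i -` ?A i \<inter> space M) = (\<Prod>i\<in>{1..n}. prob (X i -` ?A i \<inter> space M))"
      by (rule indep_varsD[OF indep ne]) (use cs in auto)
    moreover have "(\<Prod>i\<in>{1..n}. prob (X i -` ?A i \<inter> space M)) = (\<Prod>i=1..n. p (w ! (i - 1)))"
    proof (rule prod.cong[OF refl])
      fix i assume i: "i \<in> {1..n}"
      then have "measure (distr M borel (X i)) (?A i) = prob (X i -` ?A i \<inter> space M)"
        using cs by (intro measure_distr rv) auto
      then show "prob (X i -` ?A i \<inter> space M) = p (w ! (i - 1))" using p[of i "w ! (i - 1)"] wS[OF i] i by simp
    qed
    moreover have "(\<Prod>i=1..n. p (w ! (i - 1))) = weight p w"
    proof -
      have "map (\<lambda>i. w ! (i - 1)) [1..<Suc n] = w" using word_eq_iff[OF len', of "\<lambda>i. w ! (i - 1)"] by blast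
      then show ?thesis using weight_word[of p "\<lambda>i. w ! (i - 1)" n] by (simp only:)
    qed
    ultimately show ?thesis by (simp only:)
  qed
  have fin: "finite B" by (rule finite_subset[OF B finite_words[OF S]])
  have eq: "{\<omega> \<in> space M. map (\<lambda>i. c (X i \<omega>)) [1..<Suc n] \<in> B} = (\<Union>w\<in>B. E w)" unfolding E_def by blast
  show "{\<omega> \<in> space M. map (\<lambda>i. c (X i \<omega>)) [1..<Suc n] \<in> B} \<in> events"
    unfolding eq using fin E B by (intro sets.finite_UN) blast+
  have "prob (\<Union>w\<in>B. E w) = (\<Sum>w\<in>B. prob (E w))"
    by (rule finite_measure_finite_Union[OF fin]) (use E B in \<open>auto simp: disjoint_family_on_def E_def\<close>)
  also have "\<dots> = mass p B" unfolding mass_def using E B by (intro sum.cong refl) blast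
  finally show "prob {\<omega> \<in> space M. map (\<lambda>i. c (X i \<omega>)) [1..<Suc n] \<in> B} = mass p B" unfolding eq .
qed

lemma AE_greater_1: "i \<ge> 1 \<Longrightarrow> AE \<omega> in M. X i \<omega> > 1"
proof -
  assume i: "i \<ge> 1"
  have ev: "X i -` {..1} \<inter> space M \<in> events" by (rule measurable_sets[OF rv[OF i]]) simp
  have "prob (X i -` {..1} \<inter> space M) = cdf (distr M borel (X i)) 1"
    unfolding cdf_def by (rule measure_distr[symmetric, OF rv[OF i]]) simp
  also have "\<dots> = 0" unfolding law[OF i] by (simp add: pareto_cdf_def)
  finally have "AE \<omega> in M. \<omega> \<notin> X i -` {..1} \<inter> space M" using prob_eq_0[OF ev] by simp
  then show ?thesis using AE_space by eventually_elim auto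
qed

text \<open>On each grid, equal values have equal letters; two independent letters coincide with at most the largest letter
  probability, which tends to 0.\<close>

lemma AE_distinct:
  assumes ij: "i \<ge> 1" "j \<ge> 1" "i \<noteq> j" shows "AE \<omega> in M. X i \<omega> \<noteq> X j \<omega>"
proof -
  have [measurable]: "X i \<in> borel_measurable M" "X j \<in> borel_measurable M" using ij by (auto intro: rv)
  have ev: "{\<omega> \<in> space M. X i \<omega> = X j \<omega>} \<in> events" by measurable
  \<comment> \<open>A bound on the largest letter probability: bounded cells and the last cell.\<close>
  let ?b = "\<lambda>m. (1 - exp (- mesh m)) + exp (- mesh m * real (depth m))"
  have "prob {\<omega> \<in> space M. X i \<omega> = X j \<omega>} \<le> ?b m" for m
  proof -
    let ?L = "letter (mesh m) (depth m) lam" and ?p = "upper_weight (mesh m) (depth m)" and ?S = "alphabet (depth m)"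
    let ?A = "\<lambda>v. {x. ?L x = v}"
    have As: "?A v \<in> sets borel" for v
    proof -
      have "?L -` {v} \<inter> space borel \<in> sets borel" by (rule measurable_sets[OF measurable_letter]) auto
      then show ?thesis by (simp add: vimage_def)
    qed
    have pk: "prob (X k -` ?A v \<inter> space M) = ?p v" if "k \<ge> 1" "v \<in> ?S" for k v
    proof -
      have "prob (X k -` ?A v \<inter> space M) = measure (distr M borel (X k)) (?A v)"
        by (rule measure_distr[symmetric, OF rv[OF that(1)]]) (simp add: As)
      also have "\<dots> = ?p v" by (rule letter_law[OF law_distribution[OF that(1)] law[OF that(1)] lam mesh_pos that(2)])
      finally show ?thesis .
    qed
    have both: "prob (\<Inter>k\<in>{i, j}. X k -` ?A v \<inter> space M) = ?p v * ?p v" if "v \<in> ?S" for v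
    proof -
      have "prob (\<Inter>k\<in>{i, j}. X k -` ?A v \<inter> space M) = (\<Prod>k\<in>{i, j}. prob (X k -` ?A v \<inter> space M))"
        by (rule indep_varsD[OF indep]) (use ij As in auto)
      then show ?thesis using ij pk[OF _ that] by simp
    qed
    have evs: "(\<Inter>k\<in>{i, j}. X k -` ?A v \<inter> space M) \<in> events" for v
      using As measurable_sets[OF rv[OF ij(1)]] measurable_sets[OF rv[OF ij(2)]] by auto
    have "prob {\<omega> \<in> space M. X i \<omega> = X j \<omega>} \<le> prob (\<Union>v\<in>?S. \<Inter>k\<in>{i, j}. X k -` ?A v \<inter> space M)"
    proof (rule finite_measure_mono)
      show "{\<omega> \<in> space M. X i \<omega> = X j \<omega>} \<subseteq> (\<Union>v\<in>?S. \<Inter>k\<in>{i, j}. X k -` ?A v \<inter> space M)"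
        using letter_in_alphabet[of "mesh m" "depth m" lam] by auto
      show "(\<Union>v\<in>?S. \<Inter>k\<in>{i, j}. X k -` ?A v \<inter> space M) \<in> events" using evs alphabet(1) by (intro sets.finite_UN)
    qed
    also have "\<dots> \<le> (\<Sum>v\<in>?S. prob (\<Inter>k\<in>{i, j}. X k -` ?A v \<inter> space M))"
      by (rule finite_measure_subadditive_finite[OF alphabet(1)]) (use evs in blast)
    also have "\<dots> = (\<Sum>v\<in>?S. ?p v * ?p v)" by (intro sum.cong refl both)
    also have "\<dots> \<le> (\<Sum>v\<in>?S. ?b m * ?p v)"
    proof (intro sum_mono mult_right_mono)
      fix v assume v: "v \<in> ?S"
      have "exp (- mesh m * (real v - 2)) * (1 - exp (- mesh m)) \<le> 1 * (1 - exp (- mesh m))"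
        using v mesh_pos[of m] by (intro mult_right_mono) (auto simp: alphabet_def)
      moreover have "0 \<le> 1 - exp (- mesh m)" using mesh_pos[of m] by simp
      ultimately show "?p v \<le> ?b m" by (auto simp: upper_weight_def intro: add_increasing add_increasing2)
      show "0 \<le> ?p v" using upper_weight_pos[OF mesh_pos, of m "depth m" v] by simp
    qed
    also have "\<dots> = ?b m" by (simp only: sum_distrib_left[symmetric] upper_weight_sum mult_1_right)
    finally show ?thesis .
  qed
  moreover have "?b \<longlonglongrightarrow> 0"
  proof -
    have "- mesh m * real (depth m) = - real (Suc m)" for m
      unfolding mesh_def depth_def power2_eq_square of_nat_mult by (simp del: of_nat_Suc)
    then have "?b = (\<lambda>m. (1 - exp (- (1 / real (Suc m)))) + exp (- real (Suc m)))" by (simp add: mesh_def)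
    also have "\<dots> \<longlonglongrightarrow> 0" by real_asymp
    finally show ?thesis .
  qed
  ultimately have "prob {\<omega> \<in> space M. X i \<omega> = X j \<omega>} \<le> 0" by (intro LIMSEQ_le_const) blast+
  then have "prob {\<omega> \<in> space M. X i \<omega> = X j \<omega>} = 0" using measure_nonneg[of M "{\<omega> \<in> space M. X i \<omega> = X j \<omega>}"] by linarith
  then have "AE \<omega> in M. \<omega> \<notin> {\<omega> \<in> space M. X i \<omega> = X j \<omega>}" using prob_eq_0[OF ev] by simp
  then show ?thesis using AE_space by eventually_elim auto
qed

lemma AE_greater_1_distinct: "AE \<omega> in M. (\<forall>i\<in>{1..n}. X i \<omega> > 1) \<and> inj_on (\<lambda>i. X i \<omega>) {1..n}"
proof -
  have "AE \<omega> in M. \<forall>i\<in>{1..n}. X i \<omega> > 1"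
    by (rule AE_finite_allI) (auto intro: AE_greater_1)
  moreover have "AE \<omega> in M. \<forall>i\<in>{1..n}. \<forall>j\<in>{1..n}. i \<noteq> j \<longrightarrow> X i \<omega> \<noteq> X j \<omega>"
  proof (intro AE_finite_allI)
    fix i j assume "i \<in> {1..n}" "j \<in> {1..n}"
    then show "AE \<omega> in M. i \<noteq> j \<longrightarrow> X i \<omega> \<noteq> X j \<omega>"
      using AE_distinct[of i j] by (cases "i = j") auto
  qed auto
  ultimately show ?thesis
  proof eventually_elim
    case (elim \<omega>)
    then show ?case unfolding inj_on_def by blast
  qed
qed

lemma tail_upper:
  assumes d: "d > 0" and n: "n \<ge> 6"
  shows "tail n a \<le> mass (upper_weight d K)
        {w \<in> words (alphabet K) n. fail_prob (alphabet K) (freq (mset w)) \<le> 1/2 - a + 300 / real n}"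
proof -
  let ?L = "letter d K lam"
  define B where "B = {w \<in> words (alphabet K) n. fail_prob (alphabet K) (freq (mset w)) \<le> 1/2 - a + 300 / real n}"
  have B: "B \<subseteq> words (alphabet K) n" by (auto simp: B_def)
  have n1: "n \<ge> 1" "n \<ge> 4" using n by auto
  have p: "measure (distr M borel (X i)) {x. ?L x = v} = upper_weight d K v" if "i \<ge> 1" "v \<in> alphabet K" for i v
    by (rule letter_law[OF law_distribution[OF that(1)] law[OF that(1)] lam d that(2)])
  note W = word_prob[OF measurable_letter[of d K lam] alphabet(1) p B n1(1)]
  have "tail n a \<le> prob {\<omega> \<in> space M. map (\<lambda>i. ?L (X i \<omega>)) [1..<Suc n] \<in> B}"
    unfolding tail_def
  proof (rule finite_measure_mono_AE[OF _ W(1)])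
    show "AE \<omega> in M. \<omega> \<in> {\<omega> \<in> space M. I_stat (\<lambda>i. X i \<omega>) n > a} \<longrightarrow> \<omega> \<in> {\<omega> \<in> space M. map (\<lambda>i. ?L (X i \<omega>)) [1..<Suc n] \<in> B}"
      using AE_greater_1_distinct[of n]
    proof eventually_elim
      case (elim \<omega>)
      define f where "f i = ?L (X i \<omega>)" for i
      have x1: "1 < X i \<omega>" if "i \<in> {1..n}" for i using elim that by blast
      have fS: "f i \<in> alphabet K" for i unfolding f_def by (rule letter_in_alphabet)
      have "triple_frac (\<lambda>j l i. f j + f l \<le> f i) n \<le> triple_frac (\<lambda>j l i. X j \<omega> * X l \<omega> \<le> X i \<omega>) n"
        by (rule triple_frac_mono) (unfold f_def, rule letter_imp_fail[OF d lam x1 x1 x1], auto)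
      moreover have "I_stat (\<lambda>i. X i \<omega>) n = 1/2 + 1 / (2 * real n) - triple_frac (\<lambda>j l i. X j \<omega> * X l \<omega> \<le> X i \<omega>) n"
        by (rule I_stat_triples(2)[OF n1(2)]) (use elim in auto)
      moreover have "\<bar>triple_frac (\<lambda>j l i. f j + f l \<le> f i) n - fail_prob (alphabet K) (freq (mset (map f [1..<Suc n])))\<bar> \<le> 288 / real n"
        by (rule triple_frac_word[OF n alphabet(1) fS])
      moreover have "1 / (2 * real n) + 288 / real n \<le> 300 / real n" using n by (simp add: field_simps)
      ultimately have "fail_prob (alphabet K) (freq (mset (map f [1..<Suc n]))) \<le> 1/2 - a + 300 / real n"
        if "I_stat (\<lambda>i. X i \<omega>) n > a" using that by linarith
      moreover have "map f [1..<Suc n] \<in> words (alphabet K) n" using fS by (auto simp: words_def)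
      ultimately have "I_stat (\<lambda>i. X i \<omega>) n > a \<longrightarrow> map f [1..<Suc n] \<in> B" unfolding B_def by blast
      then show ?case unfolding f_def by blast
    qed
  qed
  also have "\<dots> = mass (upper_weight d K) B" by (rule W(2))
  finally show ?thesis unfolding B_def .
qed

text \<open>Stated for arbitrary sets of words, because at the level \<open>1/2\<close> the number of failures has to be counted
  exactly.\<close>

lemma tail_lower_words:
  assumes d: "d > 0" and n: "n \<ge> 6" and S: "finite S" "S \<subseteq> {1..}" and B: "B \<subseteq> words S n"
    and good: "\<And>f. map f [1..<Suc n] \<in> B \<Longrightarrow> triple_frac (\<lambda>j l i. f j + f l \<le> f i) n < 1/2 - a + 1 / (2 * real n)"
  shows "mass (lower_weight d) B \<le> tail n a"
proof -
  let ?c = "cell d lam"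
  have n1: "n \<ge> 1" "n \<ge> 4" using n by auto
  have p: "measure (distr M borel (X i)) {x. ?c x = v} = lower_weight d v" if "i \<ge> 1" "v \<in> S" for i v
    by (rule cell_law[OF law_distribution[OF that(1)] law[OF that(1)] lam d])
  note W = word_prob[OF measurable_cell[of d lam] S(1) p B n1(1)]
  have "prob {\<omega> \<in> space M. map (\<lambda>i. ?c (X i \<omega>)) [1..<Suc n] \<in> B} \<le> tail n a"
    unfolding tail_def
  proof (rule finite_measure_mono[OF _ tail_event], rule subsetI)
    fix \<omega> assume \<omega>: "\<omega> \<in> {\<omega> \<in> space M. map (\<lambda>i. ?c (X i \<omega>)) [1..<Suc n] \<in> B}"
    define f where "f i = ?c (X i \<omega>)" for i
    have fB: "map f [1..<Suc n] \<in> B" using \<omega> unfolding f_def by blast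
    have x1: "1 < X i \<omega>" if i: "i \<in> {1..n}" for i
    proof -
      have "f i \<in> set (map f [1..<Suc n])" using i by (simp del: upt_Suc)
      moreover have "map f [1..<Suc n] \<in> words S n" using fB B by (rule subsetD[rotated])
      then have "set (map f [1..<Suc n]) \<subseteq> S" unfolding words_def by blast
      ultimately have "f i \<in> S" by blast
      then have "\<not> ?c (X i \<omega>) \<le> 0" using S(2) unfolding f_def by auto
      then have "exp (real (Suc 0) * d / lam) < X i \<omega>" using cell_le_iff[OF d lam, of "X i \<omega>" 0] by linarith
      moreover have "1 < exp (real (Suc 0) * d / lam)" using d lam by simp
      ultimately show ?thesis by linarith
    qed
    have "triple_frac (\<lambda>j l i. X j \<omega> * X l \<omega> \<le> X i \<omega>) n \<le> triple_frac (\<lambda>j l i. f j + f l \<le> f i) n"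
      by (rule triple_frac_mono) (unfold f_def, rule fail_imp_cell[OF d lam x1 x1 x1], auto)
    moreover have "1/2 + 1 / (2 * real n) - triple_frac (\<lambda>j l i. X j \<omega> * X l \<omega> \<le> X i \<omega>) n \<le> I_stat (\<lambda>i. X i \<omega>) n"
      by (rule I_stat_triples(1)[OF n1(2) x1])
    ultimately have "I_stat (\<lambda>i. X i \<omega>) n > a" using good[OF fB] by linarith
    then show "\<omega> \<in> {\<omega> \<in> space M. I_stat (\<lambda>i. X i \<omega>) n > a}" using \<omega> by blast
  qed
  moreover have "prob {\<omega> \<in> space M. map (\<lambda>i. ?c (X i \<omega>)) [1..<Suc n] \<in> B} = mass (lower_weight d) B" by (rule W(2))
  ultimately show ?thesis by linarith
qed

lemma tail_lower:
  assumes d: "d > 0" and n: "n \<ge> 6" and S: "finite S" "S \<subseteq> {1..}"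
  shows "mass (lower_weight d) {w \<in> words S n. fail_prob S (freq (mset w)) < 1/2 - a - 300 / real n} \<le> tail n a"
proof (rule tail_lower_words[OF d n S])
  fix f assume f: "map f [1..<Suc n] \<in> {w \<in> words S n. fail_prob S (freq (mset w)) < 1/2 - a - 300 / real n}"
  have fS: "f i \<in> S" if i: "i \<in> {1..n}" for i
  proof -
    have "f i \<in> set (map f [1..<Suc n])" using i by (simp del: upt_Suc)
    then show ?thesis using f by (auto simp: words_def simp del: upt_Suc)
  qed
  have "\<bar>triple_frac (\<lambda>j l i. f j + f l \<le> f i) n - fail_prob S (freq (mset (map f [1..<Suc n])))\<bar> \<le> 288 / real n"
    by (rule triple_frac_word[OF n S(1) fS])
  moreover have "288 / real n \<le> 300 / real n" using n by (intro divide_right_mono) auto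
  moreover have "fail_prob S (freq (mset (map f [1..<Suc n]))) < 1/2 - a - 300 / real n" using f by blast
  moreover have "0 \<le> 1 / (2 * real n)" by simp
  ultimately show "triple_frac (\<lambda>j l i. f j + f l \<le> f i) n < 1/2 - a + 1 / (2 * real n)" by linarith
qed auto

text \<open>For \<open>d = ln 2\<close> a variable falls into the cell with index 1 with probability \<open>1/2 * (1 - 1/2) = 1/4\<close>. If all
  variables do so, the sample lies in one octave, and nothing fails.\<close>

lemma tail_half:
  assumes n: "n \<ge> 6" shows "(1/4) ^ n \<le> tail n (1/2)"
proof -
  have "mass (lower_weight (ln 2)) {replicate n 1} \<le> tail n (1/2)"
  proof (rule tail_lower_words[OF _ n, of "ln 2" "{1}"])
    fix f assume "map f [1..<Suc n] \<in> {replicate n (1::nat)}"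
    then have f: "f i = 1" if "i \<in> {1..n}" for i
      using word_eq_iff[of "replicate n 1" n f] that by auto
    have "triple_count (\<lambda>j l i. f j + f l \<le> f i) n = 0"
      unfolding triple_count_def
    proof (intro sum.neutral ballI)
      fix l i assume li: "l \<in> {1..n}" "i \<in> {1..n}"
      have "{j \<in> {1..n}. f j + f l \<le> f i} = {}" using f li by force
      then show "card {j \<in> {1..n}. f j + f l \<le> f i} choose 3 = 0" by (simp only: card.empty) simp
    qed
    then show "triple_frac (\<lambda>j l i. f j + f l \<le> f i) n < 1/2 - 1/2 + 1 / (2 * real n)"
      using n by (simp add: triple_frac_def)
  qed (auto simp: words_def)
  moreover have "weight (lower_weight (ln 2)) (replicate n 1) = (1/4) ^ n"
  proof -
    have l: "lower_weight (ln 2) 1 = 1/4" by (simp add: lower_weight_def exp_minus)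
    show ?thesis by (simp only: weight_def map_replicate l prod_list_replicate)
  qed
  ultimately show ?thesis by (simp add: mass_def)
qed

lemma sandwiched_tail: "sandwiched tail"
  unfolding sandwiched_def
proof (intro conjI allI impI)
  show "antimono (tail n)" for n
  proof (rule antimonoI)
    fix a b :: real assume "a \<le> b"
    then show "tail n b \<le> tail n a" unfolding tail_def
      by (intro finite_measure_mono tail_event) auto
  qed
qed (use tail_half tail_upper tail_lower in \<open>auto simp: tail_def\<close>)

end

text \<open>A sample on an infinite product space, needed to define the rate function independently of the model.\<close>

lemma canonical_sample: "pareto_sample (\<Pi>\<^sub>M i\<in>{1..}. pareto) (\<lambda>i \<omega>. \<omega> i) 1"
proof -
  let ?M = "\<Pi>\<^sub>M i\<in>{1::nat..}. pareto"
  have ps: "prob_space ?M" by (rule prob_space_PiM) (rule prob_space_pareto)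
  have distr: "distr ?M borel (\<lambda>\<omega>. \<omega> i) = pareto" if "i \<ge> 1" for i
  proof -
    have "distr ?M borel (\<lambda>\<omega>. \<omega> i) = distr ?M pareto (\<lambda>\<omega>. \<omega> i)" by (rule distr_cong) auto
    also have "\<dots> = pareto" by (rule distr_PiM_component) (use that prob_space_pareto in auto)
    finally show ?thesis .
  qed
  show ?thesis
  proof (intro pareto_sample.intro pareto_sample_axioms.intro ps)
    show "prob_space.indep_vars ?M (\<lambda>_. borel) (\<lambda>i \<omega>. \<omega> i) {1..}"
    proof (subst prob_space.indep_vars_iff_distr_eq_PiM'[OF ps])
      show "{1::nat..} \<noteq> {}" by auto
      show "(\<lambda>\<omega>. \<omega> i) \<in> borel_measurable ?M" if "i \<in> {1..}" for i
      proof -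
        have "(\<lambda>\<omega>. \<omega> i) \<in> measurable ?M pareto" using that by (rule measurable_component_singleton)
        then show ?thesis by (simp cong: measurable_cong_sets)
      qed
      have "distr ?M (\<Pi>\<^sub>M i\<in>{1..}. borel) (\<lambda>\<omega>. \<lambda>i\<in>{1..}. \<omega> i) = distr ?M ?M (\<lambda>\<omega>. \<omega>)"
      proof (rule distr_cong)
        show "sets (\<Pi>\<^sub>M i\<in>{1::nat..}. borel) = sets ?M" by (rule sets_PiM_cong) auto
        show "(\<lambda>i\<in>{1..}. \<omega> i) = \<omega>" if "\<omega> \<in> space ?M" for \<omega>
          using that by (auto simp: space_PiM PiE_restrict)
      qed simp
      also have "\<dots> = ?M" by (rule distr_id)
      also have "\<dots> = (\<Pi>\<^sub>M i\<in>{1..}. distr ?M borel (\<lambda>\<omega>. \<omega> i))" 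
      proof (rule PiM_cong[OF refl])
        fix i :: nat assume "i \<in> {1..}"
        then show "pareto = distr ?M borel (\<lambda>\<omega>. \<omega> i)" using distr[of i] by (simp only: atLeast_iff)
      qed
      finally show "distr ?M (\<Pi>\<^sub>M i\<in>{1..}. borel) (\<lambda>\<omega>. \<lambda>i\<in>{1..}. \<omega> i) = (\<Pi>\<^sub>M i\<in>{1..}. distr ?M borel (\<lambda>\<omega>. \<omega> i))" .
    qed
    show "cdf (distr ?M borel (\<lambda>\<omega>. \<omega> i)) = pareto_cdf 1" if "i \<ge> 1" for i
      using distr[OF that] cdf_pareto by simp
  qed simp
qed

section \<open>The theorem\<close>

definition canonical_tail :: "nat \<Rightarrow> real \<Rightarrow> real" where
  "canonical_tail = pareto_sample.tail (\<Pi>\<^sub>M i\<in>{1..}. pareto) (\<lambda>i \<omega>. \<omega> i)"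

lemma sandwiched_canonical: "sandwiched canonical_tail"
  unfolding canonical_tail_def by (rule pareto_sample.sandwiched_tail[OF canonical_sample])

text \<open>Above \<open>a = 1/2\<close> the tail vanishes; the value at \<open>1/2\<close> is the exponent of the best octave.\<close>

definition rate_function :: "real \<Rightarrow> ereal" where
  "rate_function a = (if a < 1/2 then ereal (rate canonical_tail a) else if a = 1/2 then ereal (ln 4) else \<infinity>)"

lemma sandwiched_tail_limit:
  assumes P: "sandwiched P"
  shows "(\<lambda>n. ereal (1 / real n) * eln (P n a)) \<longlonglongrightarrow> - rate_function a"
proof (cases "a \<le> 1/2")
  case True
  have "log_rate P a \<longlonglongrightarrow> (if a < 1/2 then rate canonical_tail a else ln 4)"
  proof (cases "a < 1/2")
    case True
    then show ?thesis using log_rate_tendsto[OF sandwiched_canonical P True] by simp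
  next
    case False
    then have half: "a = 1/2" using \<open>a \<le> 1/2\<close> by linarith
    show ?thesis unfolding half using log_rate_at_half[OF P] by simp
  qed
  then have "(\<lambda>n. ereal (- log_rate P a n)) \<longlonglongrightarrow> ereal (- (if a < 1/2 then rate canonical_tail a else ln 4))"
    by (intro tendsto_intros)
  moreover have "ereal (- (if a < 1/2 then rate canonical_tail a else ln 4)) = - rate_function a"
    using True by (simp add: rate_function_def)
  ultimately have lim: "(\<lambda>n. ereal (- log_rate P a n)) \<longlonglongrightarrow> - rate_function a" by (simp only:)
  have "\<forall>\<^sub>F n in sequentially. ereal (- log_rate P a n) = ereal (1 / real n) * eln (P n a)"
    using eventually_ge_at_top[of 6]
  proof eventually_elim
    case (elim n)
    show ?case using sandwiched_pos(2)[OF P True elim] by (simp add: eln_def log_rate_def)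
  qed
  with lim show ?thesis by (rule Lim_transform_eventually)
next
  case False
  then have "\<forall>\<^sub>F n in sequentially. P n a = 0" by (intro tail_zero_above_half[OF P]) simp
  then have "\<forall>\<^sub>F n in sequentially. - \<infinity> = ereal (1 / real n) * eln (P n a)"
    using eventually_gt_at_top[of 0] by eventually_elim (simp add: eln_def)
  then have "(\<lambda>n. ereal (1 / real n) * eln (P n a)) \<longlonglongrightarrow> - \<infinity>"
    by (rule Lim_transform_eventually[OF tendsto_const])
  then show ?thesis using False by (simp add: rate_function_def)
qed

theorem theorem5:
  shows "\<exists>f :: real \<Rightarrow> ereal.
      (\<forall>(M :: 'a measure) (X :: nat \<Rightarrow> 'a \<Rightarrow> real) (lam :: real).
         lam > 0 \<longrightarrow>
         prob_space M \<longrightarrow>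
         prob_space.indep_vars M (\<lambda>_. borel) X {1..} \<longrightarrow>
         (\<forall>i\<ge>1. cdf (distr M borel (X i)) = pareto_cdf lam) \<longrightarrow>
         (\<forall>a>0. (\<lambda>n. ereal (1 / real n) *
                     eln (measure M {\<omega> \<in> space M. I_stat (\<lambda>i. X i \<omega>) n > a}))
                 \<longlonglongrightarrow> - f a)) \<and>
      (\<exists>a0>0. (\<forall>a\<in>{0<..<a0}. \<bar>f a\<bar> \<noteq> \<infinity>) \<and> continuous_on {0<..<a0} f) \<and>
      ((\<lambda>a. f a / ereal (a\<^sup>2 / (50 * Delta4_sq))) \<longlongrightarrow> 1) (at_right 0) \<and>
      Delta4_sq = 271 / 52500 \<and>
      \<bar>1 / (50 * Delta4_sq) - 3.875\<bar> \<le> 0.0005"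
proof (intro exI[of _ rate_function] conjI allI impI)
  fix M :: "'a measure" and X :: "nat \<Rightarrow> 'a \<Rightarrow> real" and lam a :: real
  assume "lam > 0" and M: "prob_space M" and "prob_space.indep_vars M (\<lambda>_. borel) X {1..}"
    and "\<forall>i\<ge>1. cdf (distr M borel (X i)) = pareto_cdf lam"
  then interpret pareto_sample M X lam by (intro pareto_sample.intro pareto_sample_axioms.intro) auto
  show "(\<lambda>n. ereal (1 / real n) * eln (measure M {\<omega> \<in> space M. I_stat (\<lambda>i. X i \<omega>) n > a})) \<longlonglongrightarrow> - rate_function a"
    using sandwiched_tail_limit[OF sandwiched_tail, of a] unfolding tail_def .
next
  show "\<exists>a0>0. (\<forall>a\<in>{0<..<a0}. \<bar>rate_function a\<bar> \<noteq> \<infinity>) \<and> continuous_on {0<..<a0} rate_function"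
  proof (intro exI[of _ "1/2"] conjI ballI)
    have "continuous_on {0<..<1/2} (\<lambda>a. ereal (rate canonical_tail a))"
      using rate_continuous[OF sandwiched_canonical]
      by (intro continuous_on_ereal continuous_at_imp_continuous_on) auto
    then show "continuous_on {0<..<1/2} rate_function"
      by (rule continuous_on_eq) (auto simp: rate_function_def)
  qed (auto simp: rate_function_def)
next
  have lim: "((\<lambda>a. ereal (rate canonical_tail a / (a\<^sup>2 / (50 * Delta4_sq)))) \<longlongrightarrow> ereal 1) (at_right 0)"
    by (rule tendsto_ereal[OF rate_asymptotics[OF sandwiched_canonical]])
  have "\<forall>\<^sub>F a in at_right 0. ereal (rate canonical_tail a / (a\<^sup>2 / (50 * Delta4_sq))) = rate_function a / ereal (a\<^sup>2 / (50 * Delta4_sq))"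
    unfolding eventually_at_right_field
    by (intro exI[of _ "1/2"]) (auto simp: rate_function_def Delta4_sq_value)
  from Lim_transform_eventually[OF lim this]
  show "((\<lambda>a. rate_function a / ereal (a\<^sup>2 / (50 * Delta4_sq))) \<longlongrightarrow> 1) (at_right 0)"
    unfolding one_ereal_def .
next
  show "Delta4_sq = 271 / 52500" by (rule Delta4_sq_value)
  show "\<bar>1 / (50 * Delta4_sq) - 3.875\<bar> \<le> 0.0005" by (simp add: Delta4_sq_value)
qed

end
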